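(* Let $t\ge s\ge1$ be integers, $\mathbf S\sim\mathbf W_s(t,\mathbf I_s,\mathbf\Omega)$, and suppose $\mathbf\Omega$ has exactly $L\le s$ non-zero eigenvalues, distinct, $\lambda_1>\dots>\lambda_L>0$. Let $\phi_s$ be the smallest eigenvalue of $\mathbf S$. For $x\in(0,\infty)$ define the $s\times s$ matrix $\mathbf\Psi(x)$ by $$\{\mathbf\Psi(x)\}_{i,j}=\begin{cases}2^{(2i-s-t)/2}\,Q_{s+t-2i+1,\,t-s}\big(\sqrt{2\lambda_j},\sqrt{2x}\big), & j=1,\dots,L,\\ \Gamma(t+s-i-j+1,x), & j=L+1,\dots,s,\end{cases}$$ and let $\mathbf\Psi(0)$ be given by the same formula at $x=0$. Then the c.d.f.\ of $\phi_s$ is $$F_{\phi_s}(x)=1-\frac{|\mathbf\Psi(x)|}{|\mathbf\Psi(0)|}.$$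
   Context: Complex noncentral Wishart: $\mathbf S=\mathbf X\mathbf X^\dagger$ where $\mathbf X$ is an $s\times t$ complex random matrix with independent entries $\{\mathbf X\}_{ij}\sim\mathcal{CN}(\{\mathbf M\}_{ij},1)$ and $\mathbf\Omega=\mathbf M\mathbf M^\dagger$; denoted $\mathbf W_s(t,\mathbf I_s,\mathbf\Omega)$. Nuttall $Q$-function: $Q_{p,q}(a,b)=\int_b^\infty x^p\exp\!\big(-\tfrac{x^2+a^2}{2}\big)I_q(ax)\,\mathrm dx$, with $I_q$ the $q$th order modified Bessel function of the first kind. Upper incomplete gamma function: $\Gamma(p,x)=\int_x^\infty u^{p-1}e^{-u}\,\mathrm du$. *)

theory Defs
  imports "HOL-Probability.Probability" "Jordan_Normal_Form.Schur_Decomposition"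
begin

definition besselI :: "nat \<Rightarrow> real \<Rightarrow> real" where
  "besselI q z = (\<Sum>k. (z / 2) ^ (2 * k + q) / (fact k * fact (k + q)))"

definition nuttallQ :: "nat \<Rightarrow> nat \<Rightarrow> real \<Rightarrow> real \<Rightarrow> real" where
  "nuttallQ p q a b =
     (LINT x:{b..}|lborel. x ^ p * exp (- (x\<^sup>2 + a\<^sup>2) / 2) * besselI q (a * x))"

definition upper_inc_Gamma :: "nat \<Rightarrow> real \<Rightarrow> real" where
  "upper_inc_Gamma p x = (LINT u:{x..}|lborel. u ^ (p - 1) * exp (- u))"

definition cn_density :: "complex \<Rightarrow> complex \<Rightarrow> real" where
  "cn_density m z = exp (- (cmod (z - m))\<^sup>2) / pi"

text \<open>Smallest eigenvalue of a (Hermitian) complex matrix; its eigenvalues are real.\<close>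
definition smallest_eigenvalue :: "complex mat \<Rightarrow> real" where
  "smallest_eigenvalue A = Min {Re z | z. eigenvalue A z}"

text \<open>The matrix Psi(x) of the theorem (0-indexed; row i, column j stand for i+1, j+1).\<close>
definition Psi :: "nat \<Rightarrow> nat \<Rightarrow> nat \<Rightarrow> (nat \<Rightarrow> real) \<Rightarrow> real \<Rightarrow> real mat" where
  "Psi s t L lam x = mat s s (\<lambda>(i, j).
     if j < L then
       2 powr ((2 * real (i + 1) - real s - real t) / 2) *
       nuttallQ (s + t - 2 * (i + 1) + 1) (t - s) (sqrt (2 * lam (j + 1))) (sqrt (2 * x))
     else upper_inc_Gamma (t + s - (i + 1) - (j + 1) + 1) x)"

end

theory Submission
  imports Defs
begin

text \<open>
  The formula is a statement about the heat flow. For a polynomial \<open>f\<close> in the entries of \<open>X\<close> and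
  their conjugates, \<open>E f(X) = (e\<^sup>\<Delta> f)(M)\<close> with \<open>\<Delta> = \<Sum> \<partial>\<^sub>i\<^sub>j \<partial>\<^sub>i\<^sub>j*\<close>. On functions of the eigenvalues \<open>\<lambda>\<close> of
  \<open>XX*\<close>, \<open>\<Delta>\<close> acts as \<open>V\<^sup>-\<^sup>1 (\<Sum> D\<^sub>j) V\<close>, where \<open>V\<close> is the Vandermonde product and
  \<open>D = \<lambda>\<partial>\<^sup>2 + (t - s + 1)\<partial>\<close>: both operators act by the same rule on products of power sums. Hence
  \<open>V(\<lambda>) E f = e\<^sup>\<Sigma>\<^sup>D (V f)(\<lambda>)\<close>, and for \<open>f = \<Prod> h(\<lambda>\<^sub>j)\<close> the right-hand side is a determinant of
  one-dimensional transforms of \<open>\<lambda>\<^sup>i h(\<lambda>)\<close> with the noncentral chi-square kernel. No invariant integration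
  over unitary groups and no change of variables to eigenvalues is needed. A Gaussian tilt extends
  the identity to \<open>h(w) = p(w) e\<^sup>-\<^sup>\<theta>\<^sup>w\<close>, coinciding zero eigenvalues are reached by a limit, and bounded
  pointwise limits give \<open>h = 1\<close> on \<open>(x, \<infinity>)\<close>, \<open>h = 0\<close> elsewhere. The choice \<open>h = 1\<close> yields
  \<open>|\<Psi>(0)|\<close> as the normalising constant.
\<close>

section \<open>Polynomial functions and partial derivatives\<close>

text \<open>The two operators are compared on formal words in power sums, because for fixed
  \<open>s\<close> the power sums obey algebraic relations: a rule on words makes sense in every
  realisation, and nothing has to be shown well defined. The matrix side and the eigenvalue side
  then meet only in the numbers tr S^n, so no measurable choice of eigenvalues is needed. The
  obstacle is growth: bounded limits cannot start from polynomials. The product of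
  \<open>exp (- \<theta> * w)\<close> over the eigenvalues is exp (- \<theta> tr S), which splits
  over the entries, and completing the square turns CN(m, 1) into a multiple of CN(\<tau> m, \<tau>)
  with \<tau> = 1 / (1 + \<theta>). The heat flow then runs for time \<tau> from eigenvalues
  \<tau>^2 \<xi>. Freed of exp (- \<xi>) and of powers of \<xi>, the kernel integral is a convergent
  power series in \<xi>. Zero eigenvalues therefore turn columns into Taylor coefficients, which are
  the incomplete gamma columns up to factorials. The identity has degree \<open>s\<close> in
  \<open>h\<close>, so sums of admissible \<open>h\<close> are not automatically admissible; each
  approximant has to be admissible by itself.\<close>

definition pmonom :: "'v set \<Rightarrow> ('v \<Rightarrow> nat) \<Rightarrow> ('v \<Rightarrow> complex) \<Rightarrow> complex" where
  "pmonom A n x = (\<Prod>v\<in>A. x v ^ n v)"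

text \<open>Polynomials are kept as functions, since derivatives, integrals and power sums all
  concern values. With scaled monomials and binary sums as the only generators, induction reduces
  every linear statement to a single monomial.\<close>

inductive poly_fun :: "'v set \<Rightarrow> (('v \<Rightarrow> complex) \<Rightarrow> complex) \<Rightarrow> bool" for A where
  poly_fun_pmonom: "poly_fun A (\<lambda>x. c * pmonom A n x)"
| poly_fun_add: "poly_fun A f \<Longrightarrow> poly_fun A g \<Longrightarrow> poly_fun A (\<lambda>x. f x + g x)"

lemma poly_fun_const [simp, intro]: "poly_fun A (\<lambda>x. c)"
  using poly_fun_pmonom[of A c "\<lambda>_. 0"] by (simp add: pmonom_def)

lemma poly_fun_mult_pmonom:
  assumes "poly_fun A f" shows "poly_fun A (\<lambda>x. c * pmonom A n x * f x)"
  using assms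
proof induction
  case (poly_fun_pmonom d m)
  have "(\<lambda>x. c * pmonom A n x * (d * pmonom A m x)) = (\<lambda>x. (c * d) * pmonom A (\<lambda>v. n v + m v) x)"
    by (auto simp: pmonom_def power_add prod.distrib)
  then show ?case by (metis poly_fun.poly_fun_pmonom)
next
  case (poly_fun_add f g)
  then show ?case using poly_fun.poly_fun_add[OF poly_fun_add.IH] by (simp add: distrib_left)
qed

lemma poly_fun_mult:
  assumes "poly_fun A f" "poly_fun A g" shows "poly_fun A (\<lambda>x. f x * g x)"
  using assms(1)
proof induction
  case (poly_fun_pmonom d m)
  show ?case using poly_fun_mult_pmonom[OF assms(2)] .
next
  case (poly_fun_add f1 f2)
  then show ?case using poly_fun.poly_fun_add[OF poly_fun_add.IH] by (simp add: distrib_right)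
qed

lemma poly_fun_var:
  assumes "finite A" "v \<in> A" shows "poly_fun A (\<lambda>x. x v)"
proof -
  have "(\<lambda>x. 1 * pmonom A (\<lambda>u. if u = v then 1 else 0) x) = (\<lambda>x :: 'a \<Rightarrow> complex. x v)"
  proof
    fix x :: "'a \<Rightarrow> complex"
    have "pmonom A (\<lambda>u. if u = v then 1 else 0) x = (\<Prod>u\<in>A. if u = v then x u else 1)"
      unfolding pmonom_def by (intro prod.cong) auto
    then show "1 * pmonom A (\<lambda>u. if u = v then 1 else 0) x = x v"
      using assms by (simp add: prod.delta)
  qed
  then show ?thesis by (metis poly_fun_pmonom)
qed

lemma poly_fun_cmult: "poly_fun A f \<Longrightarrow> poly_fun A (\<lambda>x. c * f x)"
  by (rule poly_fun_mult) auto

lemma poly_fun_diff: "poly_fun A f \<Longrightarrow> poly_fun A g \<Longrightarrow> poly_fun A (\<lambda>x. f x - g x)"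
  using poly_fun_add[of A f "\<lambda>x. (-1) * g x"] poly_fun_cmult[of A g "-1"] by simp

lemma poly_fun_sum: "(\<And>i. i \<in> I \<Longrightarrow> poly_fun A (f i)) \<Longrightarrow> poly_fun A (\<lambda>x. \<Sum>i\<in>I. f i x)"
  by (induction I rule: infinite_finite_induct) (auto intro: poly_fun_add)

lemma poly_fun_sum_list: "(\<And>i. i \<in> set I \<Longrightarrow> poly_fun A (f i)) \<Longrightarrow> poly_fun A (\<lambda>x. \<Sum>i\<leftarrow>I. f i x)"
  by (induction I) (auto intro: poly_fun_add)

lemma poly_fun_prod: "(\<And>i. i \<in> I \<Longrightarrow> poly_fun A (f i)) \<Longrightarrow> poly_fun A (\<lambda>x. \<Prod>i\<in>I. f i x)"
  by (induction I rule: infinite_finite_induct) (auto intro: poly_fun_mult)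

lemma poly_fun_prod_list: "(\<And>i. i \<in> set I \<Longrightarrow> poly_fun A (f i)) \<Longrightarrow> poly_fun A (\<lambda>x. \<Prod>i\<leftarrow>I. f i x)"
  by (induction I) (auto intro: poly_fun_mult)

lemma poly_fun_power: "poly_fun A f \<Longrightarrow> poly_fun A (\<lambda>x. f x ^ n)"
  by (induction n) (auto intro: poly_fun_mult)

text \<open>An ordinary complex derivative in one coordinate. Entries and their conjugates will be
  separate coordinates, so it also serves as Wirtinger derivative.\<close>

definition partial :: "'v \<Rightarrow> (('v \<Rightarrow> complex) \<Rightarrow> complex) \<Rightarrow> ('v \<Rightarrow> complex) \<Rightarrow> complex" where
  "partial v f x = deriv (\<lambda>z. f (x(v := z))) (x v)"

lemma partial_eqI: "((\<lambda>z. f (x(v := z))) has_field_derivative D) (at (x v)) \<Longrightarrow> partial v f x = D"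
  unfolding partial_def by (rule DERIV_imp_deriv)

lemma pmonom_upd:
  assumes "finite A" "v \<in> A"
  shows "pmonom A n (x(v := z)) = z ^ n v * (\<Prod>u\<in>A - {v}. x u ^ n u)"
proof -
  have "(\<Prod>u\<in>A - {v}. (x(v := z)) u ^ n u) = (\<Prod>u\<in>A - {v}. x u ^ n u)"
    by (rule prod.cong) auto
  then show ?thesis
    unfolding pmonom_def using prod.remove[OF assms, of "\<lambda>u. (x(v := z)) u ^ n u"] by simp
qed

lemma pmonom_DERIV:
  assumes "finite A"
  shows "((\<lambda>z. pmonom A n (x(v := z))) has_field_derivative
    (if v \<in> A then of_nat (n v) * pmonom A (n(v := n v - 1)) x else 0)) (at (x v))"
proof (cases "v \<in> A")
  case True
  have e: "pmonom A (n(v := n v - 1)) x = x v ^ (n v - 1) * (\<Prod>u\<in>A - {v}. x u ^ n u)"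
  proof -
    have "(\<Prod>u\<in>A - {v}. x u ^ (n(v := n v - 1)) u) = (\<Prod>u\<in>A - {v}. x u ^ n u)"
      by (rule prod.cong) auto
    then show ?thesis
      using pmonom_upd[OF assms True, of "n(v := n v - 1)" x "x v"] by simp
  qed
  show ?thesis
    unfolding pmonom_upd[OF assms True] using True
    by (auto simp: e[simplified] intro!: derivative_eq_intros)
next
  case False
  then have "pmonom A n (x(v := z)) = pmonom A n x" for z
    unfolding pmonom_def by (intro prod.cong) auto
  then show ?thesis using False by simp
qed

text \<open>The existence of some derivative passes through the induction; uniqueness then
  identifies it with \<open>partial\<close>, whose value is arbitrary where no derivative
  exists.\<close>

lemma partial_DERIV:
  assumes "finite A" "poly_fun A f"
  shows "((\<lambda>z. f (x(v := z))) has_field_derivative partial v f x) (at (x v))"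
proof -
  have "\<exists>D. ((\<lambda>z. f (x(v := z))) has_field_derivative D) (at (x v))"
    using assms(2)
  proof induction
    case (poly_fun_pmonom c n)
    show ?case using DERIV_cmult[OF pmonom_DERIV[OF assms(1)]] by blast
  next
    case (poly_fun_add f g)
    then show ?case using DERIV_add by blast
  qed
  then show ?thesis using partial_eqI by metis
qed

lemma partial_pmonom:
  assumes "finite A"
  shows "partial v (pmonom A n) x = (if v \<in> A then of_nat (n v) * pmonom A (n(v := n v - 1)) x else 0)"
  by (rule partial_eqI, rule pmonom_DERIV[OF assms])

lemma partial_const [simp]: "partial v (\<lambda>x. c) = (\<lambda>x. 0)"
  by (rule ext, rule partial_eqI) auto

lemma partial_var: "partial v (\<lambda>x. x u) = (\<lambda>x. if u = v then 1 else 0)"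
  by (rule ext, rule partial_eqI) (auto intro!: derivative_eq_intros)

context
  fixes A :: "'v set"
  assumes fin: "finite A"
begin

lemma partial_add:
  assumes "poly_fun A f" "poly_fun A g"
  shows "partial v (\<lambda>x. f x + g x) = (\<lambda>x. partial v f x + partial v g x)"
  by (rule ext, rule partial_eqI) (intro DERIV_add partial_DERIV[OF fin] assms)

lemma partial_diff:
  assumes "poly_fun A f" "poly_fun A g"
  shows "partial v (\<lambda>x. f x - g x) = (\<lambda>x. partial v f x - partial v g x)"
  by (rule ext, rule partial_eqI) (intro DERIV_diff partial_DERIV[OF fin] assms)

lemma partial_mult:
  assumes "poly_fun A f" "poly_fun A g"
  shows "partial v (\<lambda>x. f x * g x) = (\<lambda>x. partial v f x * g x + f x * partial v g x)"
proof (rule ext, rule partial_eqI)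
  fix x
  show "((\<lambda>z. f (x(v := z)) * g (x(v := z))) has_field_derivative
         partial v f x * g x + f x * partial v g x) (at (x v))"
    using DERIV_mult[OF partial_DERIV[OF fin assms(1), where v=v and x=x] partial_DERIV[OF fin assms(2), where v=v and x=x]]
    by (simp add: algebra_simps)
qed

lemma partial_cmult:
  assumes "poly_fun A f"
  shows "partial v (\<lambda>x. c * f x) = (\<lambda>x. c * partial v f x)"
  by (subst partial_mult) (auto simp: assms)

lemma partial_sum:
  assumes "\<forall>i\<in>I. poly_fun A (f i)"
  shows "partial v (\<lambda>x. \<Sum>i\<in>I. f i x) = (\<lambda>x. \<Sum>i\<in>I. partial v (f i) x)"
  using assms
proof (induction I rule: infinite_finite_induct)
  case (insert i I)
  then show ?case by (simp add: partial_add poly_fun_sum)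
qed auto

lemma poly_fun_partial:
  assumes "poly_fun A f" shows "poly_fun A (partial v f)"
  using assms
proof induction
  case (poly_fun_pmonom c n)
  have "poly_fun A (\<lambda>x. c * pmonom A n x)" for c n by (rule poly_fun.poly_fun_pmonom)
  then have "poly_fun A (\<lambda>x. pmonom A n x)" for n using poly_fun.poly_fun_pmonom[of A 1 n] by simp
  then show ?case
    by (cases "v \<in> A") (subst partial_cmult; auto simp: partial_pmonom[OF fin, abs_def] intro!: poly_fun_cmult)+
next
  case (poly_fun_add f g)
  then show ?case using poly_fun.poly_fun_add by (subst partial_add) auto
qed

end

section \<open>Exponentials of nilpotent second-order operators\<close>

text \<open>The exponential series of \<tau> D, cut off at \<open>N\<close>. Both operators used
  below lower the degree, so on a given polynomial the cut-off is exact from some \<open>N\<close>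
  on, and no convergence question arises.\<close>

definition heat_exp :: "((('v \<Rightarrow> complex) \<Rightarrow> complex) \<Rightarrow> ('v \<Rightarrow> complex) \<Rightarrow> complex) \<Rightarrow> nat \<Rightarrow>
    complex \<Rightarrow> (('v \<Rightarrow> complex) \<Rightarrow> complex) \<Rightarrow> ('v \<Rightarrow> complex) \<Rightarrow> complex" where
  "heat_exp D N \<tau> f x = (\<Sum>k\<le>N. \<tau> ^ k / fact k * (D ^^ k) f x)"

lemma poly_higher_pderiv_0: "poly ((pderiv ^^ j) p) 0 = fact j * coeff p j"
  for p :: "complex poly"
  by (simp add: poly_0_coeff_0 coeff_higher_pderiv pochhammer_fact[symmetric])

text \<open>Only linearity and stability of polynomials are required. Nilpotency is not part of the
  interface; it enters through the degree bound in \<open>heat_exp_basis\<close>.\<close>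

locale heat_op =
  fixes A :: "'v set"
    and D :: "(('v \<Rightarrow> complex) \<Rightarrow> complex) \<Rightarrow> ('v \<Rightarrow> complex) \<Rightarrow> complex"
  assumes D_add: "poly_fun A f \<Longrightarrow> poly_fun A g \<Longrightarrow> D (\<lambda>x. f x + g x) = (\<lambda>x. D f x + D g x)"
    and D_cmult: "poly_fun A f \<Longrightarrow> D (\<lambda>x. c * f x) = (\<lambda>x. c * D f x)"
    and poly_fun_D: "poly_fun A f \<Longrightarrow> poly_fun A (D f)"
begin

lemma D_0: "D (\<lambda>x. 0) = (\<lambda>x. 0)"
  using D_cmult[of "\<lambda>x. 0" 0] by simp

lemma poly_fun_Dk: "poly_fun A f \<Longrightarrow> poly_fun A ((D ^^ k) f)"
  by (induction k) (auto intro: poly_fun_D)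

lemma Dk_add:
  "poly_fun A f \<Longrightarrow> poly_fun A g \<Longrightarrow> (D ^^ k) (\<lambda>x. f x + g x) = (\<lambda>x. (D ^^ k) f x + (D ^^ k) g x)"
  by (induction k) (auto simp: D_add poly_fun_Dk)

lemma Dk_cmult:
  "poly_fun A f \<Longrightarrow> (D ^^ k) (\<lambda>x. c * f x) = (\<lambda>x. c * (D ^^ k) f x)"
  by (induction k) (auto simp: D_cmult poly_fun_Dk)

lemma Dk_0: "(D ^^ k) (\<lambda>x. 0) = (\<lambda>x. 0)"
  by (induction k) (auto simp: D_0)

lemma Dk_sum:
  "(\<And>i. i \<in> I \<Longrightarrow> poly_fun A (f i)) \<Longrightarrow>
    (D ^^ k) (\<lambda>x. \<Sum>i\<in>I. f i x) = (\<lambda>x. \<Sum>i\<in>I. (D ^^ k) (f i) x)"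
  by (induction I rule: infinite_finite_induct) (auto simp: Dk_0 Dk_add poly_fun_sum)

lemma heat_exp_add:
  "poly_fun A f \<Longrightarrow> poly_fun A g \<Longrightarrow>
    heat_exp D N \<tau> (\<lambda>x. f x + g x) x = heat_exp D N \<tau> f x + heat_exp D N \<tau> g x"
  by (simp add: heat_exp_def Dk_add distrib_left sum.distrib)

lemma heat_exp_cmult:
  "poly_fun A f \<Longrightarrow> heat_exp D N \<tau> (\<lambda>x. c * f x) x = c * heat_exp D N \<tau> f x"
  by (simp add: heat_exp_def Dk_cmult sum_distrib_left mult_ac)

lemma heat_exp_sum:
  "(\<And>i. i \<in> I \<Longrightarrow> poly_fun A (f i)) \<Longrightarrow>
    heat_exp D N \<tau> (\<lambda>x. \<Sum>i\<in>I. f i x) x = (\<Sum>i\<in>I. heat_exp D N \<tau> (f i) x)"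
  unfolding heat_exp_def by (simp add: Dk_sum sum_distrib_left) (rule sum.swap)

text \<open>\<open>G n\<close> solves the heat equation and is polynomial in time: its time
  derivative has the same coefficients as \<open>D (b n)\<close>, and at time 0 it equals
  \<open>b n x\<close>. So \<open>(D ^^ k) (b n) x / fact k\<close> is its k-th Taylor coefficient,
  and the degree bound makes the truncation exact. The index type is free, so that exponent
  functions and families of polynomials can both serve.\<close>

lemma heat_exp_basis:
  fixes b :: "'i \<Rightarrow> ('v \<Rightarrow> complex) \<Rightarrow> complex" and G :: "'i \<Rightarrow> complex poly"
  assumes b: "\<And>n. poly_fun A (b n)"
    and Db: "\<And>n. D (b n) = (\<lambda>x. \<Sum>k\<in>K. c k n * b (r k n) x)"
    and G: "\<And>n. pderiv (G n) = (\<Sum>k\<in>K. Polynomial.smult (c k n) (G (r k n)))"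
    and G0: "\<And>n. poly (G n) 0 = b n x"
    and N: "degree (G n) \<le> N"
  shows "heat_exp D N \<tau> (b n) x = poly (G n) \<tau>"
proof -
  have *: "(D ^^ j) (b n) x = poly ((pderiv ^^ j) (G n)) 0" for j n
  proof (induction j arbitrary: n)
    case 0
    then show ?case by (simp add: G0)
  next
    case (Suc j)
    have "(D ^^ Suc j) (b n) x = (D ^^ j) (\<lambda>x. \<Sum>k\<in>K. c k n * b (r k n) x) x"
      by (simp add: funpow_Suc_right Db del: funpow.simps)
    also have "\<dots> = (\<Sum>k\<in>K. c k n * (D ^^ j) (b (r k n)) x)"
      by (simp add: Dk_sum poly_fun_cmult b Dk_cmult)
    also have "\<dots> = poly ((pderiv ^^ j) (pderiv (G n))) 0"
      by (simp add: Suc G higher_pderiv_sum higher_pderiv_smult poly_sum)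
    finally show ?case
      by (simp add: funpow_Suc_right del: funpow.simps)
  qed
  have "heat_exp D N \<tau> (b n) x = (\<Sum>k\<le>N. coeff (G n) k * \<tau> ^ k)"
    unfolding heat_exp_def by (rule sum.cong) (auto simp: * poly_higher_pderiv_0)
  also have "\<dots> = poly (G n) \<tau>"
    unfolding poly_altdef using N
    by (intro sum.mono_neutral_right) (auto simp: coeff_eq_0)
  finally show ?thesis .
qed

end

section \<open>Words in power sums\<close>

text \<open>A list of coefficient-word pairs stands for a linear combination of products of power
  sums. Nothing is normalised: different lists may have the same value, which is harmless as only
  values are compared.\<close>

definition eval_words :: "(nat \<Rightarrow> complex) \<Rightarrow> (complex \<times> nat list) list \<Rightarrow> complex" where
  "eval_words p cs = (\<Sum>cw\<leftarrow>cs. fst cw * (\<Prod>n\<leftarrow>snd cw. p n))"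

text \<open>The cross term of the n-th power sum with a product, expanded by the derivation property
  from the value 2 n m P (n + m - 1) on two power sums.\<close>

fun gamma_word :: "nat \<Rightarrow> nat list \<Rightarrow> (complex \<times> nat list) list" where
  "gamma_word n [] = []"
| "gamma_word n (m # w) = (2 * of_nat n * of_nat m, (n + m - 1) # w) # map (\<lambda>(c, u). (c, m # u)) (gamma_word n w)"

text \<open>Product rule of a second-order operator: the operator on the first letter, the operator
  on the rest, and the cross term. For \<open>n = 0\<close> the splitting list is empty and the
  coefficient of the \<open>q\<close> term is 0, so the truncated \<open>n - 1\<close> does no
  harm.\<close>

fun heat_word :: "nat \<Rightarrow> nat list \<Rightarrow> (complex \<times> nat list) list" where
  "heat_word q [] = []"
| "heat_word q (n # w) = map (\<lambda>a. (of_nat n, a # (n - 1 - a) # w)) [0..<n] @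
     [(of_nat n * of_nat q, (n - 1) # w)] @ map (\<lambda>(c, u). (c, n # u)) (heat_word q w) @ gamma_word n w"

definition heat_words :: "nat \<Rightarrow> (complex \<times> nat list) list \<Rightarrow> (complex \<times> nat list) list" where
  "heat_words q cs = concat (map (\<lambda>(c, w). map (\<lambda>(d, u). (c * d, u)) (heat_word q w)) cs)"

definition heat_exp_words :: "nat \<Rightarrow> nat \<Rightarrow> complex \<Rightarrow> (complex \<times> nat list) list \<Rightarrow> (nat \<Rightarrow> complex) \<Rightarrow> complex" where
  "heat_exp_words q N \<tau> cs p = (\<Sum>k\<le>N. \<tau> ^ k / fact k * eval_words p ((heat_words q ^^ k) cs))"

lemma eval_words_simps [simp]:
  "eval_words p [] = 0"
  "eval_words p (cw # cs) = fst cw * (\<Prod>n\<leftarrow>snd cw. p n) + eval_words p cs"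
  "eval_words p (cs @ ds) = eval_words p cs + eval_words p ds"
  by (auto simp: eval_words_def)

lemma eval_words_Cons_word: "eval_words p (map (\<lambda>(c, u). (c, n # u)) cs) = p n * eval_words p cs"
  by (induction cs) (auto simp: algebra_simps)

lemma eval_words_scale: "eval_words p (map (\<lambda>(d, u). (c * d, u)) cs) = c * eval_words p cs"
  by (induction cs) (auto simp: algebra_simps)

lemma eval_words_split:
  "eval_words p (map (\<lambda>a. (c, a # (m - a) # w)) as) = c * (\<Sum>a\<leftarrow>as. p a * p (m - a)) * (\<Prod>n\<leftarrow>w. p n)"
  by (induction as) (auto simp: algebra_simps)

lemma poly_fun_eval_words: "(\<And>n. poly_fun A (P n)) \<Longrightarrow> poly_fun A (\<lambda>x. eval_words (\<lambda>n. P n x) cs)"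
  unfolding eval_words_def by (intro poly_fun_sum_list poly_fun_cmult poly_fun_prod_list)

text \<open>On the power sums \<open>P\<close>, the operator \<open>f \<mapsto> D (V f) / V\<close> acts by a rule that does not
  depend on the realisation; matrices (with \<open>V = 1\<close>) and eigenvalues (with \<open>V\<close> the
  Vandermonde product) are two instances with the same rule.\<close>

locale power_sum_heat = heat_op A D
  for A :: "'v set" and D +
  fixes V :: "('v \<Rightarrow> complex) \<Rightarrow> complex"
    and \<Gamma> :: "(('v \<Rightarrow> complex) \<Rightarrow> complex) \<Rightarrow> (('v \<Rightarrow> complex) \<Rightarrow> complex) \<Rightarrow> ('v \<Rightarrow> complex) \<Rightarrow> complex"
    and P :: "nat \<Rightarrow> ('v \<Rightarrow> complex) \<Rightarrow> complex" and q :: nat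
  assumes poly_fun_V: "poly_fun A V" and poly_fun_P: "poly_fun A (P n)"
    and D_V: "D V = (\<lambda>x. 0)"
    and D_mult: "poly_fun A f \<Longrightarrow> poly_fun A g \<Longrightarrow> D (\<lambda>x. V x * (f x * g x)) =
      (\<lambda>x. D (\<lambda>x. V x * f x) x * g x + f x * D (\<lambda>x. V x * g x) x + V x * \<Gamma> f g x)"
    and \<Gamma>_const: "\<Gamma> f (\<lambda>x. c) = (\<lambda>x. 0)"
    and \<Gamma>_mult: "poly_fun A f \<Longrightarrow> poly_fun A g \<Longrightarrow> poly_fun A h \<Longrightarrow>
      \<Gamma> f (\<lambda>x. g x * h x) = (\<lambda>x. \<Gamma> f g x * h x + g x * \<Gamma> f h x)"
    and D_P: "D (\<lambda>x. V x * P n x) =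
      (\<lambda>x. V x * (of_nat n * ((\<Sum>a<n. P a x * P (n - 1 - a) x) + of_nat q * P (n - 1) x)))"
    and \<Gamma>_P: "\<Gamma> (P n) (P m) = (\<lambda>x. 2 * of_nat n * of_nat m * P (n + m - 1) x)"
begin

lemma poly_fun_word: "poly_fun A (\<lambda>x. \<Prod>n\<leftarrow>w. P n x)"
  by (intro poly_fun_prod_list poly_fun_P)

lemma \<Gamma>_word: "\<Gamma> (P n) (\<lambda>x. \<Prod>m\<leftarrow>w. P m x) = (\<lambda>x. eval_words (\<lambda>n. P n x) (gamma_word n w))"
  by (induction w)
    (simp_all add: \<Gamma>_const \<Gamma>_mult poly_fun_P poly_fun_word \<Gamma>_P eval_words_Cons_word algebra_simps)

lemma D_word: "D (\<lambda>x. V x * (\<Prod>m\<leftarrow>w. P m x)) = (\<lambda>x. V x * eval_words (\<lambda>n. P n x) (heat_word q w))"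
proof (induction w)
  case Nil
  then show ?case by (simp add: D_V)
next
  case (Cons n w)
  show ?case
    by (simp add: D_mult poly_fun_P poly_fun_word Cons D_P \<Gamma>_word eval_words_Cons_word fun_eq_iff
        eval_words_split[of _ _ "n - 1", simplified] interv_sum_list_conv_sum_set_nat
        atLeast0LessThan algebra_simps)
qed

lemma D_eval_words: "D (\<lambda>x. V x * eval_words (\<lambda>n. P n x) cs) = (\<lambda>x. V x * eval_words (\<lambda>n. P n x) (heat_words q cs))"
proof (induction cs)
  case Nil
  then show ?case by (simp add: D_0 heat_words_def)
next
  case (Cons cw cs)
  obtain c w where cw: "cw = (c, w)" by fastforce
  have "(\<lambda>x. V x * eval_words (\<lambda>n. P n x) (cw # cs)) =
    (\<lambda>x. c * (V x * (\<Prod>n\<leftarrow>w. P n x)) + V x * eval_words (\<lambda>n. P n x) cs)"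
    by (auto simp: cw algebra_simps)
  then have "D (\<lambda>x. V x * eval_words (\<lambda>n. P n x) (cw # cs)) =
    (\<lambda>x. c * (V x * eval_words (\<lambda>n. P n x) (heat_word q w)) + V x * eval_words (\<lambda>n. P n x) (heat_words q cs))"
    by (simp add: D_add D_cmult poly_fun_mult poly_fun_cmult poly_fun_V poly_fun_word poly_fun_eval_words poly_fun_P
      Cons D_word)
  moreover have "heat_words q (cw # cs) = map (\<lambda>(d, u). (c * d, u)) (heat_word q w) @ heat_words q cs"
    by (simp add: heat_words_def cw)
  ultimately show ?case
    by (simp add: eval_words_scale distrib_left mult.left_commute)
qed

text \<open>The transfer principle: apart from the prefactor \<open>V x\<close>, the right-hand side
  depends on the realisation only through the numbers \<open>P n x\<close>. Two realisations with
  equal power sums at their respective points share the heat evolution of \<open>cs\<close>.\<close>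

lemma heat_exp_eval_words:
  "heat_exp D N \<tau> (\<lambda>x. V x * eval_words (\<lambda>n. P n x) cs) x = V x * heat_exp_words q N \<tau> cs (\<lambda>n. P n x)"
proof -
  have "(D ^^ k) (\<lambda>x. V x * eval_words (\<lambda>n. P n x) cs) =
    (\<lambda>x. V x * eval_words (\<lambda>n. P n x) ((heat_words q ^^ k) cs))" for k
    by (induction k) (auto simp: D_eval_words)
  then show ?thesis
    by (simp add: heat_exp_def heat_exp_words_def sum_distrib_left mult_ac)
qed

end

section \<open>The Laplacian on power sums of the Gram matrix\<close>

text \<open>\<open>Inl\<close> coordinates are the entries of X, \<open>Inr\<close> coordinates
  those of its entrywise conjugate Y, treated as independent. The Gram matrix S thus becomes
  bilinear; the conjugation is restored by \<open>rvar\<close>.\<close>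

definition gramS :: "nat \<Rightarrow> (nat \<times> nat + nat \<times> nat \<Rightarrow> complex) \<Rightarrow> nat \<Rightarrow> nat \<Rightarrow> complex" where
  "gramS t x i k = (\<Sum>j<t. x (Inl (i, j)) * x (Inr (k, j)))"

fun gramP :: "nat \<Rightarrow> nat \<Rightarrow> nat \<Rightarrow> (nat \<times> nat + nat \<times> nat \<Rightarrow> complex) \<Rightarrow> nat \<Rightarrow> nat \<Rightarrow> complex" where
  "gramP s t 0 x i k = (if i = k then 1 else 0)"
| "gramP s t (Suc n) x i k = (\<Sum>l<s. gramP s t n x i l * gramS t x l k)"

definition gramTr :: "nat \<Rightarrow> nat \<Rightarrow> nat \<Rightarrow> (nat \<times> nat + nat \<times> nat \<Rightarrow> complex) \<Rightarrow> complex" where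
  "gramTr s t n x = (\<Sum>i<s. gramP s t n x i i)"

text \<open>S^n X, with mirror image Y^T S^n below: up to the factor n + 1, the gradients of tr S^(n
  + 1) in the two groups of coordinates.\<close>

definition gramPX where "gramPX s t n x i j = (\<Sum>l<s. gramP s t n x i l * x (Inl (l, j)))"
definition gramYP where "gramYP s t n x j k = (\<Sum>l<s. x (Inr (l, j)) * gramP s t n x l k)"

definition gvars :: "nat \<Rightarrow> nat \<Rightarrow> (nat \<times> nat + nat \<times> nat) set" where
  "gvars s t = ({..<s} \<times> {..<t}) <+> ({..<s} \<times> {..<t})"

text \<open>In Wirtinger terms a quarter of the usual Laplacian. This normalisation makes time 1
  correspond to E|Z - m|^2 = 1, the variance of the entries.\<close>

definition heatX :: "nat \<Rightarrow> nat \<Rightarrow> ((nat \<times> nat + nat \<times> nat \<Rightarrow> complex) \<Rightarrow> complex) \<Rightarrow>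
    (nat \<times> nat + nat \<times> nat \<Rightarrow> complex) \<Rightarrow> complex" where
  "heatX s t f = (\<lambda>x. \<Sum>v\<in>{..<s} \<times> {..<t}. partial (Inl v) (partial (Inr v) f) x)"

definition gammaX where
  "gammaX s t f g = (\<lambda>x. \<Sum>v\<in>{..<s} \<times> {..<t}. partial (Inl v) f x * partial (Inr v) g x + partial (Inr v) f x * partial (Inl v) g x)"

lemma finite_gvars [simp]: "finite (gvars s t)"
  by (auto simp: gvars_def)

section \<open>Powers of the Gram matrix, their traces and the gradients of the traces\<close>

lemma gramP_add:
  assumes "k < s"
  shows "(\<Sum>l<s. gramP s t m x i l * gramP s t n x l k) = gramP s t (m + n) x i k"
  using assms
proof (induction n arbitrary: k)
  case 0
  have "(\<Sum>l<s. gramP s t m x i l * gramP s t 0 x l k) = (\<Sum>l<s. if l = k then gramP s t m x i l else 0)"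
    by (rule sum.cong) auto
  then show ?case using 0 by simp
next
  case (Suc n)
  have "(\<Sum>l<s. gramP s t m x i l * gramP s t (Suc n) x l k) =
    (\<Sum>l<s. \<Sum>h<s. gramP s t m x i l * gramP s t n x l h * gramS t x h k)"
    by (simp add: sum_distrib_left mult_ac)
  also have "\<dots> = (\<Sum>h<s. (\<Sum>l<s. gramP s t m x i l * gramP s t n x l h) * gramS t x h k)"
    by (subst sum.swap) (simp add: sum_distrib_right)
  also have "\<dots> = (\<Sum>h<s. gramP s t (m + n) x i h * gramS t x h k)"
    using Suc.IH by (intro sum.cong) auto
  finally show ?case by simp
qed

lemma gramP_add_sum:
  "(\<Sum>l<s. gramP s t m x i l * gramPX s t n x l j) = gramPX s t (m + n) x i j"
proof -
  have "(\<Sum>l<s. gramP s t m x i l * gramPX s t n x l j) =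
    (\<Sum>l<s. \<Sum>h<s. gramP s t m x i l * gramP s t n x l h * x (Inl (h, j)))"
    by (simp add: gramPX_def sum_distrib_left mult_ac)
  also have "\<dots> = (\<Sum>h<s. (\<Sum>l<s. gramP s t m x i l * gramP s t n x l h) * x (Inl (h, j)))"
    by (subst sum.swap) (simp add: sum_distrib_right)
  also have "\<dots> = (\<Sum>h<s. gramP s t (m + n) x i h * x (Inl (h, j)))"
    by (intro sum.cong refl) (simp add: gramP_add)
  finally show ?thesis by (simp add: gramPX_def)
qed

lemma gramYP_add:
  assumes "k < s"
  shows "(\<Sum>l<s. gramYP s t m x j l * gramP s t n x l k) = gramYP s t (m + n) x j k"
proof -
  have "(\<Sum>l<s. gramYP s t m x j l * gramP s t n x l k) =
    (\<Sum>l<s. \<Sum>h<s. x (Inr (h, j)) * (gramP s t m x h l * gramP s t n x l k))"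
    by (simp add: gramYP_def sum_distrib_right mult.assoc)
  also have "\<dots> = (\<Sum>h<s. x (Inr (h, j)) * (\<Sum>l<s. gramP s t m x h l * gramP s t n x l k))"
    by (subst sum.swap) (simp add: sum_distrib_left)
  also have "\<dots> = (\<Sum>h<s. x (Inr (h, j)) * gramP s t (m + n) x h k)"
    by (intro sum.cong refl) (simp add: gramP_add assms)
  finally show ?thesis by (simp add: gramYP_def)
qed

lemma gramTr_cyclic:
  "(\<Sum>j<t. \<Sum>l<s. gramYP s t n x j l * x (Inl (l, j))) = gramTr s t (Suc n) x"
proof -
  have "(\<Sum>j<t. \<Sum>l<s. gramYP s t n x j l * x (Inl (l, j))) =
    (\<Sum>j<t. \<Sum>l<s. \<Sum>h<s. x (Inr (h, j)) * gramP s t n x h l * x (Inl (l, j)))"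
    by (simp add: gramYP_def sum_distrib_right)
  also have "\<dots> = (\<Sum>l<s. \<Sum>j<t. \<Sum>h<s. x (Inr (h, j)) * gramP s t n x h l * x (Inl (l, j)))"
    by (rule sum.swap)
  also have "\<dots> = (\<Sum>l<s. \<Sum>h<s. \<Sum>j<t. x (Inr (h, j)) * gramP s t n x h l * x (Inl (l, j)))"
    by (intro sum.cong refl sum.swap)
  also have "\<dots> = (\<Sum>h<s. \<Sum>l<s. \<Sum>j<t. x (Inr (h, j)) * gramP s t n x h l * x (Inl (l, j)))"
    by (rule sum.swap)
  also have "\<dots> = gramTr s t (Suc n) x"
    by (simp add: gramTr_def gramS_def sum_distrib_left mult_ac)
  finally show ?thesis .
qed

lemma poly_fun_gram_var:
  "i < s \<Longrightarrow> j < t \<Longrightarrow> poly_fun (gvars s t) (\<lambda>x. x (Inl (i, j)))"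
  "i < s \<Longrightarrow> j < t \<Longrightarrow> poly_fun (gvars s t) (\<lambda>x. x (Inr (i, j)))"
  by (intro poly_fun_var finite_gvars; auto simp: gvars_def)+

lemma poly_fun_gramS: "i < s \<Longrightarrow> k < s \<Longrightarrow> poly_fun (gvars s t) (\<lambda>x. gramS t x i k)"
  unfolding gramS_def by (intro poly_fun_sum poly_fun_mult poly_fun_gram_var) auto

lemma poly_fun_gramP: "i < s \<Longrightarrow> k < s \<Longrightarrow> poly_fun (gvars s t) (\<lambda>x. gramP s t n x i k)"
  by (induction n arbitrary: k) (auto intro!: poly_fun_sum poly_fun_mult poly_fun_gramS)

lemma poly_fun_gramTr: "poly_fun (gvars s t) (gramTr s t n)"
  unfolding gramTr_def by (intro poly_fun_sum poly_fun_gramP) auto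

lemma poly_fun_gramPX: "i < s \<Longrightarrow> j < t \<Longrightarrow> poly_fun (gvars s t) (\<lambda>x. gramPX s t n x i j)"
  unfolding gramPX_def by (intro poly_fun_sum poly_fun_mult poly_fun_gramP poly_fun_gram_var) auto

lemma partial_gramS:
  assumes "a < s" "b < s" "j < t"
  shows "partial (Inr (i, j)) (\<lambda>x. gramS t x a b) = (\<lambda>x. if b = i then x (Inl (a, j)) else 0)"
    and "partial (Inl (i, j)) (\<lambda>x. gramS t x a b) = (\<lambda>x. if a = i then x (Inr (b, j)) else 0)"
proof -
  have "partial v (\<lambda>x. gramS t x a b) = (\<lambda>x. \<Sum>j'<t. partial v (\<lambda>x. x (Inl (a, j'))) x * x (Inr (b, j')) +
      x (Inl (a, j')) * partial v (\<lambda>x. x (Inr (b, j'))) x)" for v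
    unfolding gramS_def using assms
    by (simp add: partial_sum[OF finite_gvars[of s t]] partial_mult[OF finite_gvars[of s t]] poly_fun_mult poly_fun_gram_var)
  note * = this
  show "partial (Inr (i, j)) (\<lambda>x. gramS t x a b) = (\<lambda>x. if b = i then x (Inl (a, j)) else 0)"
  proof
    fix x :: "nat \<times> nat + nat \<times> nat \<Rightarrow> complex"
    have "partial (Inr (i, j)) (\<lambda>x. gramS t x a b) x = (\<Sum>j'<t. if j' = j then (if b = i then x (Inl (a, j)) else 0) else 0)"
      unfolding * partial_var by (rule sum.cong) auto
    then show "partial (Inr (i, j)) (\<lambda>x. gramS t x a b) x = (if b = i then x (Inl (a, j)) else 0)"
      using assms by simp
  qed
  show "partial (Inl (i, j)) (\<lambda>x. gramS t x a b) = (\<lambda>x. if a = i then x (Inr (b, j)) else 0)"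
  proof
    fix x :: "nat \<times> nat + nat \<times> nat \<Rightarrow> complex"
    have "partial (Inl (i, j)) (\<lambda>x. gramS t x a b) x = (\<Sum>j'<t. if j' = j then (if a = i then x (Inr (b, j)) else 0) else 0)"
      unfolding * partial_var by (rule sum.cong) auto
    then show "partial (Inl (i, j)) (\<lambda>x. gramS t x a b) x = (if a = i then x (Inr (b, j)) else 0)"
      using assms by simp
  qed
qed

lemma partial_gramP_Suc:
  assumes "a < s" "b < s"
  shows "partial v (\<lambda>x. gramP s t (Suc n) x a b) x =
    (\<Sum>l<s. partial v (\<lambda>x. gramP s t n x a l) x * gramS t x l b) +
    (\<Sum>l<s. gramP s t n x a l * partial v (\<lambda>x. gramS t x l b) x)"
  using assms
  by (simp add: partial_sum[OF finite_gvars[of s t]] partial_mult[OF finite_gvars[of s t]] poly_fun_mult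
      poly_fun_gramP poly_fun_gramS sum.distrib)

text \<open>The derivative of S in the coordinate \<open>Inr (i, j)\<close> is column j of X placed
  in column i. It can hit any of the n factors of S^n; with c factors to its left it leaves S^c X on
  the left and S^(n - 1 - c) on the right.\<close>

lemma partial_gramP_Inr:
  assumes "a < s" "b < s" "i < s" "j < t"
  shows "partial (Inr (i, j)) (\<lambda>x. gramP s t n x a b) x =
    (\<Sum>c<n. gramPX s t c x a j * gramP s t (n - 1 - c) x i b)"
  using assms(2)
proof (induction n arbitrary: b)
  case 0
  then show ?case by simp
next
  case (Suc n)
  have "(\<Sum>l<s. partial (Inr (i, j)) (\<lambda>x. gramP s t n x a l) x * gramS t x l b) =
    (\<Sum>l<s. \<Sum>c<n. gramPX s t c x a j * (gramP s t (n - 1 - c) x i l * gramS t x l b))"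
    using Suc.IH by (simp add: sum_distrib_right mult.assoc)
  also have "\<dots> = (\<Sum>c<n. gramPX s t c x a j * gramP s t (Suc (n - 1 - c)) x i b)"
    by (subst sum.swap) (simp add: sum_distrib_left)
  also have "\<dots> = (\<Sum>c<n. gramPX s t c x a j * gramP s t (Suc n - 1 - c) x i b)"
    by (intro sum.cong refl) (simp add: Suc_diff_Suc)
  finally have 1: "(\<Sum>l<s. partial (Inr (i, j)) (\<lambda>x. gramP s t n x a l) x * gramS t x l b) = \<dots>" .
  have "(\<Sum>l<s. gramP s t n x a l * partial (Inr (i, j)) (\<lambda>x. gramS t x l b) x) =
    (if b = i then gramPX s t n x a j else 0)"
    using Suc.prems assms by (auto simp: partial_gramS[of _ s] gramPX_def)
  then show ?case
    using Suc.prems assms by (auto simp: partial_gramP_Suc 1 simp del: gramP.simps(2))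
qed

lemma partial_gramP_Inl:
  assumes "a < s" "b < s" "i < s" "j < t"
  shows "partial (Inl (i, j)) (\<lambda>x. gramP s t n x a b) x =
    (\<Sum>c<n. gramP s t c x a i * gramYP s t (n - 1 - c) x j b)"
  using assms(2)
proof (induction n arbitrary: b)
  case 0
  then show ?case by simp
next
  case (Suc n)
  have Y: "(\<Sum>l<s. gramYP s t m x j l * gramS t x l b) = gramYP s t (Suc m) x j b" for m
  proof -
    have "gramYP s t 1 x j b = (\<Sum>h<s. x (Inr (h, j)) * gramS t x h b)"
      unfolding gramYP_def One_nat_def gramP.simps
      by (intro sum.cong refl) (simp add: if_distrib[of "\<lambda>z. z * _"] cong: if_cong)
    have "gramP s t 1 x h b = gramS t x h b" if "h < s" for h
      using that by (simp add: if_distrib[of "\<lambda>z. z * _"] cong: if_cong)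
    then show ?thesis using gramYP_add[OF Suc.prems, of t m x j 1] by simp
  qed
  have "(\<Sum>l<s. partial (Inl (i, j)) (\<lambda>x. gramP s t n x a l) x * gramS t x l b) =
    (\<Sum>l<s. \<Sum>c<n. gramP s t c x a i * (gramYP s t (n - 1 - c) x j l * gramS t x l b))"
    using Suc.IH by (simp add: sum_distrib_right mult.assoc)
  also have "\<dots> = (\<Sum>c<n. gramP s t c x a i * gramYP s t (Suc (n - 1 - c)) x j b)"
    by (subst sum.swap) (simp add: sum_distrib_left[symmetric] Y)
  also have "\<dots> = (\<Sum>c<n. gramP s t c x a i * gramYP s t (Suc n - 1 - c) x j b)"
    by (intro sum.cong refl) (simp add: Suc_diff_Suc)
  finally have 1: "(\<Sum>l<s. partial (Inl (i, j)) (\<lambda>x. gramP s t n x a l) x * gramS t x l b) = \<dots>" .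
  have "(\<Sum>l<s. gramP s t n x a l * partial (Inl (i, j)) (\<lambda>x. gramS t x l b) x) =
    (\<Sum>l<s. if l = i then gramP s t n x a i * x (Inr (b, j)) else 0)"
    using Suc.prems assms by (intro sum.cong refl) (auto simp: partial_gramS[of _ s])
  also have "\<dots> = gramP s t n x a i * gramYP s t 0 x j b"
    using assms Suc.prems by (simp add: gramYP_def if_distrib[of "\<lambda>z. _ * z"] cong: if_cong)
  finally show ?case
    using Suc.prems assms by (simp add: partial_gramP_Suc 1 del: gramP.simps(2))
qed

text \<open>Closing the trace recombines the two outer powers, so each of the n positions
  contributes the same S^(n - 1) X.\<close>

lemma partial_gramTr_Inr:
  assumes "i < s" "j < t"
  shows "partial (Inr (i, j)) (gramTr s t n) = (\<lambda>x. of_nat n * gramPX s t (n - 1) x i j)"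
proof
  fix x
  have "partial (Inr (i, j)) (gramTr s t n) x =
    (\<Sum>a<s. \<Sum>c<n. gramP s t (n - 1 - c) x i a * gramPX s t c x a j)"
    unfolding gramTr_def using assms
    by (simp add: partial_sum[OF finite_gvars[of s t]] poly_fun_gramP partial_gramP_Inr mult.commute)
  also have "\<dots> = (\<Sum>c<n. gramPX s t (n - 1 - c + c) x i j)"
    by (subst sum.swap) (simp add: gramP_add_sum)
  finally show "partial (Inr (i, j)) (gramTr s t n) x = of_nat n * gramPX s t (n - 1) x i j"
    by simp
qed

lemma partial_gramTr_Inl:
  assumes "i < s" "j < t"
  shows "partial (Inl (i, j)) (gramTr s t n) = (\<lambda>x. of_nat n * gramYP s t (n - 1) x j i)"
proof
  fix x
  have "partial (Inl (i, j)) (gramTr s t n) x =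
    (\<Sum>a<s. \<Sum>c<n. gramYP s t (n - 1 - c) x j a * gramP s t c x a i)"
    unfolding gramTr_def using assms
    by (simp add: partial_sum[OF finite_gvars[of s t]] poly_fun_gramP partial_gramP_Inl mult.commute)
  also have "\<dots> = (\<Sum>c<n. gramYP s t (n - 1 - c + c) x j i)"
    by (subst sum.swap) (simp add: gramYP_add[OF assms(1)])
  finally show "partial (Inl (i, j)) (gramTr s t n) x = of_nat n * gramYP s t (n - 1) x j i"
    by simp
qed

text \<open>Differentiating the explicit X in S^(n - 1) X gives the factor \<open>t\<close> from the
  sum over columns. Differentiating one of the n - 1 factors S cuts the trace in two, tr S^a times
  tr S^(n - 1 - a) with a < n - 1.\<close>

lemma heatX_gramTr:
  "heatX s t (gramTr s t n) x =
    of_nat n * ((\<Sum>a<n - 1. gramTr s t a x * gramTr s t (n - 1 - a) x) + of_nat t * gramTr s t (n - 1) x)"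
proof -
  have "heatX s t (gramTr s t n) x = (\<Sum>i<s. \<Sum>j<t. partial (Inl (i, j)) (partial (Inr (i, j)) (gramTr s t n)) x)"
    unfolding heatX_def sum.cartesian_product by (simp add: case_prod_unfold)
  also have "\<dots> = (\<Sum>i<s. \<Sum>j<t. of_nat n * ((\<Sum>c<n - 1. gramP s t c x i i *
      (\<Sum>l<s. gramYP s t (n - 2 - c) x j l * x (Inl (l, j)))) + gramP s t (n - 1) x i i))"
  proof (intro sum.cong refl)
    fix i j assume "i \<in> {..<s}" "j \<in> {..<t}"
    then have ij: "i < s" "j < t" by auto
    have "partial (Inl (i, j)) (\<lambda>x. gramPX s t m x i j) x =
      (\<Sum>l<s. (\<Sum>c<m. gramP s t c x i i * gramYP s t (m - 1 - c) x j l) * x (Inl (l, j)) +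
        gramP s t m x i l * (if l = i then 1 else 0))" for m
      unfolding gramPX_def using ij
      by (simp add: partial_sum[OF finite_gvars[of s t]] partial_mult[OF finite_gvars[of s t]] poly_fun_mult
          poly_fun_gramP poly_fun_gram_var partial_gramP_Inl partial_var eq_commute[of i])
    also have "\<dots> m = (\<Sum>c<m. gramP s t c x i i * (\<Sum>l<s. gramYP s t (m - 1 - c) x j l * x (Inl (l, j)))) +
        gramP s t m x i i" for m
    proof -
      have "(\<Sum>l<s. (\<Sum>c<m. gramP s t c x i i * gramYP s t (m - 1 - c) x j l) * x (Inl (l, j))) =
        (\<Sum>c<m. gramP s t c x i i * (\<Sum>l<s. gramYP s t (m - 1 - c) x j l * x (Inl (l, j))))"
        unfolding sum_distrib_right sum_distrib_left by (subst sum.swap) (simp add: mult.assoc)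
      moreover have "(\<Sum>l<s. gramP s t m x i l * (if l = i then 1 else 0)) = gramP s t m x i i"
        using ij by (simp add: if_distrib[of "\<lambda>z. _ * z"] cong: if_cong)
      ultimately show ?thesis by (simp only: sum.distrib)
    qed
    finally show "partial (Inl (i, j)) (partial (Inr (i, j)) (gramTr s t n)) x = of_nat n * ((\<Sum>c<n - 1. gramP s t c x i i *
      (\<Sum>l<s. gramYP s t (n - 2 - c) x j l * x (Inl (l, j)))) + gramP s t (n - 1) x i i)"
      by (simp add: partial_gramTr_Inr ij partial_cmult[OF finite_gvars[of s t]] poly_fun_gramPX numeral_2_eq_2)
  qed
  also have "\<dots> = of_nat n * ((\<Sum>c<n - 1. gramTr s t c x * 
      (\<Sum>j<t. \<Sum>l<s. gramYP s t (n - 2 - c) x j l * x (Inl (l, j)))) + of_nat t * gramTr s t (n - 1) x)"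
  proof -
    have "(\<Sum>i<s. \<Sum>j<t. \<Sum>c<n - 1. gramP s t c x i i * Y c j) = (\<Sum>c<n - 1. gramTr s t c x * (\<Sum>j<t. Y c j))" for Y
    proof -
      have "(\<Sum>i<s. \<Sum>j<t. \<Sum>c<n - 1. gramP s t c x i i * Y c j) = (\<Sum>i<s. \<Sum>c<n - 1. gramP s t c x i i * (\<Sum>j<t. Y c j))"
        unfolding sum_distrib_left by (intro sum.cong refl sum.swap)
      also have "\<dots> = (\<Sum>c<n - 1. gramTr s t c x * (\<Sum>j<t. Y c j))"
        by (subst sum.swap) (simp add: gramTr_def sum_distrib_right)
      finally show ?thesis .
    qed
    note * = this
    show ?thesis
      unfolding sum_distrib_left[symmetric] sum.distrib * by (simp add: gramTr_def sum_distrib_left)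
  qed
  also have "\<dots> = of_nat n * ((\<Sum>a<n - 1. gramTr s t a x * gramTr s t (n - 1 - a) x) + of_nat t * gramTr s t (n - 1) x)"
  proof -
    have "Suc (n - 2 - c) = n - 1 - c" if "c < n - 1" for c
      using that by linarith
    then show ?thesis unfolding gramTr_cyclic
      by (intro arg_cong2[where f = "(*)"] arg_cong2[where f = "(+)"] sum.cong refl)
        (metis lessThan_iff)
  qed
  finally show ?thesis .
qed

text \<open>Both products pair a gradient Y^T S^a with a gradient S^b X where a + b = n + m - 2.
  Cyclicity turns either into tr S^(n + m - 1), hence the factor 2. The truncated subtraction
  matters only when the coefficient vanishes.\<close>

lemma gammaX_gramTr:
  "gammaX s t (gramTr s t n) (gramTr s t m) x = 2 * of_nat n * of_nat m * gramTr s t (n + m - 1) x"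
proof (cases "n = 0 \<or> m = 0")
  case True
  then show ?thesis
    unfolding gammaX_def by (intro trans[OF sum.neutral]) (auto simp: partial_gramTr_Inl partial_gramTr_Inr)
next
  case False
  have *: "(\<Sum>i<s. \<Sum>j<t. gramYP s t a x j i * gramPX s t b x i j) = gramTr s t (Suc (a + b)) x" for a b
  proof -
    have "(\<Sum>i<s. \<Sum>j<t. gramYP s t a x j i * gramPX s t b x i j) =
      (\<Sum>j<t. \<Sum>i<s. \<Sum>l<s. gramYP s t a x j i * gramP s t b x i l * x (Inl (l, j)))"
      by (subst sum.swap) (simp add: gramPX_def sum_distrib_left mult.assoc)
    also have "\<dots> = (\<Sum>j<t. \<Sum>l<s. (\<Sum>i<s. gramYP s t a x j i * gramP s t b x i l) * x (Inl (l, j)))"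
      unfolding sum_distrib_right by (intro sum.cong refl sum.swap)
    also have "\<dots> = (\<Sum>j<t. \<Sum>l<s. gramYP s t (a + b) x j l * x (Inl (l, j)))"
      by (intro sum.cong refl) (simp add: gramYP_add)
    finally show ?thesis by (simp add: gramTr_cyclic)
  qed
  have "gammaX s t (gramTr s t n) (gramTr s t m) x =
    (\<Sum>i<s. \<Sum>j<t. partial (Inl (i, j)) (gramTr s t n) x * partial (Inr (i, j)) (gramTr s t m) x +
       partial (Inr (i, j)) (gramTr s t n) x * partial (Inl (i, j)) (gramTr s t m) x)"
    unfolding gammaX_def sum.cartesian_product by (simp add: case_prod_unfold)
  also have "\<dots> = (\<Sum>i<s. \<Sum>j<t. of_nat n * of_nat m * (gramYP s t (n - 1) x j i * gramPX s t (m - 1) x i j) +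
      of_nat n * of_nat m * (gramYP s t (m - 1) x j i * gramPX s t (n - 1) x i j))"
    by (intro sum.cong refl) (simp add: partial_gramTr_Inl partial_gramTr_Inr mult_ac)
  also have "\<dots> = of_nat n * of_nat m * gramTr s t (Suc (n - 1 + (m - 1))) x +
     of_nat n * of_nat m * gramTr s t (Suc (m - 1 + (n - 1))) x"
    by (simp only: sum.distrib sum_distrib_left[symmetric] *)
  finally show ?thesis
    using False by (simp add: Suc_diff_Suc add.commute)
qed

lemma heat_op_X: "heat_op (gvars s t) (heatX s t)"
proof
  fix f g assume "poly_fun (gvars s t) f" "poly_fun (gvars s t) g"
  then show "heatX s t (\<lambda>x. f x + g x) = (\<lambda>x. heatX s t f x + heatX s t g x)"
    by (simp add: heatX_def partial_add[OF finite_gvars[of s t]] poly_fun_partial sum.distrib)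
next
  fix f c assume "poly_fun (gvars s t) f"
  then show "heatX s t (\<lambda>x. c * f x) = (\<lambda>x. c * heatX s t f x)"
    by (simp add: heatX_def partial_cmult[OF finite_gvars[of s t]] poly_fun_partial sum_distrib_left)
next
  fix f assume "poly_fun (gvars s t) f"
  then show "poly_fun (gvars s t) (heatX s t f)"
    unfolding heatX_def by (intro poly_fun_sum poly_fun_partial finite_gvars)
qed

lemma power_sum_heat_X:
  "power_sum_heat (gvars s (q + s)) (heatX s (q + s)) (\<lambda>x. 1) (gammaX s (q + s)) (gramTr s (q + s)) q"
proof -
  note pds = partial_add[OF finite_gvars] partial_mult[OF finite_gvars]
  interpret heat_op "gvars s (q + s)" "heatX s (q + s)" by (rule heat_op_X)
  show ?thesis
  proof
    show "poly_fun (gvars s (q + s)) (\<lambda>x. 1)" by simp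
    show "poly_fun (gvars s (q + s)) (gramTr s (q + s) n)" for n by (rule poly_fun_gramTr)
    show "heatX s (q + s) (\<lambda>x. 1) = (\<lambda>x. 0)" by (simp add: heatX_def)
    show "gammaX s (q + s) f (\<lambda>x. c) = (\<lambda>x. 0)" for f c by (simp add: gammaX_def)
    show "gammaX s (q + s) (gramTr s (q + s) n) (gramTr s (q + s) m) =
      (\<lambda>x. 2 * of_nat n * of_nat m * gramTr s (q + s) (n + m - 1) x)" for n m
      by (rule ext) (rule gammaX_gramTr)
    fix f g h assume "poly_fun (gvars s (q + s)) f" "poly_fun (gvars s (q + s)) g" "poly_fun (gvars s (q + s)) h"
    then show "gammaX s (q + s) f (\<lambda>x. g x * h x) =
      (\<lambda>x. gammaX s (q + s) f g x * h x + g x * gammaX s (q + s) f h x)"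
      by (simp add: gammaX_def pds[of s "q + s"] sum_distrib_left sum_distrib_right sum.distrib algebra_simps)
  next
    fix f g assume "poly_fun (gvars s (q + s)) f" "poly_fun (gvars s (q + s)) g"
    then show "heatX s (q + s) (\<lambda>x. 1 * (f x * g x)) =
      (\<lambda>x. heatX s (q + s) (\<lambda>x. 1 * f x) x * g x + f x * heatX s (q + s) (\<lambda>x. 1 * g x) x + 1 * gammaX s (q + s) f g x)"
      by (simp add: heatX_def gammaX_def pds[of s "q + s"] poly_fun_mult poly_fun_partial 
          sum_distrib_left sum_distrib_right sum.distrib algebra_simps)
  next
    fix n
    show "heatX s (q + s) (\<lambda>x. 1 * gramTr s (q + s) n x) = (\<lambda>x. 1 * (of_nat n *
      ((\<Sum>a<n. gramTr s (q + s) a x * gramTr s (q + s) (n - 1 - a) x) + of_nat q * gramTr s (q + s) (n - 1) x)))"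
    proof (cases n)
      case 0
      then show ?thesis by (simp add: fun_eq_iff heatX_gramTr)
    next
      case (Suc m)
      \<comment> \<open>The summand a = n - 1 that the common rule has in addition is tr S^(n - 1)
        times tr S^0 = s. It absorbs \<open>s\<close> of the \<open>q + s\<close> columns and leaves
        the coefficient \<open>q\<close>.\<close>
      have "gramTr s (q + s) 0 x = of_nat s" for x by (simp add: gramTr_def)
      then show ?thesis by (simp add: fun_eq_iff heatX_gramTr Suc algebra_simps)
    qed
  qed
qed

section \<open>The Vandermonde determinant\<close>

definition vdm :: "nat \<Rightarrow> (nat \<Rightarrow> 'a :: comm_ring_1) \<Rightarrow> 'a" where
  "vdm s x = (\<Prod>(i, j)\<in>{(i, j). i < j \<and> j < s}. x i - x j)"

lemma finite_pairs: "finite {(i, j). i < j \<and> j < (s :: nat)}"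
  by (rule finite_subset[of _ "{..<s} \<times> {..<s}"]) auto

lemma vdm_Suc: "vdm (Suc s) x = (\<Prod>j<s. x 0 - x (Suc j)) * vdm s (\<lambda>j. x (Suc j))"
proof -
  have e: "{(i, j). i < j \<and> j < Suc s} =
    (\<lambda>j. (0, Suc j)) ` {..<s} \<union> (\<lambda>(i, j). (Suc i, Suc j)) ` {(i, j). i < j \<and> j < s}" (is "?P = ?A \<union> ?B")
  proof (intro equalityI subsetI)
    fix p assume "p \<in> ?P"
    then obtain i j where p: "p = (i, j)" "i < j" "j < Suc s" by auto
    then obtain j' where j': "j = Suc j'" using less_imp_Suc_add by blast
    show "p \<in> ?A \<union> ?B"
      using p j' by (cases i) (auto simp: image_iff)
  qed auto
  have "vdm (Suc s) x = (\<Prod>(i, j)\<in>?A. x i - x j) * (\<Prod>(i, j)\<in>?B. x i - x j)"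
    unfolding vdm_def e by (rule prod.union_disjoint) (auto intro: finite_imageI finite_pairs)
  also have "(\<Prod>(i, j)\<in>?A. x i - x j) = (\<Prod>j<s. x 0 - x (Suc j))"
    by (subst prod.reindex) (auto simp: inj_on_def)
  also have "(\<Prod>(i, j)\<in>?B. x i - x j) = vdm s (\<lambda>j. x (Suc j))"
    unfolding vdm_def by (subst prod.reindex) (auto simp: inj_on_def case_prod_unfold)
  finally show ?thesis .
qed

lemma poly_eq_lead_prod_roots:
  fixes p :: "'a :: field poly"
  assumes "degree p \<le> n" "inj_on y {..<n}" "\<And>j. j < n \<Longrightarrow> poly p (y j) = 0"
  shows "p = Polynomial.smult (coeff p n) (\<Prod>j<n. [:- y j, 1:])"
proof (rule ccontr)
  define q where "q = (\<Prod>j<n. [:- y j, 1:])"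
  have dq: "degree q = n" unfolding q_def
    by (subst degree_prod_eq_sum_degree) auto
  have "lead_coeff q = 1" unfolding q_def
    by (simp add: lead_coeff_prod)
  then have cq: "coeff q n = 1" by (simp add: dq)
  define r where "r = p - Polynomial.smult (coeff p n) q"
  assume "p \<noteq> Polynomial.smult (coeff p n) (\<Prod>j<n. [:- y j, 1:])"
  then have r0: "r \<noteq> 0" by (simp add: r_def q_def)
  have "degree r \<le> n" unfolding r_def using assms(1) dq
    by (intro degree_diff_le) (auto intro: order_trans[OF degree_smult_le])
  moreover have "coeff r n = 0" by (simp add: r_def cq)
  ultimately have dr: "degree r < n"
    using r0 by (metis le_neq_implies_less leading_coeff_0_iff)
  have "poly q (y j) = 0" if "j < n" for j
    unfolding q_def poly_prod using that by (intro prod_zero) auto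
  then have "y ` {..<n} \<subseteq> {x. poly r x = 0}"
    using assms(3) by (auto simp: r_def)
  then have "card (y ` {..<n}) \<le> card {x. poly r x = 0}"
    by (intro card_mono poly_roots_finite r0)
  also have "\<dots> \<le> degree r" by (rule card_poly_roots_bound[OF r0])
  finally show False using dr by (simp add: card_image assms(2))
qed

lemma vdm_eq_0:
  fixes x :: "nat \<Rightarrow> 'a :: idom"
  shows "vdm s x = 0 \<longleftrightarrow> \<not> inj_on x {..<s}"
proof -
  have "vdm s x = 0 \<longleftrightarrow> (\<exists>i j. i < j \<and> j < s \<and> x i = x j)"
    unfolding vdm_def using finite_pairs[of s] by (auto simp: prod_zero_iff)
  also have "\<dots> \<longleftrightarrow> \<not> inj_on x {..<s}"
    unfolding inj_on_def by (auto; metis linorder_neqE_nat order_less_trans)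
  finally show ?thesis .
qed

text \<open>In its first node the determinant is a polynomial of degree at most n that vanishes at
  the other nodes and has the smaller determinant as n-th coefficient. Exponents decrease down the
  rows, so no sign arises against the factors \<open>x i - x j\<close> with i < j.\<close>

theorem det_vdm:
  fixes x :: "nat \<Rightarrow> 'a :: field"
  shows "det (mat s s (\<lambda>(i, j). x j ^ (s - 1 - i))) = vdm s x"
proof (induction s arbitrary: x)
  case 0
  then show ?case by (simp add: vdm_def)
next
  case (Suc n)
  \<comment> \<open>The first node is freed as z; the cofactors of column 0 do not contain
    it.\<close>
  define A where "A z = mat (Suc n) (Suc n) (\<lambda>(i, j). (x(0 := z)) j ^ (n - i))" for z
  have A_carrier: "A z \<in> carrier_mat (Suc n) (Suc n)" for z by (simp add: A_def)
  let ?y = "\<lambda>j. x (Suc j)"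
  define c where "c i = cofactor (A 0) i 0" for i
  have del: "mat_delete (A z) i 0 = mat_delete (A 0) i 0" for z i
    unfolding mat_delete_def A_def by (rule eq_matI) auto
  have cof: "cofactor (A z) i 0 = c i" for z i
    by (simp add: cofactor_def c_def del[of z])
  define p where "p = (\<Sum>i<Suc n. monom (c i) (n - i))"
  have p: "det (A z) = poly p z" for z
  proof -
    have "A z $$ (i, 0) = z ^ (n - i)" if "i < Suc n" for i using that by (simp add: A_def)
    then show ?thesis
      using laplace_expansion_column[OF A_carrier, of 0 z]
      by (simp add: cof p_def poly_sum poly_monom mult.commute)
  qed
  have c0: "c 0 = vdm n ?y"
  proof -
    have "mat_delete (A 0) 0 0 = mat n n (\<lambda>(i, j). ?y j ^ (n - 1 - i))"
      unfolding mat_delete_def A_def by (rule eq_matI) auto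
    then show ?thesis using Suc[of ?y] by (simp add: c_def cofactor_def)
  qed
  have cp: "coeff p n = c 0"
  proof -
    have "coeff p n = (\<Sum>i<Suc n. if i = 0 then c 0 else 0)"
      unfolding p_def coeff_sum by (rule sum.cong) auto
    then show ?thesis by simp
  qed
  have dp: "degree p \<le> n"
    unfolding p_def by (intro degree_sum_le) (auto intro: order_trans[OF degree_monom_le])
  have *: "poly p (x 0) = (\<Prod>j<n. x 0 - ?y j) * c 0"
  proof (cases "inj_on ?y {..<n}")
    case True
    have "poly p (?y j) = 0" if "j < n" for j
      unfolding p[symmetric]
      by (rule det_identical_columns[OF A_carrier, of 0 "Suc j"])
        (use that in \<open>auto intro!: eq_vecI simp: A_def\<close>)
    from poly_eq_lead_prod_roots[OF dp True this] have "poly p (x 0) =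
      poly (Polynomial.smult (coeff p n) (\<Prod>j<n. [:- ?y j, 1:])) (x 0)" by simp
    then show ?thesis by (simp add: cp poly_prod mult.commute)
  next
    \<comment> \<open>With two equal nodes among the others there are too few distinct roots to
      count, but both sides vanish.\<close>
    case False
    then have "c 0 = 0" unfolding c0 vdm_eq_0 by simp
    moreover have "poly p (x 0) = 0"
    proof -
      from False obtain i j where ij: "i < n" "j < n" "i \<noteq> j" "?y i = ?y j"
        by (auto simp: inj_on_def)
      have "col (A z) (Suc i) = col (A z) (Suc j)" for z
        by (rule eq_vecI) (use ij(1,2) in \<open>simp_all add: A_def ij(4)\<close>)
      then show ?thesis
        unfolding p[symmetric]
        using det_identical_columns[OF A_carrier, of "Suc i" "Suc j"] ij(1-3) by simp
    qed
    ultimately show ?thesis by (simp only: mult_zero_right)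
  qed
  have "mat (Suc n) (Suc n) (\<lambda>(i, j). x j ^ (Suc n - 1 - i)) = A (x 0)"
    unfolding A_def fun_upd_triv by simp
  then have "det (mat (Suc n) (Suc n) (\<lambda>(i, j). x j ^ (Suc n - 1 - i))) = poly p (x 0)"
    by (simp only: p)
  then show ?case unfolding * vdm_Suc c0 .
qed

section \<open>The radial operator on power sums of the eigenvalues\<close>

text \<open>Each summand is the radial part, in the variable |z|^2, of the operator sum of d/dz
  d/dz' (z' the conjugate) on q + 1 complex coordinates.\<close>

definition heatL :: "nat \<Rightarrow> nat \<Rightarrow> ((nat \<Rightarrow> complex) \<Rightarrow> complex) \<Rightarrow> (nat \<Rightarrow> complex) \<Rightarrow> complex" where
  "heatL s q f = (\<lambda>x. \<Sum>j<s. x j * partial j (partial j f) x + of_nat (q + 1) * partial j f x)"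

definition gammaL :: "nat \<Rightarrow> ((nat \<Rightarrow> complex) \<Rightarrow> complex) \<Rightarrow> ((nat \<Rightarrow> complex) \<Rightarrow> complex) \<Rightarrow> (nat \<Rightarrow> complex) \<Rightarrow> complex" where
  "gammaL s f g = (\<lambda>x. \<Sum>j<s. 2 * x j * partial j f x * partial j g x)"

definition powsum :: "nat \<Rightarrow> nat \<Rightarrow> (nat \<Rightarrow> complex) \<Rightarrow> complex" where
  "powsum s n x = (\<Sum>j<s. x j ^ n)"

lemma heat_op_L: "heat_op {..<s} (heatL s q)"
proof
  fix f g assume "poly_fun {..<s} f" "poly_fun {..<s} g"
  then show "heatL s q (\<lambda>x. f x + g x) = (\<lambda>x. heatL s q f x + heatL s q g x)"
    by (simp add: heatL_def partial_add[OF finite_lessThan[of s]] poly_fun_partial sum.distrib algebra_simps)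
next
  fix f c assume "poly_fun {..<s} f"
  then show "heatL s q (\<lambda>x. c * f x) = (\<lambda>x. c * heatL s q f x)"
    by (simp add: heatL_def partial_cmult[OF finite_lessThan[of s]] poly_fun_partial sum_distrib_left algebra_simps)
next
  fix f assume "poly_fun {..<s} f"
  then show "poly_fun {..<s} (heatL s q f)"
    unfolding heatL_def by (intro poly_fun_sum poly_fun_partial poly_fun_add poly_fun_mult poly_fun_var poly_fun_const) auto
qed

lemma heatL_mult:
  assumes "poly_fun {..<s} f" "poly_fun {..<s} g"
  shows "heatL s q (\<lambda>x. f x * g x) = (\<lambda>x. heatL s q f x * g x + f x * heatL s q g x + gammaL s f g x)"
  using assms
  by (simp add: heatL_def gammaL_def partial_mult[OF finite_lessThan[of s]] partial_add[OF finite_lessThan[of s]]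
      poly_fun_mult poly_fun_partial sum_distrib_left sum_distrib_right sum.distrib algebra_simps)

lemma gammaL_mult:
  assumes "poly_fun {..<s} g" "poly_fun {..<s} h"
  shows "gammaL s f (\<lambda>x. g x * h x) = (\<lambda>x. gammaL s f g x * h x + g x * gammaL s f h x)"
  using assms
  by (simp add: gammaL_def partial_mult[OF finite_lessThan[of s]]
      poly_fun_mult sum_distrib_left sum_distrib_right sum.distrib algebra_simps)

lemma poly_fun_vdm: "poly_fun {..<s} (vdm s)"
  unfolding vdm_def[abs_def] case_prod_unfold
  by (intro poly_fun_prod poly_fun_diff poly_fun_var) auto

lemma poly_fun_powsum: "poly_fun {..<s} (powsum s n)"
  unfolding powsum_def[abs_def] by (intro poly_fun_sum poly_fun_power poly_fun_var) auto

lemma partial_power: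
  assumes "j < s"
  shows "partial i (\<lambda>x. x j ^ n) = (\<lambda>x. if i = j then of_nat n * x j ^ (n - 1) else 0)"
  by (rule ext, rule partial_eqI) (auto intro!: derivative_eq_intros)

lemma partial_powsum:
  assumes "i < s"
  shows "partial i (powsum s n) = (\<lambda>x. of_nat n * x i ^ (n - 1))"
proof -
  have "partial i (powsum s n) = (\<lambda>x. \<Sum>j<s. partial i (\<lambda>x. x j ^ n) x)"
    unfolding powsum_def[abs_def]
    by (rule partial_sum[OF finite_lessThan[of s]]) (auto intro!: poly_fun_power poly_fun_var)
  also have "\<dots> = (\<lambda>x. \<Sum>j<s. if i = j then of_nat n * x j ^ (n - 1) else 0)"
    by (intro ext sum.cong refl) (auto simp: partial_power[of _ s])
  finally show ?thesis using assms by simp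
qed

lemma heatL_powsum:
  "heatL s q (powsum s n) x = of_nat n * of_nat (n + q) * powsum s (n - 1) x"
proof -
  have "heatL s q (powsum s n) x = (\<Sum>j<s. of_nat n * of_nat (n + q) * x j ^ (n - 1))"
    unfolding heatL_def
  proof (intro sum.cong refl)
    fix j assume j: "j \<in> {..<s}"
    have "partial j (\<lambda>x. of_nat n * x j ^ (n - 1)) x = of_nat n * (of_nat (n - 1) * x j ^ (n - 1 - 1))"
      using j by (subst partial_cmult[OF finite_lessThan[of s]])
        (auto intro!: poly_fun_power poly_fun_var simp: partial_power[of _ s])
    then show "x j * partial j (partial j (powsum s n)) x + of_nat (q + 1) * partial j (powsum s n) x =
        of_nat n * of_nat (n + q) * x j ^ (n - 1)"
      using j by (cases n; cases "n - 1") (auto simp: partial_powsum algebra_simps)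
  qed
  then show ?thesis by (simp add: powsum_def sum_distrib_left)
qed

lemma partial_prod:
  assumes "finite A" "\<forall>i\<in>I. poly_fun A (f i)"
  shows "partial v (\<lambda>x. \<Prod>i\<in>I. f i x) = (\<lambda>x. \<Sum>i\<in>I. partial v (f i) x * (\<Prod>k\<in>I - {i}. f k x))"
  using assms(2)
proof (induction I rule: infinite_finite_induct)
  case (insert i I)
  have "(\<Sum>k\<in>I. partial v (f k) x * (\<Prod>l\<in>insert i I - {k}. f l x)) =
    (\<Sum>k\<in>I. f i x * (partial v (f k) x * (\<Prod>l\<in>I - {k}. f l x)))" for x
  proof (intro sum.cong refl)
    fix k assume "k \<in> I"
    then have "insert i I - {k} = insert i (I - {k})" using insert by auto
    then show "partial v (f k) x * (\<Prod>l\<in>insert i I - {k}. f l x) = f i x * (partial v (f k) x * (\<Prod>l\<in>I - {k}. f l x))"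
      using insert by simp
  qed
  then show ?case
    using insert by (simp add: partial_mult[OF assms(1)] poly_fun_prod sum_distrib_left)
qed auto

text \<open>Formally, the j-th derivative of log V is the sum of 1 / (x j - x k) over k. Weighting
  with x j ^ n and pairing indices produces divided differences of the n-th power. Their sum over
  all ordered pairs, diagonal included, is the sum of P a P (n - 1 - a); the diagonal is n P (n -
  1), which explains the subtraction. Instead of dividing, the corresponding factor of V is left
  out.\<close>

lemma gammaL_vdm_powsum:
  "gammaL s (vdm s) (powsum s n) x =
    vdm s x * (of_nat n * ((\<Sum>a<n. powsum s a x * powsum s (n - 1 - a) x) - of_nat n * powsum s (n - 1) x))"
proof (cases "n = 0")
  case True
  then show ?thesis by (simp add: gammaL_def partial_powsum)
next
  case False
  let ?P = "{(i, j). i < j \<and> j < s}"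
  have V: "partial j (vdm s) x = (\<Sum>p\<in>?P. ((if j = fst p then 1 else 0) - (if j = snd p then 1 else 0)) *
      (\<Prod>p\<in>?P - {p}. x (fst p) - x (snd p)))" for j
  proof -
    have "partial j (vdm s) x = (\<Sum>p\<in>?P. partial j (\<lambda>x. x (fst p) - x (snd p)) x * (\<Prod>p\<in>?P - {p}. x (fst p) - x (snd p)))"
      unfolding vdm_def[abs_def] case_prod_unfold
      by (subst partial_prod[OF finite_lessThan[of s]]) (auto intro!: poly_fun_diff poly_fun_var)
    moreover have "partial j (\<lambda>x. x (fst p) - x (snd p)) x = (if j = fst p then 1 else 0) - (if j = snd p then 1 else 0)"
      if "p \<in> ?P" for p
      using that by (subst partial_diff[OF finite_lessThan[of s]]) (auto intro!: poly_fun_var simp: partial_var)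
    ultimately show ?thesis by simp
  qed
  have 1: "(\<Sum>j<s. x j ^ n * partial j (vdm s) x) =
    (\<Sum>p\<in>?P. (x (fst p) ^ n - x (snd p) ^ n) * (\<Prod>p\<in>?P - {p}. x (fst p) - x (snd p)))"
  proof -
    have "(\<Sum>j<s. x j ^ n * partial j (vdm s) x) = (\<Sum>p\<in>?P. \<Sum>j<s. x j ^ n *
      (((if j = fst p then 1 else 0) - (if j = snd p then 1 else 0)) * (\<Prod>p\<in>?P - {p}. x (fst p) - x (snd p))))"
      unfolding V sum_distrib_left by (rule sum.swap)
    also have "\<dots> = (\<Sum>p\<in>?P. (\<Sum>j<s. x j ^ n * ((if j = fst p then 1 else 0) - (if j = snd p then 1 else 0))) *
         (\<Prod>p\<in>?P - {p}. x (fst p) - x (snd p)))"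
      by (simp add: sum_distrib_right mult.assoc)
    also have "\<dots> = (\<Sum>p\<in>?P. (x (fst p) ^ n - x (snd p) ^ n) * (\<Prod>p\<in>?P - {p}. x (fst p) - x (snd p)))"
    proof (intro sum.cong refl arg_cong2[where f = "(*)"])
      fix p assume "p \<in> ?P"
      then have "fst p < s" "snd p < s" by auto
      then show "(\<Sum>j<s. x j ^ n * ((if j = fst p then 1 else 0) - (if j = snd p then 1 else 0))) =
        x (fst p) ^ n - x (snd p) ^ n"
        by (simp add: right_diff_distrib sum_subtractf if_distrib[of "\<lambda>z. _ * z"] cong: if_cong)
    qed
    finally show ?thesis .
  qed
  \<comment> \<open>The divided difference of the n-th power at \<open>x i\<close> and
    \<open>x j\<close>, written as a polynomial; on the diagonal it is the derivative.\<close>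
  define h where "h i j = (\<Sum>a<n. x j ^ (n - 1 - a) * x i ^ a)" for i j
  have h_sym: "h i j = h j i" for i j
    unfolding h_def
    by (rule sum.reindex_bij_witness[of _ "\<lambda>a. n - 1 - a" "\<lambda>a. n - 1 - a"]) (auto simp: mult.commute)
  have h_diag: "h i i = of_nat n * x i ^ (n - 1)" for i
  proof -
    have "h i i = (\<Sum>a<n. x i ^ (n - 1))"
      unfolding h_def by (intro sum.cong refl) (simp flip: power_add)
    then show ?thesis by simp
  qed
  have "(x (fst p) ^ n - x (snd p) ^ n) * (\<Prod>p\<in>?P - {p}. x (fst p) - x (snd p)) = vdm s x * h (fst p) (snd p)"
    if "p \<in> ?P" for p
  proof -
    have "vdm s x = (x (fst p) - x (snd p)) * (\<Prod>p\<in>?P - {p}. x (fst p) - x (snd p))"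
      unfolding vdm_def case_prod_unfold by (rule prod.remove) (use that finite_pairs[of s, unfolded case_prod_unfold] in auto)
    then show ?thesis by (simp add: power_diff_sumr2 h_def)
  qed
  then have 2: "(\<Sum>j<s. x j ^ n * partial j (vdm s) x) = vdm s x * (\<Sum>p\<in>?P. h (fst p) (snd p))"
    unfolding 1 sum_distrib_left by (rule sum.cong[OF refl])
  have "(\<Sum>a<n. powsum s a x * powsum s (n - 1 - a) x) = (\<Sum>i<s. \<Sum>j<s. h i j)"
  proof -
    have "(\<Sum>a<n. powsum s a x * powsum s (n - 1 - a) x) = (\<Sum>a<n. \<Sum>i<s. \<Sum>j<s. x j ^ (n - 1 - a) * x i ^ a)"
      by (simp add: powsum_def sum_product mult.commute)
    also have "\<dots> = (\<Sum>i<s. \<Sum>a<n. \<Sum>j<s. x j ^ (n - 1 - a) * x i ^ a)"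
      by (rule sum.swap)
    also have "\<dots> = (\<Sum>i<s. \<Sum>j<s. h i j)"
      unfolding h_def by (intro sum.cong refl sum.swap)
    finally show ?thesis .
  qed
  also have "\<dots> = (\<Sum>p\<in>{..<s} \<times> {..<s}. h (fst p) (snd p))"
    by (simp add: sum.cartesian_product case_prod_unfold)
  also have "{..<s} \<times> {..<s} = ?P \<union> ((\<lambda>(i, j). (j, i)) ` ?P \<union> (\<lambda>i. (i, i)) ` {..<s})"
    by (auto simp: image_iff)
  also have "(\<Sum>p\<in>\<dots>. h (fst p) (snd p)) = (\<Sum>p\<in>?P. h (fst p) (snd p)) +
     ((\<Sum>p\<in>(\<lambda>(i, j). (j, i)) ` ?P. h (fst p) (snd p)) + (\<Sum>p\<in>(\<lambda>i. (i, i)) ` {..<s}. h (fst p) (snd p)))"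
    using finite_pairs[of s] by (subst sum.union_disjoint; (subst sum.union_disjoint)?) auto
  also have "(\<Sum>p\<in>(\<lambda>(i, j). (j, i)) ` ?P. h (fst p) (snd p)) = (\<Sum>p\<in>?P. h (fst p) (snd p))"
    by (subst sum.reindex) (auto simp: inj_on_def case_prod_unfold h_sym)
  also have "(\<Sum>p\<in>(\<lambda>i. (i, i)) ` {..<s}. h (fst p) (snd p)) = of_nat n * powsum s (n - 1) x"
    by (subst sum.reindex) (auto simp: inj_on_def powsum_def h_diag sum_distrib_left)
  finally have 3: "2 * (\<Sum>p\<in>?P. h (fst p) (snd p)) =
    (\<Sum>a<n. powsum s a x * powsum s (n - 1 - a) x) - of_nat n * powsum s (n - 1) x"
    by simp
  have "gammaL s (vdm s) (powsum s n) x = of_nat n * (2 * (\<Sum>j<s. x j ^ n * partial j (vdm s) x))"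
    unfolding gammaL_def sum_distrib_left
  proof (intro sum.cong refl)
    fix j assume "j \<in> {..<s}"
    then show "2 * x j * partial j (vdm s) x * partial j (powsum s n) x = of_nat n * (2 * (x j ^ n * partial j (vdm s) x))"
      using False by (cases n) (auto simp: partial_powsum)
  qed
  also have "\<dots> = vdm s x * (of_nat n * (2 * (\<Sum>p\<in>?P. h (fst p) (snd p))))"
    unfolding 2 by (simp add: mult_ac)
  finally show ?thesis unfolding 3 .
qed


section \<open>Products of one-variable polynomials and their heat evolution\<close>

definition sep_prod :: "nat \<Rightarrow> (nat \<Rightarrow> complex poly) \<Rightarrow> (nat \<Rightarrow> complex) \<Rightarrow> complex" where
  "sep_prod s \<phi> x = (\<Prod>j<s. poly (\<phi> j) (x j))"

definition opL :: "nat \<Rightarrow> complex poly \<Rightarrow> complex poly" where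
  "opL q p = [:0, 1:] * pderiv (pderiv p) + Polynomial.smult (of_nat (q + 1)) (pderiv p)"

lemma poly_fun_poly: fixes s :: nat shows "j < s \<Longrightarrow> poly_fun {..<s} (\<lambda>x. poly p (x j))"
  unfolding poly_altdef by (intro poly_fun_sum poly_fun_mult poly_fun_const poly_fun_power poly_fun_var) auto

lemma poly_fun_sep_prod: "poly_fun {..<s} (sep_prod s \<phi>)"
  unfolding sep_prod_def[abs_def] by (intro poly_fun_prod poly_fun_poly) auto

lemma sep_prod_upd:
  assumes "j < s"
  shows "sep_prod s (\<phi>(j := p)) x = poly p (x j) * (\<Prod>k\<in>{..<s} - {j}. poly (\<phi> k) (x k))"
proof -
  have "(\<Prod>k\<in>{..<s} - {j}. poly ((\<phi>(j := p)) k) (x k)) = (\<Prod>k\<in>{..<s} - {j}. poly (\<phi> k) (x k))"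
    by (rule prod.cong) auto
  then show ?thesis
    unfolding sep_prod_def using assms prod.remove[of "{..<s}" j "\<lambda>k. poly ((\<phi>(j := p)) k) (x k)"] by simp
qed

lemma partial_sep_prod:
  assumes "j < s"
  shows "partial j (sep_prod s \<phi>) = sep_prod s (\<phi>(j := pderiv (\<phi> j)))"
proof (rule ext, rule partial_eqI)
  fix x
  have *: "sep_prod s \<phi> (x(j := z)) = poly (\<phi> j) z * (\<Prod>k\<in>{..<s} - {j}. poly (\<phi> k) (x k))" for z
  proof -
    have "(\<Prod>k\<in>{..<s} - {j}. poly (\<phi> k) ((x(j := z)) k)) = (\<Prod>k\<in>{..<s} - {j}. poly (\<phi> k) (x k))"
      by (rule prod.cong) auto
    then show ?thesis
      using sep_prod_upd[OF assms, of \<phi> "\<phi> j" "x(j := z)"] by simp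
  qed
  show "((\<lambda>z. sep_prod s \<phi> (x(j := z))) has_field_derivative sep_prod s (\<phi>(j := pderiv (\<phi> j))) x) (at (x j))"
    unfolding * sep_prod_upd[OF assms] by (intro DERIV_cmult_right poly_DERIV)
qed

lemma heatL_sep_prod: "heatL s q (sep_prod s \<phi>) = (\<lambda>x. \<Sum>j<s. sep_prod s (\<phi>(j := opL q (\<phi> j))) x)"
  unfolding heatL_def
  by (intro ext sum.cong refl) (simp add: partial_sep_prod sep_prod_upd opL_def algebra_simps)

lemma opL_monom: "opL q (monom 1 n) = monom (of_nat n * of_nat (n + q)) (n - 1)"
proof -
  have "[:0, 1:] * monom c m = monom c (Suc m)" for c :: complex and m
    by (simp add: monom_Suc)
  moreover have "monom (of_nat (n * (n - 1))) (Suc (n - 1 - 1)) = (monom (of_nat (n * (n - 1))) (n - 1) :: complex poly)"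
    by (cases n; cases "n - 1") auto
  ultimately show ?thesis
    by (cases n) (auto simp: opL_def pderiv_monom smult_monom add_monom algebra_simps)
qed

lemma vdm_eq_sep_prod:
  "vdm s x = (\<Sum>p | p permutes {0..<s}. signof p * sep_prod s (\<lambda>j. monom 1 (s - 1 - p j)) x)"
proof -
  have "vdm s x = det (mat s s (\<lambda>(i, j). x j ^ (s - 1 - i)))"
    by (rule det_vdm[symmetric])
  also have "\<dots> = (\<Sum>p | p permutes {0..<s}. signof p * sep_prod s (\<lambda>j. monom 1 (s - 1 - p j)) x)"
    by (subst det_col[of _ s])
      (auto simp: sep_prod_def poly_monom permutes_in_image intro!: sum.cong prod.cong arg_cong2[where f = "(*)"])
  finally show ?thesis .
qed

text \<open>Up to a scalar, \<open>opL\<close> lowers an exponent by one. In the alternant with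
  exponents s - 1, ..., 0 a lowered row coincides with the next row, and the last row has exponent
  0, where the scalar is 0. So every term vanishes.\<close>

lemma heatL_vdm: "heatL s q (vdm s) = (\<lambda>x. 0)"
proof
  fix x
  interpret heat_op "{..<s}" "heatL s q" by (rule heat_op_L)
  define e where "e i = s - 1 - i" for i :: nat
  define c :: "nat \<Rightarrow> complex" where "c n = of_nat n * of_nat (n + q)" for n
  define e' where "e' i k = (if k = i then e i - 1 else e k)" for i k
  have "heatL s q (vdm s) x =
    (\<Sum>p | p permutes {0..<s}. signof p * heatL s q (sep_prod s (\<lambda>j. monom 1 (e (p j)))) x)"
  proof -
    have "vdm s = (\<lambda>x. \<Sum>p | p permutes {0..<s}. signof p * sep_prod s (\<lambda>j. monom 1 (e (p j))) x)"
      by (auto simp: vdm_eq_sep_prod e_def)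
    then show ?thesis
      using Dk_sum[of "{p. p permutes {0..<s}}" "\<lambda>p x. signof p * sep_prod s (\<lambda>j. monom 1 (e (p j))) x" 1]
      by (simp add: poly_fun_cmult poly_fun_sep_prod D_cmult)
  qed
  also have "\<dots> = (\<Sum>p | p permutes {0..<s}. \<Sum>i<s. c (e i) * (signof p * (\<Prod>k<s. x k ^ e' i (p k))))"
  proof (intro sum.cong refl)
    fix p assume "p \<in> {p. p permutes {0..<s}}"
    then have p: "p permutes {..<s}" by (simp add: atLeast0LessThan)
    have "heatL s q (sep_prod s (\<lambda>j. monom 1 (e (p j)))) x =
      (\<Sum>j<s. sep_prod s ((\<lambda>j. monom 1 (e (p j)))(j := opL q (monom 1 (e (p j))))) x)"
      by (simp add: heatL_sep_prod)
    also have "\<dots> = (\<Sum>j<s. c (e (p j)) * (\<Prod>k<s. x k ^ e' (p j) (p k)))"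
    proof (intro sum.cong refl)
      fix j assume "j \<in> {..<s}"
      then have j: "j < s" by simp
      have "(\<Prod>k\<in>{..<s} - {j}. x k ^ e (p k)) = (\<Prod>k\<in>{..<s} - {j}. x k ^ e' (p j) (p k))"
        using permutes_inj[OF p] by (intro prod.cong refl) (auto simp: e'_def inj_eq)
      then show "sep_prod s ((\<lambda>j. monom 1 (e (p j)))(j := opL q (monom 1 (e (p j))))) x =
        c (e (p j)) * (\<Prod>k<s. x k ^ e' (p j) (p k))"
        using j prod.remove[of "{..<s}" j "\<lambda>k. x k ^ e' (p j) (p k)"]
        by (simp add: sep_prod_upd opL_monom poly_monom c_def e'_def)
    qed
    \<comment> \<open>Summing over the rows i = p j instead of the columns j makes the altered row
      independent of the permutation, so that the signed sum over p is a determinant.\<close>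
    also have "\<dots> = (\<Sum>i<s. c (e i) * (\<Prod>k<s. x k ^ e' i (p k)))"
      by (rule sum.permute[OF p, symmetric, unfolded comp_def])
    finally show "signof p * heatL s q (sep_prod s (\<lambda>j. monom 1 (e (p j)))) x =
      (\<Sum>i<s. c (e i) * (signof p * (\<Prod>k<s. x k ^ e' i (p k))))"
      by (simp add: sum_distrib_left mult_ac)
  qed
  also have "\<dots> = (\<Sum>i<s. c (e i) * (\<Sum>p | p permutes {0..<s}. signof p * (\<Prod>k<s. x k ^ e' i (p k))))"
    by (subst sum.swap) (simp add: sum_distrib_left)
  also have "\<dots> = (\<Sum>i<s. 0)"
  proof (intro sum.cong refl)
    fix i assume "i \<in> {..<s}"
    then have i: "i < s" by simp
    show "c (e i) * (\<Sum>p | p permutes {0..<s}. signof p * (\<Prod>k<s. x k ^ e' i (p k))) = 0"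
    proof (cases "Suc i < s")
      case True
      let ?A = "mat s s (\<lambda>(k, j). x j ^ e' i k)"
      have "(\<Sum>p | p permutes {0..<s}. signof p * (\<Prod>k<s. x k ^ e' i (p k))) = det ?A"
        by (subst det_col[of _ s])
          (auto simp: permutes_in_image intro!: sum.cong prod.cong arg_cong2[where f = "(*)"])
      also have "\<dots> = 0"
      proof (rule det_identical_rows[of _ s i "Suc i"])
        have "e' i i = e' i (Suc i)" using True by (simp add: e'_def e_def)
        then show "row ?A i = row ?A (Suc i)"
          using True by (intro eq_vecI) auto
      qed (use True in auto)
      finally show ?thesis by simp
    next
      case False
      then have "e i = 0" using i by (simp add: e_def)
      then show ?thesis by (simp add: c_def)
    qed
  qed
  finally show "heatL s q (vdm s) x = 0" by simp
qed

text \<open>The operator on the power sum alone gives n (n + q) P (n - 1). The part with n^2 cancels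
  the diagonal term in the cross term with the Vandermonde product, leaving the n q of the common
  rule.\<close>

lemma power_sum_heat_L:
  "power_sum_heat {..<s} (heatL s q) (vdm s) (gammaL s) (powsum s) q"
proof -
  interpret heat_op "{..<s}" "heatL s q" by (rule heat_op_L)
  show ?thesis
  proof
    show "poly_fun {..<s} (vdm s)" by (rule poly_fun_vdm)
    show "poly_fun {..<s} (powsum s n)" for n by (rule poly_fun_powsum)
    show "heatL s q (vdm s) = (\<lambda>x. 0)" by (rule heatL_vdm)
    show "gammaL s f (\<lambda>x. c) = (\<lambda>x. 0)" for f c by (simp add: gammaL_def)
    show "gammaL s (powsum s n) (powsum s m) = (\<lambda>x. 2 * of_nat n * of_nat m * powsum s (n + m - 1) x)" for n m
    proof
      fix x
      have "gammaL s (powsum s n) (powsum s m) x = (\<Sum>j<s. 2 * of_nat n * of_nat m * x j ^ (n + m - 1))"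
        unfolding gammaL_def
        by (intro sum.cong refl; cases n; cases m) (auto simp: partial_powsum power_add)
      then show "gammaL s (powsum s n) (powsum s m) x = 2 * of_nat n * of_nat m * powsum s (n + m - 1) x"
        by (simp add: powsum_def sum_distrib_left)
    qed
    show "heatL s q (\<lambda>x. vdm s x * powsum s n x) = (\<lambda>x. vdm s x * (of_nat n *
      ((\<Sum>a<n. powsum s a x * powsum s (n - 1 - a) x) + of_nat q * powsum s (n - 1) x)))" for n
      by (simp add: heatL_mult poly_fun_vdm poly_fun_powsum heatL_vdm heatL_powsum gammaL_vdm_powsum
          fun_eq_iff algebra_simps)
    fix f g assume fg: "poly_fun {..<s} f" "poly_fun {..<s} g"
    show "heatL s q (\<lambda>x. vdm s x * (f x * g x)) =
      (\<lambda>x. heatL s q (\<lambda>x. vdm s x * f x) x * g x + f x * heatL s q (\<lambda>x. vdm s x * g x) x +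
        vdm s x * gammaL s f g x)"
      using fg by (simp add: heatL_mult poly_fun_vdm poly_fun_mult heatL_vdm gammaL_mult fun_eq_iff algebra_simps)
    fix h assume "poly_fun {..<s} h"
    then show "gammaL s f (\<lambda>x. g x * h x) = (\<lambda>x. gammaL s f g x * h x + g x * gammaL s f h x)"
      using fg by (intro gammaL_mult)
  qed
qed

text \<open>The heat evolution of \<zeta>^n as a polynomial in time \<tau>: n! \<tau>^n times the
  Laguerre polynomial of degree n and parameter q at - \<zeta> / \<tau>, cleared of
  denominators.\<close>

definition heat_monom :: "nat \<Rightarrow> nat \<Rightarrow> complex \<Rightarrow> complex poly" where
  "heat_monom q n \<zeta> = (\<Sum>j\<le>n. monom (fact n * of_nat ((q + n) choose j) / fact (n - j) * \<zeta> ^ (n - j)) j)"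

definition heat_poly :: "nat \<Rightarrow> complex poly \<Rightarrow> complex \<Rightarrow> complex poly" where
  "heat_poly q p \<zeta> = (\<Sum>m\<le>degree p. Polynomial.smult (coeff p m) (heat_monom q m \<zeta>))"

text \<open>The heat equation on monomials, since \<open>opL\<close> maps \<zeta>^n to n (n + q)
  \<zeta>^(n - 1). The coefficients match by absorption, (j + 1) C(q + n, j + 1) = (q + n) C(q + n -
  1, j).\<close>

lemma pderiv_heat_monom: "pderiv (heat_monom q n \<zeta>) = Polynomial.smult (of_nat n * of_nat (n + q)) (heat_monom q (n - 1) \<zeta>)"
proof (cases n)
  case 0
  then show ?thesis by (simp add: heat_monom_def pderiv_monom)
next
  case (Suc m)
  have "pderiv (heat_monom q n \<zeta>) =
    (\<Sum>j\<le>m. monom (of_nat (Suc j) * (fact n * of_nat ((q + n) choose Suc j) / fact (m - j) * \<zeta> ^ (m - j))) j)"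
    unfolding heat_monom_def Suc sum.atMost_Suc_shift
    by (simp add: pderiv_add pderiv_sum pderiv_monom del: of_nat_Suc fact_Suc binomial_Suc_Suc)
  also have "\<dots> = (\<Sum>j\<le>m. Polynomial.smult (of_nat n * of_nat (n + q))
      (monom (fact m * of_nat ((q + m) choose j) / fact (m - j) * \<zeta> ^ (m - j)) j))"
  proof (intro sum.cong refl)
    fix j
    have "Suc j * ((q + n) choose Suc j) = (q + n) * ((q + m) choose j)"
      using Suc_times_binomial[of j "q + m"] by (simp add: Suc)
    then have "(of_nat (Suc j) * of_nat ((q + n) choose Suc j) :: complex) = of_nat (q + n) * of_nat ((q + m) choose j)"
      by (metis of_nat_mult)
    moreover have "(fact n :: complex) = of_nat n * fact m"
      by (simp add: Suc)
    moreover have "a * (F * b / g * z) = a * b * F / g * z" for a F b g z :: complex by simp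
    ultimately have "of_nat (Suc j) * (fact n * of_nat ((q + n) choose Suc j) / fact (m - j) * \<zeta> ^ (m - j)) =
      of_nat (q + n) * of_nat ((q + m) choose j) * (of_nat n * fact m) / fact (m - j) * \<zeta> ^ (m - j)"
      by (simp only:)
    also have "\<dots> = of_nat n * of_nat (n + q) * (fact m * of_nat ((q + m) choose j) / fact (m - j) * \<zeta> ^ (m - j))"
      by (simp add: ac_simps del: of_nat_add)
    finally show "monom (of_nat (Suc j) * (fact n * of_nat ((q + n) choose Suc j) / fact (m - j) * \<zeta> ^ (m - j))) j =
      Polynomial.smult (of_nat n * of_nat (n + q))
        (monom (fact m * of_nat ((q + m) choose j) / fact (m - j) * \<zeta> ^ (m - j)) j)"
      by (simp only: smult_monom)
  qed
  finally show ?thesis by (simp add: heat_monom_def Suc smult_sum2)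
qed

lemma poly_heat_monom_0: "poly (heat_monom q n \<zeta>) 0 = \<zeta> ^ n"
proof -
  have "poly (heat_monom q n \<zeta>) 0 = (\<Sum>j\<le>n. if j = 0 then \<zeta> ^ n else 0)"
    unfolding heat_monom_def poly_sum by (intro sum.cong) (auto simp: poly_monom power_0_left)
  then show ?thesis by simp
qed

lemma degree_heat_monom: "degree (heat_monom q n \<zeta>) \<le> n"
  unfolding heat_monom_def by (intro degree_sum_le) (auto intro: order_trans[OF degree_monom_le])

lemma heat_poly_eq:
  assumes "degree p \<le> n"
  shows "heat_poly q p \<zeta> = (\<Sum>m\<le>n. Polynomial.smult (coeff p m) (heat_monom q m \<zeta>))"
  unfolding heat_poly_def using assms
  by (intro sum.mono_neutral_left) (auto simp: coeff_eq_0)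

lemma degree_heat_poly: "degree (heat_poly q p \<zeta>) \<le> degree p"
  unfolding heat_poly_def
  by (intro degree_sum_le) (auto intro: order_trans[OF degree_smult_le] order_trans[OF degree_heat_monom])

lemma poly_heat_poly_0: "poly (heat_poly q p \<zeta>) 0 = poly p \<zeta>"
  unfolding heat_poly_def poly_sum poly_smult poly_heat_monom_0 poly_altdef[of p] ..

lemma coeff_opL: "coeff (opL q p) m = of_nat (Suc m) * of_nat (Suc m + q) * coeff p (Suc m)"
  by (cases m) (simp_all add: opL_def coeff_pderiv algebra_simps)

lemma pderiv_heat_poly: "pderiv (heat_poly q p \<zeta>) = heat_poly q (opL q p) \<zeta>"
proof -
  define n where "n = Suc (degree p)"
  have d: "degree (opL q p) \<le> n"
    by (rule degree_le) (auto simp: coeff_opL n_def coeff_eq_0)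
  have "pderiv (heat_poly q p \<zeta>) = (\<Sum>m\<le>Suc n. Polynomial.smult (coeff p m * (of_nat m * of_nat (m + q))) (heat_monom q (m - 1) \<zeta>))"
  proof -
    have "degree p \<le> Suc n" by (simp add: n_def)
    from heat_poly_eq[OF this] show ?thesis by (simp only: pderiv_sum pderiv_smult pderiv_heat_monom smult_smult)
  qed
  also have "\<dots> = (\<Sum>m\<le>n. Polynomial.smult (coeff (opL q p) m) (heat_monom q m \<zeta>))"
    by (subst sum.atMost_Suc_shift) (simp add: coeff_opL algebra_simps)
  also have "\<dots> = heat_poly q (opL q p) \<zeta>" by (rule heat_poly_eq[OF d, symmetric])
  finally show ?thesis .
qed

text \<open>The operator is a sum of one-variable operators, so a product of one-variable solutions
  solves the heat equation.\<close>

lemma heat_exp_sep_prod: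
  assumes "(\<Sum>j<s. degree (\<phi> j)) \<le> N"
  shows "heat_exp (heatL s q) N \<tau> (sep_prod s \<phi>) x = (\<Prod>j<s. poly (heat_poly q (\<phi> j) (x j)) \<tau>)"
proof -
  interpret heat_op "{..<s}" "heatL s q" by (rule heat_op_L)
  define G where "G \<phi> = (\<Prod>j<s. heat_poly q (\<phi> j) (x j))" for \<phi>
  have "heat_exp (heatL s q) N \<tau> (sep_prod s \<phi>) x = poly (G \<phi>) \<tau>"
  proof (rule heat_exp_basis[where b = "sep_prod s" and G = G and K = "{..<s}" and c = "\<lambda>_ _. 1" and r = "\<lambda>j \<phi>. \<phi>(j := opL q (\<phi> j))"])
    show "poly_fun {..<s} (sep_prod s n)" for n by (rule poly_fun_sep_prod)
    show "heatL s q (sep_prod s n) = (\<lambda>x. \<Sum>k<s. 1 * sep_prod s (n(k := opL q (n k))) x)" for n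
      by (simp add: heatL_sep_prod)
    show "pderiv (G n) = (\<Sum>k<s. Polynomial.smult 1 (G (n(k := opL q (n k)))))" for n
    proof -
      have "pderiv (G n) = (\<Sum>k<s. (\<Prod>j\<in>{..<s} - {k}. heat_poly q (n j) (x j)) * heat_poly q (opL q (n k)) (x k))"
        by (simp add: G_def pderiv_prod pderiv_heat_poly)
      also have "\<dots> = (\<Sum>k<s. G (n(k := opL q (n k))))"
      proof (intro sum.cong refl)
        fix k assume k: "k \<in> {..<s}"
        have "(\<Prod>j\<in>{..<s} - {k}. heat_poly q ((n(k := opL q (n k))) j) (x j)) = (\<Prod>j\<in>{..<s} - {k}. heat_poly q (n j) (x j))"
          by (rule prod.cong) auto
        then show "(\<Prod>j\<in>{..<s} - {k}. heat_poly q (n j) (x j)) * heat_poly q (opL q (n k)) (x k) = G (n(k := opL q (n k)))"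
          unfolding G_def using prod.remove[OF finite_lessThan k, of "\<lambda>j. heat_poly q ((n(k := opL q (n k))) j) (x j)"]
          by simp
      qed
      finally show ?thesis by simp
    qed
    show "poly (G n) 0 = sep_prod s n x" for n
      by (simp add: G_def poly_prod poly_heat_poly_0 sep_prod_def)
    have "degree (G \<phi>) \<le> (\<Sum>j<s. degree (heat_poly q (\<phi> j) (x j)))"
      unfolding G_def by (rule degree_prod_sum_le[unfolded comp_def]) simp
    also have "\<dots> \<le> (\<Sum>j<s. degree (\<phi> j))" by (intro sum_mono degree_heat_poly)
    finally show "degree (G \<phi>) \<le> N" using assms by linarith
  qed
  then show ?thesis by (simp add: G_def poly_prod)
qed

text \<open>The factor V makes the problem separable: V times the product of the values of
  \<open>p\<close> is a signed sum of separated products, each evolves factor by factor, and the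
  signed sum closes up to a determinant again. Every factor has degree at most s + degree p, whence
  the bound on \<open>N\<close>.\<close>

lemma heat_exp_words_det:
  assumes cs: "\<And>x. eval_words (\<lambda>n. powsum s n x) cs = (\<Prod>j<s. poly p (x j))"
    and N: "s * (s + degree p) \<le> N"
  shows "vdm s x * heat_exp_words q N \<tau> cs (\<lambda>n. powsum s n x) =
    det (mat s s (\<lambda>(i, j). poly (heat_poly q (monom 1 (s - 1 - i) * p) (x j)) \<tau>))"
proof -
  interpret power_sum_heat "{..<s}" "heatL s q" "vdm s" "gammaL s" "powsum s" q
    by (rule power_sum_heat_L)
  let ?\<phi> = "\<lambda>(\<pi> :: nat \<Rightarrow> nat) (j :: nat). monom 1 (s - 1 - \<pi> j) * p"
  have "(\<lambda>x. vdm s x * eval_words (\<lambda>n. powsum s n x) cs) =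
    (\<lambda>x. \<Sum>\<pi> | \<pi> permutes {0..<s}. signof \<pi> * sep_prod s (?\<phi> \<pi>) x)"
    unfolding cs vdm_eq_sep_prod
    by (auto simp: fun_eq_iff sum_distrib_right mult.assoc sep_prod_def prod.distrib)
  then have "vdm s x * heat_exp_words q N \<tau> cs (\<lambda>n. powsum s n x) =
    heat_exp (heatL s q) N \<tau> (\<lambda>x. \<Sum>\<pi> | \<pi> permutes {0..<s}. signof \<pi> * sep_prod s (?\<phi> \<pi>) x) x"
    using heat_exp_eval_words[of N \<tau> cs x] by simp
  also have "\<dots> = (\<Sum>\<pi> | \<pi> permutes {0..<s}. signof \<pi> * heat_exp (heatL s q) N \<tau> (sep_prod s (?\<phi> \<pi>)) x)"
    by (subst heat_exp_sum) (auto intro: poly_fun_cmult poly_fun_sep_prod simp: heat_exp_cmult poly_fun_sep_prod)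
  also have "\<dots> = (\<Sum>\<pi> | \<pi> permutes {0..<s}. signof \<pi> *
     (\<Prod>j<s. poly (heat_poly q (monom 1 (s - 1 - \<pi> j) * p) (x j)) \<tau>))"
  proof (intro sum.cong refl)
    fix \<pi>
    have *: "degree (monom 1 k * p) \<le> k + degree p" for k
      by (rule order_trans[OF degree_mult_le]) (simp add: degree_monom_eq)
    have "degree (?\<phi> \<pi> j) \<le> s + degree p" for j
      by (rule order_trans[OF *]) simp
    then have "(\<Sum>j<s. degree (?\<phi> \<pi> j)) \<le> (\<Sum>j<s. s + degree p)" by (intro sum_mono)
    then have "(\<Sum>j<s. degree (?\<phi> \<pi> j)) \<le> N" using N by simp
    from heat_exp_sep_prod[OF this, of q \<tau> x]
    show "signof \<pi> * heat_exp (heatL s q) N \<tau> (sep_prod s (?\<phi> \<pi>)) x =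
      signof \<pi> * (\<Prod>j<s. poly (heat_poly q (?\<phi> \<pi> j) (x j)) \<tau>)" by simp
  qed
  also have "\<dots> = det (mat s s (\<lambda>(i, j). poly (heat_poly q (monom 1 (s - 1 - i) * p) (x j)) \<tau>))"
    by (subst det_col[of _ s])
      (auto simp: permutes_in_image intro!: sum.cong prod.cong arg_cong2[where f = "(*)"])
  finally show ?thesis .
qed

section \<open>Symmetric products as combinations of power sums\<close>

definition psum_expr :: "nat \<Rightarrow> ((nat \<Rightarrow> complex) \<Rightarrow> complex) \<Rightarrow> bool" where
  "psum_expr s f \<longleftrightarrow> (\<exists>cs. \<forall>x. eval_words (\<lambda>n. powsum s n x) cs = f x)"

lemma psum_expr_const: "psum_expr s (\<lambda>x. c)"
  unfolding psum_expr_def by (rule exI[of _ "[(c, [])]"]) simp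

lemma psum_expr_powsum: "psum_expr s (powsum s n)"
  unfolding psum_expr_def by (rule exI[of _ "[(1, [n])]"]) simp

lemma psum_expr_add: "psum_expr s f \<Longrightarrow> psum_expr s g \<Longrightarrow> psum_expr s (\<lambda>x. f x + g x)"
  unfolding psum_expr_def by (metis eval_words_simps(3))

lemma eval_words_mult: "\<exists>es. \<forall>p. eval_words p es = eval_words p cs * eval_words p ds"
proof (induction cs)
  case Nil
  show ?case by (rule exI[of _ "[]"]) simp
next
  case (Cons cw cs)
  then obtain es where es: "\<And>p. eval_words p es = eval_words p cs * eval_words p ds" by blast
  have "eval_words p (map (\<lambda>(d, u). (fst cw * d, snd cw @ u)) ds) = fst cw * (\<Prod>n\<leftarrow>snd cw. p n) * eval_words p ds" for p
    by (induction ds) (auto simp: algebra_simps)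
  then show ?case
    by (intro exI[of _ "map (\<lambda>(d, u). (fst cw * d, snd cw @ u)) ds @ es"]) (simp add: es algebra_simps)
qed

lemma psum_expr_mult: "psum_expr s f \<Longrightarrow> psum_expr s g \<Longrightarrow> psum_expr s (\<lambda>x. f x * g x)"
  unfolding psum_expr_def using eval_words_mult by metis

lemma psum_expr_sum: "(\<And>i. i \<in> I \<Longrightarrow> psum_expr s (f i)) \<Longrightarrow> psum_expr s (\<lambda>x. \<Sum>i\<in>I. f i x)"
  by (induction I rule: infinite_finite_induct) (auto intro: psum_expr_add psum_expr_const)

lemma psum_expr_poly: "psum_expr s (\<lambda>x. \<Sum>j<s. poly f (x j))"
proof -
  have "(\<lambda>x. \<Sum>j<s. poly f (x j)) = (\<lambda>x. \<Sum>m\<le>degree f. coeff f m * powsum s m x)"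
    unfolding poly_altdef powsum_def sum_distrib_left by (rule ext) (rule sum.swap)
  then show ?thesis
    by (simp only:) (intro psum_expr_sum psum_expr_mult psum_expr_const psum_expr_powsum)
qed

definition inj_lists :: "nat \<Rightarrow> nat \<Rightarrow> nat list set" where
  "inj_lists s m = {js. length js = m \<and> distinct js \<and> set js \<subseteq> {..<s}}"

lemma finite_inj_lists: "finite (inj_lists s m)"
  unfolding inj_lists_def by (rule finite_subset[OF _ finite_lists_length_eq[of "{..<s}" m]]) auto

lemma inj_lists_Suc:
  "inj_lists s (Suc m) = (\<lambda>(js, i). i # js) ` (SIGMA js:inj_lists s m. {..<s} - set js)"
proof (intro equalityI subsetI)
  fix js assume "js \<in> inj_lists s (Suc m)"
  then obtain i ks where "js = i # ks" "ks \<in> inj_lists s m" "i \<in> {..<s} - set ks"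
    by (cases js) (auto simp: inj_lists_def)
  then show "js \<in> (\<lambda>(js, i). i # js) ` (SIGMA js:inj_lists s m. {..<s} - set js)"
    by (intro image_eqI[of _ _ "(ks, i)"]) auto
qed (auto simp: inj_lists_def)

text \<open>Letting the index of the head factor range freely gives a plain sum over all
  coordinates. The excess terms are those where it equals the l-th later index; there the two
  polynomials merge into \<open>f * gs ! l\<close>. All remaining lists are shorter by one, so
  induction on the length applies.\<close>

lemma psum_expr_inj:
  "psum_expr s (\<lambda>x. \<Sum>js\<in>inj_lists s (length fs). \<Prod>k<length fs. poly (fs ! k) (x (js ! k)))"
proof (induction "length fs" arbitrary: fs)
  case 0
  then show ?case by (simp add: psum_expr_const)
next
  case (Suc m)
  obtain f gs where fs: "fs = f # gs" and m: "m = length gs"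
    using Suc.hyps(2) by (cases fs) auto
  let ?t = "\<lambda>gs js x. \<Prod>k<m. poly (gs ! k) (x (js ! k))"
  have "(\<Sum>js\<in>inj_lists s (Suc m). \<Prod>k<Suc m. poly (fs ! k) (x (js ! k))) =
    (\<Sum>j<s. poly f (x j)) * (\<Sum>js\<in>inj_lists s m. ?t gs js x) +
    (-1) * (\<Sum>l<m. \<Sum>js\<in>inj_lists s m. ?t (gs[l := f * gs ! l]) js x)" for x
  proof -
    have "(\<Sum>js\<in>inj_lists s (Suc m). \<Prod>k<Suc m. poly (fs ! k) (x (js ! k))) =
      (\<Sum>(js, i)\<in>(SIGMA js:inj_lists s m. {..<s} - set js). poly f (x i) * ?t gs js x)"
    proof -
      have "inj_on (\<lambda>(js, i). i # js) (SIGMA js:inj_lists s m. {..<s} - set js)"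
        by (auto simp: inj_on_def)
      moreover have "(\<Prod>k<Suc m. poly (fs ! k) (x ((i # js) ! k))) = poly f (x i) * ?t gs js x" for i js
        unfolding prod.lessThan_Suc_shift by (simp add: fs)
      ultimately show ?thesis
        unfolding inj_lists_Suc by (simp only: sum.reindex comp_def case_prod_unfold)
    qed
    also have "\<dots> = (\<Sum>js\<in>inj_lists s m. \<Sum>i\<in>{..<s} - set js. poly f (x i) * ?t gs js x)"
      by (rule sum.Sigma[symmetric]) (auto simp: finite_inj_lists)
    also have "\<dots> = (\<Sum>js\<in>inj_lists s m. (\<Sum>i<s. poly f (x i)) * ?t gs js x - (\<Sum>l<m. ?t (gs[l := f * gs ! l]) js x))"
    proof (intro sum.cong refl)
      fix js assume js: "js \<in> inj_lists s m"
      have "(\<Sum>l<m. ?t (gs[l := f * gs ! l]) js x) = (\<Sum>l<m. poly f (x (js ! l)) * ?t gs js x)"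
      proof (intro sum.cong refl)
        fix l assume l: "l \<in> {..<m}"
        have "(\<Prod>k\<in>{..<m} - {l}. poly (gs[l := f * gs ! l] ! k) (x (js ! k))) = (\<Prod>k\<in>{..<m} - {l}. poly (gs ! k) (x (js ! k)))"
          by (rule prod.cong) auto
        then show "?t (gs[l := f * gs ! l]) js x = poly f (x (js ! l)) * ?t gs js x"
          using l prod.remove[OF finite_lessThan l, of "\<lambda>k. poly (gs[l := f * gs ! l] ! k) (x (js ! k))"]
            prod.remove[OF finite_lessThan l, of "\<lambda>k. poly (gs ! k) (x (js ! k))"]
          by (simp add: m)
      qed
      also have "\<dots> = (\<Sum>i\<in>set js. poly f (x i)) * ?t gs js x"
      proof -
        have "(\<Sum>i\<in>set js. poly f (x i)) = (\<Sum>l<m. poly f (x (js ! l)))"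
          using js by (auto simp: inj_lists_def sum_list_distinct_conv_sum_set[symmetric]
              sum_list_sum_nth atLeast0LessThan)
        then show ?thesis by (simp add: sum_distrib_right)
      qed
      finally have 1: "(\<Sum>l<m. ?t (gs[l := f * gs ! l]) js x) = \<dots>" .
      have "(\<Sum>i\<in>{..<s} - set js. poly f (x i)) = (\<Sum>i<s. poly f (x i)) - (\<Sum>i\<in>set js. poly f (x i))"
        using js by (intro sum_diff) (auto simp: inj_lists_def)
      then show "(\<Sum>i\<in>{..<s} - set js. poly f (x i) * ?t gs js x) =
        (\<Sum>i<s. poly f (x i)) * ?t gs js x - (\<Sum>l<m. ?t (gs[l := f * gs ! l]) js x)"
        unfolding 1 by (simp add: sum_distrib_right[symmetric] left_diff_distrib)
    qed
    also have "\<dots> = (\<Sum>j<s. poly f (x j)) * (\<Sum>js\<in>inj_lists s m. ?t gs js x) +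
      (-1) * (\<Sum>l<m. \<Sum>js\<in>inj_lists s m. ?t (gs[l := f * gs ! l]) js x)"
      unfolding sum_subtractf sum_distrib_left[symmetric] by (subst sum.swap) simp
    finally show ?thesis .
  qed
  then have e: "(\<lambda>x. \<Sum>js\<in>inj_lists s (length fs). \<Prod>k<length fs. poly (fs ! k) (x (js ! k))) =
    (\<lambda>x. (\<Sum>j<s. poly f (x j)) * (\<Sum>js\<in>inj_lists s m. ?t gs js x) +
    (-1) * (\<Sum>l<m. \<Sum>js\<in>inj_lists s m. ?t (gs[l := f * gs ! l]) js x))"
    by (simp add: Suc.hyps(2)[symmetric])
  have IH: "psum_expr s (\<lambda>x. \<Sum>js\<in>inj_lists s m. ?t hs js x)" if "length hs = m" for hs
    using Suc.hyps(1)[of hs] that by simp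
  show ?case
    unfolding e
    by (intro psum_expr_add psum_expr_mult psum_expr_poly psum_expr_const psum_expr_sum IH) (simp_all add: m)
qed

lemma prod_inj_lists:
  fixes g :: "nat \<Rightarrow> 'a :: comm_monoid_mult"
  assumes "js \<in> inj_lists s s"
  shows "(\<Prod>k<s. g (js ! k)) = (\<Prod>j<s. g j)"
proof -
  from assms have js: "length js = s" "distinct js" "set js \<subseteq> {..<s}"
    by (simp_all add: inj_lists_def)
  have "set js = {..<s}"
    using card_subset_eq[OF finite_lessThan js(3)] distinct_card[OF js(2)] js(1) by simp
  then have "bij_betw ((!) js) {..<s} {..<s}"
    by (intro bij_betw_nth js) (simp_all only: js)
  from prod.reindex_bij_betw[OF this, of g] show ?thesis .
qed

text \<open>With \<open>s\<close> equal factors, every injective list of length \<open>s\<close> is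
  a rearrangement of all indices and contributes the same product. Their number is nonzero because
  \<open>[0..<s]\<close> is one of them, so it can be divided out.\<close>

lemma psum_expr_prod: "psum_expr s (\<lambda>x. \<Prod>j<s. poly f (x j))"
proof -
  define c :: complex where "c = of_nat (card (inj_lists s s))"
  define F where "F x = (\<Prod>j<s. poly f (x j))" for x
  define G where "G x = (\<Sum>js\<in>inj_lists s (length (replicate s f)).
    \<Prod>k<length (replicate s f). poly (replicate s f ! k) (x (js ! k)))" for x
  have "[0..<s] \<in> inj_lists s s" by (auto simp: inj_lists_def)
  then have c: "c \<noteq> 0"
    using finite_inj_lists[of s s] by (auto simp: c_def card_eq_0_iff)
  have G: "G x = c * F x" for x
  proof -
    have "G x = (\<Sum>js\<in>inj_lists s s. F x)"
      unfolding G_def F_def length_replicate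
    proof (intro sum.cong refl)
      fix js assume js: "js \<in> inj_lists s s"
      have "(\<Prod>k<s. poly (replicate s f ! k) (x (js ! k))) = (\<Prod>k<s. poly f (x (js ! k)))"
        by (intro prod.cong) simp_all
      also have "\<dots> = (\<Prod>j<s. poly f (x j))"
        by (rule prod_inj_lists[OF js, of "\<lambda>j. poly f (x j)"])
      finally show "(\<Prod>k<s. poly (replicate s f ! k) (x (js ! k))) = (\<Prod>j<s. poly f (x j))" .
    qed
    then show ?thesis by (simp add: c_def)
  qed
  have F: "F = (\<lambda>x. (1 / c) * G x)"
    using c by (intro ext) (simp add: G)
  have "psum_expr s G"
    unfolding G_def[abs_def] using psum_expr_inj[of s "replicate s f"] .
  then have "psum_expr s F"
    unfolding F by (intro psum_expr_mult psum_expr_const)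
  then show ?thesis unfolding F_def[abs_def] .
qed

section \<open>Moments of complex Gaussians\<close>

lemma normal_central_moment:
  assumes "0 < \<sigma>"
  shows "integrable lborel (\<lambda>x. normal_density m \<sigma> x * (x - m) ^ k)"
    and "(\<integral>x. normal_density m \<sigma> x * (x - m) ^ Suc k \<partial>lborel) =
      \<sigma>\<^sup>2 * k * (\<integral>x. normal_density m \<sigma> x * (x - m) ^ (k - 1) \<partial>lborel)"
proof -
  show "integrable lborel (\<lambda>x. normal_density m \<sigma> x * (x - m) ^ k)"
    by (rule integrable_normal_moment[OF assms])
  show "(\<integral>x. normal_density m \<sigma> x * (x - m) ^ Suc k \<partial>lborel) =
      \<sigma>\<^sup>2 * k * (\<integral>x. normal_density m \<sigma> x * (x - m) ^ (k - 1) \<partial>lborel)"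
  proof (cases "even k")
    case True
    then obtain j where j: "k = 2 * j" by (elim evenE)
    have "(\<integral>x. normal_density m \<sigma> x * (x - m) ^ Suc k \<partial>lborel) = 0"
      using integral_normal_moment_odd[OF assms, of m j] by (simp add: j)
    moreover have "(\<integral>x. normal_density m \<sigma> x * (x - m) ^ (k - 1) \<partial>lborel) = 0" if "k \<noteq> 0"
    proof -
      have "k - 1 = 2 * (j - 1) + 1" using that j by simp
      then show ?thesis using integral_normal_moment_odd[OF assms, of m "j - 1"] by simp
    qed
    ultimately show ?thesis by (cases "k = 0") auto
  next
    case False
    then obtain j where j: "k = 2 * j + 1" by (elim oddE)
    have "Suc k = 2 * Suc j" "k - 1 = 2 * j" using j by auto
    moreover have "fact (2 * Suc j) / ((2 / \<sigma>\<^sup>2) ^ Suc j * fact (Suc j)) =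
      \<sigma>\<^sup>2 * real k * (fact (2 * j) / ((2 / \<sigma>\<^sup>2) ^ j * fact j))"
      using assms by (simp add: j divide_simps)
    ultimately show ?thesis
      by (simp only: integral_normal_moment_even[OF assms])
  qed
qed

text \<open>Stein's identity. Expanding \<open>p\<close> around the mean reduces it to the recursion
  of the central moments, which avoids boundary terms.\<close>

lemma normal_poly_stein:
  assumes "0 < \<sigma>"
  shows "integrable lborel (\<lambda>x. normal_density m \<sigma> x * poly p x)"
    and "(\<integral>x. normal_density m \<sigma> x * ((x - m) * poly p x) \<partial>lborel) =
      \<sigma>\<^sup>2 * (\<integral>x. normal_density m \<sigma> x * poly (pderiv p) x \<partial>lborel)"
proof -
  define q where "q = pcompose p [:m, 1:]"
  have q: "poly p x = (\<Sum>k\<le>degree q. coeff q k * (x - m) ^ k)" for x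
    using poly_altdef[of q "x - m"] by (simp add: q_def poly_pcompose)
  have "pderiv q = pcompose (pderiv p) [:m, 1:]"
    by (simp add: q_def pderiv_pcompose pderiv_pCons)
  then have "poly (pderiv p) x = poly (pderiv q) (x - m)" for x
    by (simp add: poly_pcompose)
  moreover have "pderiv q = (\<Sum>k\<le>degree q. monom (real k * coeff q k) (k - 1))"
    by (subst (1) poly_as_sum_of_monoms[of q, symmetric]) (simp add: pderiv_sum pderiv_monom)
  ultimately have q': "poly (pderiv p) x = (\<Sum>k\<le>degree q. real k * coeff q k * (x - m) ^ (k - 1))" for x
    by (simp add: poly_sum poly_monom)
  note int = normal_central_moment(1)[OF assms, of m]
  have *: "normal_density m \<sigma> x * (\<Sum>k\<le>degree q. c k * (x - m) ^ e k) =
      (\<Sum>k\<le>degree q. c k * (normal_density m \<sigma> x * (x - m) ^ e k))" for x c and e :: "nat \<Rightarrow> nat"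
    by (simp add: sum_distrib_left mult_ac)
  show "integrable lborel (\<lambda>x. normal_density m \<sigma> x * poly p x)"
    unfolding q * by (intro Bochner_Integration.integrable_sum integrable_mult_right int)
  have "(\<integral>x. normal_density m \<sigma> x * ((x - m) * poly p x) \<partial>lborel) =
    (\<integral>x. (\<Sum>k\<le>degree q. coeff q k * (normal_density m \<sigma> x * (x - m) ^ Suc k)) \<partial>lborel)"
    unfolding q by (intro Bochner_Integration.integral_cong refl) (simp add: sum_distrib_left mult_ac)
  also have "\<dots> = (\<Sum>k\<le>degree q. coeff q k * (\<integral>x. normal_density m \<sigma> x * (x - m) ^ Suc k \<partial>lborel))"
    by (subst Bochner_Integration.integral_sum) (intro integrable_mult_right int, simp)
  also have "\<dots> = \<sigma>\<^sup>2 * (\<Sum>k\<le>degree q. real k * coeff q k * (\<integral>x. normal_density m \<sigma> x * (x - m) ^ (k - 1) \<partial>lborel))"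
    unfolding normal_central_moment(2)[OF assms] by (simp add: sum_distrib_left mult_ac)
  also have "\<dots> = \<sigma>\<^sup>2 * (\<integral>x. normal_density m \<sigma> x * poly (pderiv p) x \<partial>lborel)"
    unfolding q' * using int by (subst Bochner_Integration.integral_sum) auto
  finally show "(\<integral>x. normal_density m \<sigma> x * ((x - m) * poly p x) \<partial>lborel) = \<dots>" .
qed

definition normal_moment :: "real \<Rightarrow> real \<Rightarrow> nat \<Rightarrow> real" where
  "normal_moment m \<sigma> k = (\<integral>x. normal_density m \<sigma> x * x ^ k \<partial>lborel)"

lemma normal_moment_Suc:
  assumes "0 < \<sigma>"
  shows "normal_moment m \<sigma> (Suc k) = m * normal_moment m \<sigma> k + \<sigma>\<^sup>2 * k * normal_moment m \<sigma> (k - 1)"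
    and "integrable lborel (\<lambda>x. normal_density m \<sigma> x * x ^ k)"
proof -
  have int: "integrable lborel (\<lambda>x. normal_density m \<sigma> x * x ^ k)" for k
    using normal_poly_stein(1)[OF assms, of m "monom 1 k"] by (simp add: poly_monom)
  then show "integrable lborel (\<lambda>x. normal_density m \<sigma> x * x ^ k)" .
  have "(\<integral>x. normal_density m \<sigma> x * ((x - m) * x ^ k) \<partial>lborel) =
    \<sigma>\<^sup>2 * (k * normal_moment m \<sigma> (k - 1))"
    using normal_poly_stein(2)[OF assms, of m "monom 1 k"] int
    by (simp add: poly_monom pderiv_monom normal_moment_def mult.left_commute[of _ "real k"])
  moreover have "normal_density m \<sigma> x * x ^ Suc k =
      normal_density m \<sigma> x * ((x - m) * x ^ k) + m * (normal_density m \<sigma> x * x ^ k)" for x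
    by (simp add: algebra_simps)
  moreover have "integrable lborel (\<lambda>x. normal_density m \<sigma> x * ((x - m) * x ^ k))"
  proof -
    have "poly ([:- m, 1:] * monom 1 k) x = (x - m) * x ^ k" for x
      by (simp add: poly_monom algebra_simps)
    then show ?thesis using normal_poly_stein(1)[OF assms, of m "[:- m, 1:] * monom 1 k"] by (simp only:)
  qed
  ultimately show "normal_moment m \<sigma> (Suc k) = m * normal_moment m \<sigma> k + \<sigma>\<^sup>2 * k * normal_moment m \<sigma> (k - 1)"
    using int[of k] by (simp add: normal_moment_def)
qed

text \<open>The two real coordinates are integrated over a product measure indexed by
  \<open>Basis\<close>, but handed to \<open>f\<close> as complex numbers, so that
  \<open>poly_fun\<close> and \<open>partial\<close> apply unchanged. \<open>\<sigma>\<close> is the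
  deviation of each real coordinate.\<close>

definition gaussE :: "complex \<Rightarrow> real \<Rightarrow> ((complex \<Rightarrow> complex) \<Rightarrow> complex) \<Rightarrow> complex" where
  "gaussE m \<sigma> f = (\<integral>\<omega>. f (\<lambda>b. of_real (\<omega> b)) * of_real (\<Prod>b\<in>Basis. normal_density (m \<bullet> b) \<sigma> (\<omega> b))
     \<partial>(\<Pi>\<^sub>M b\<in>(Basis :: complex set). lborel))"

definition gauss_integrable where
  "gauss_integrable m \<sigma> f = integrable (\<Pi>\<^sub>M b\<in>(Basis :: complex set). lborel)
     (\<lambda>\<omega>. f (\<lambda>b. of_real (\<omega> b)) * (of_real (\<Prod>b\<in>Basis. normal_density (m \<bullet> b) \<sigma> (\<omega> b)) :: complex))"

lemma gauss_pmonom: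
  assumes "0 < \<sigma>"
  shows "gauss_integrable m \<sigma> (\<lambda>x. c * pmonom Basis n x)"
    and "gaussE m \<sigma> (\<lambda>x. c * pmonom Basis n x) = c * of_real (\<Prod>b\<in>Basis. normal_moment (m \<bullet> b) \<sigma> (n b))"
proof -
  interpret product_sigma_finite "\<lambda>b :: complex. lborel :: real measure" ..
  have e: "(\<lambda>\<omega>. c * pmonom Basis n (\<lambda>b. of_real (\<omega> b)) *
      of_real (\<Prod>b\<in>Basis. normal_density (m \<bullet> b) \<sigma> (\<omega> b))) =
    (\<lambda>\<omega>. c * of_real (\<Prod>b\<in>Basis. normal_density (m \<bullet> b) \<sigma> (\<omega> b) * \<omega> b ^ n b))"
    by (auto simp: pmonom_def prod.distrib mult_ac)
  have i: "integrable (\<Pi>\<^sub>M b\<in>(Basis :: complex set). lborel)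
      (\<lambda>\<omega>. \<Prod>b\<in>Basis. normal_density (m \<bullet> b) \<sigma> (\<omega> b) * \<omega> b ^ n b)"
    by (rule product_integrable_prod) (auto intro: normal_moment_Suc(2)[OF assms])
  have v: "(\<integral>\<omega>. (\<Prod>b\<in>Basis. normal_density (m \<bullet> b) \<sigma> (\<omega> b) * \<omega> b ^ n b) \<partial>(\<Pi>\<^sub>M b\<in>(Basis :: complex set). lborel)) =
    (\<Prod>b\<in>Basis. normal_moment (m \<bullet> b) \<sigma> (n b))"
    unfolding normal_moment_def
    by (rule product_integral_prod) (auto intro: normal_moment_Suc(2)[OF assms])
  show "gauss_integrable m \<sigma> (\<lambda>x. c * pmonom Basis n x)"
    unfolding gauss_integrable_def e by (intro integrable_mult_right integrable_of_real i)
  show "gaussE m \<sigma> (\<lambda>x. c * pmonom Basis n x) = c * of_real (\<Prod>b\<in>Basis. normal_moment (m \<bullet> b) \<sigma> (n b))"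
    unfolding gaussE_def e by (simp only: integral_mult_right_zero integral_complex_of_real v)
qed

lemma gauss_integrable_poly_fun:
  assumes "0 < \<sigma>" "poly_fun Basis f"
  shows "gauss_integrable m \<sigma> f"
  using assms(2)
proof induction
  case (poly_fun_pmonom c n)
  show ?case by (rule gauss_pmonom(1)[OF assms(1)])
next
  case (poly_fun_add f g)
  show ?case
    using poly_fun_add(3,4) unfolding gauss_integrable_def distrib_right
    by (rule Bochner_Integration.integrable_add)
qed

lemma gaussE_add:
  assumes "0 < \<sigma>" "poly_fun Basis f" "poly_fun Basis g"
  shows "gaussE m \<sigma> (\<lambda>x. f x + g x) = gaussE m \<sigma> f + gaussE m \<sigma> g"
  using gauss_integrable_poly_fun[OF assms(1,2), of m] gauss_integrable_poly_fun[OF assms(1,3), of m]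
  unfolding gaussE_def gauss_integrable_def distrib_right by (rule Bochner_Integration.integral_add)

lemma gaussE_cmult: "gaussE m \<sigma> (\<lambda>x. c * f x) = c * gaussE m \<sigma> f"
  unfolding gaussE_def mult.assoc by (rule integral_mult_right_zero)

lemma gaussE_stein:
  assumes "0 < \<sigma>" "poly_fun Basis f" "b \<in> Basis"
  shows "gaussE m \<sigma> (\<lambda>x. x b * f x) = of_real (m \<bullet> b) * gaussE m \<sigma> f + of_real (\<sigma>\<^sup>2) * gaussE m \<sigma> (partial b f)"
  using assms(2)
proof induction
  case (poly_fun_pmonom c n)
  have 1: "(\<lambda>x. x b * (c * pmonom Basis n x)) = (\<lambda>x. c * pmonom Basis (n(b := Suc (n b))) x)"
  proof
    fix x
    show "x b * (c * pmonom Basis n x) = c * pmonom Basis (n(b := Suc (n b))) x"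
    proof -
      have "(\<Prod>u\<in>Basis - {b}. x u ^ (n(b := Suc (n b))) u) = (\<Prod>u\<in>Basis - {b}. x u ^ n u)"
        by (rule prod.cong) auto
      then show ?thesis
        using pmonom_upd[OF finite_Basis assms(3), of "n(b := Suc (n b))" x "x b"]
          pmonom_upd[OF finite_Basis assms(3), of n x "x b"] by simp
    qed
  qed
  have 2: "partial b (\<lambda>x. c * pmonom Basis n x) = (\<lambda>x. (c * of_nat (n b)) * pmonom Basis (n(b := n b - 1)) x)"
  proof -
    have "poly_fun Basis (pmonom Basis n)" using poly_fun.poly_fun_pmonom[of Basis 1 n] by simp
    from partial_cmult[OF finite_Basis this] show ?thesis
      using assms(3) by (simp add: partial_pmonom fun_eq_iff)
  qed
  have 3: "(\<Prod>u\<in>Basis. normal_moment (m \<bullet> u) \<sigma> ((n(b := k)) u)) =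
    normal_moment (m \<bullet> b) \<sigma> k * (\<Prod>u\<in>Basis - {b}. normal_moment (m \<bullet> u) \<sigma> (n u))" for k
  proof -
    have "(\<Prod>u\<in>Basis - {b}. normal_moment (m \<bullet> u) \<sigma> ((n(b := k)) u)) =
      (\<Prod>u\<in>Basis - {b}. normal_moment (m \<bullet> u) \<sigma> (n u))"
      by (rule prod.cong) auto
    then show ?thesis
      using prod.remove[OF finite_Basis assms(3), of "\<lambda>u. normal_moment (m \<bullet> u) \<sigma> ((n(b := k)) u)"] by simp
  qed
  have 4: "(\<Prod>u\<in>Basis. normal_moment (m \<bullet> u) \<sigma> (n u)) =
    normal_moment (m \<bullet> b) \<sigma> (n b) * (\<Prod>u\<in>Basis - {b}. normal_moment (m \<bullet> u) \<sigma> (n u))"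
    by (rule prod.remove[OF finite_Basis assms(3)])
  show ?case
    unfolding 1 2 gauss_pmonom(2)[OF assms(1)] 3 4 normal_moment_Suc(1)[OF assms(1)]
    by (simp add: algebra_simps)
next
  case (poly_fun_add f g)
  have "gaussE m \<sigma> (\<lambda>x. x b * (f x + g x)) = gaussE m \<sigma> (\<lambda>x. x b * f x) + gaussE m \<sigma> (\<lambda>x. x b * g x)"
    unfolding distrib_left using poly_fun_add assms
    by (intro gaussE_add poly_fun_mult poly_fun_var) auto
  moreover have "gaussE m \<sigma> (partial b (\<lambda>x. f x + g x)) = gaussE m \<sigma> (partial b f) + gaussE m \<sigma> (partial b g)"
    unfolding partial_add[OF finite_Basis poly_fun_add(1,2)] using poly_fun_add assms
    by (intro gaussE_add poly_fun_partial finite_Basis) auto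
  ultimately show ?case
    using poly_fun_add assms by (simp add: gaussE_add algebra_simps)
qed

section \<open>Joint moments of a complex Gaussian variable and its conjugate\<close>

definition zvar :: "(complex \<Rightarrow> complex) \<Rightarrow> complex" where "zvar x = x 1 + \<i> * x \<i>"
definition zcvar :: "(complex \<Rightarrow> complex) \<Rightarrow> complex" where "zcvar x = x 1 - \<i> * x \<i>"

lemma poly_fun_zvar: "poly_fun Basis zvar" "poly_fun Basis zcvar"
  unfolding zvar_def[abs_def] zcvar_def[abs_def]
  by (intro poly_fun_add poly_fun_diff poly_fun_mult poly_fun_const poly_fun_var finite_Basis; simp add: Basis_complex_def)+

lemma partial_pow:
  assumes "finite A" "poly_fun A f"
  shows "partial v (\<lambda>x. f x ^ n) = (\<lambda>x. of_nat n * f x ^ (n - 1) * partial v f x)"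
proof (rule ext, rule partial_eqI)
  fix x
  show "((\<lambda>z. f (x(v := z)) ^ n) has_field_derivative of_nat n * f x ^ (n - 1) * partial v f x) (at (x v))"
    using DERIV_power[OF partial_DERIV[OF assms, where x = x and v = v], of n] by (simp add: mult_ac)
qed

lemma partial_zvar:
  "partial 1 zvar = (\<lambda>x. 1)" "partial \<i> zvar = (\<lambda>x. \<i>)" "partial 1 zcvar = (\<lambda>x. 1)" "partial \<i> zcvar = (\<lambda>x. - \<i>)"
  by (rule ext, rule partial_eqI, auto simp: zvar_def zcvar_def intro!: derivative_eq_intros)+

definition gaussM :: "complex \<Rightarrow> real \<Rightarrow> nat \<Rightarrow> nat \<Rightarrow> complex" where
  "gaussM m \<sigma> a b = gaussE m \<sigma> (\<lambda>x. zvar x ^ a * zcvar x ^ b)"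

lemma poly_fun_zvar_pow: "poly_fun Basis (\<lambda>x. zvar x ^ a * zcvar x ^ b)"
  by (intro poly_fun_mult poly_fun_power poly_fun_zvar)

lemma partial_zvar_pow:
  "partial 1 (\<lambda>x. zvar x ^ a * zcvar x ^ b) =
    (\<lambda>x. of_nat a * (zvar x ^ (a - 1) * zcvar x ^ b) + of_nat b * (zvar x ^ a * zcvar x ^ (b - 1)))"
  "partial \<i> (\<lambda>x. zvar x ^ a * zcvar x ^ b) =
    (\<lambda>x. (\<i> * of_nat a) * (zvar x ^ (a - 1) * zcvar x ^ b) + (- \<i> * of_nat b) * (zvar x ^ a * zcvar x ^ (b - 1)))"
  by (simp_all add: partial_mult[OF finite_Basis] poly_fun_power poly_fun_zvar partial_pow[OF finite_Basis] partial_zvar fun_eq_iff)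

lemma gaussE_partial_zvar_pow:
  assumes "0 < \<sigma>"
  shows "gaussE m \<sigma> (partial 1 (\<lambda>x. zvar x ^ a * zcvar x ^ b)) =
      of_nat a * gaussM m \<sigma> (a - 1) b + of_nat b * gaussM m \<sigma> a (b - 1)"
    "gaussE m \<sigma> (partial \<i> (\<lambda>x. zvar x ^ a * zcvar x ^ b)) =
      (\<i> * of_nat a) * gaussM m \<sigma> (a - 1) b + (- \<i> * of_nat b) * gaussM m \<sigma> a (b - 1)"
  unfolding partial_zvar_pow gaussM_def
  by (subst gaussE_add[OF assms], (intro poly_fun_cmult poly_fun_zvar_pow)+, simp only: gaussE_cmult)+

lemma gaussE_stein_complex:
  assumes "0 < \<sigma>" "poly_fun Basis f"
  shows "gaussE m \<sigma> (\<lambda>x. (x 1 + c * x \<i>) * f x) = (of_real (m \<bullet> 1) + c * of_real (m \<bullet> \<i>)) * gaussE m \<sigma> f +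
    of_real (\<sigma>\<^sup>2) * (gaussE m \<sigma> (partial 1 f) + c * gaussE m \<sigma> (partial \<i> f))"
proof -
  have B: "1 \<in> (Basis :: complex set)" "\<i> \<in> (Basis :: complex set)" by (auto simp: Basis_complex_def)
  have "poly_fun Basis (\<lambda>x. x b * f x)" if "b \<in> Basis" for b
    by (intro poly_fun_mult poly_fun_var finite_Basis that assms(2))
  then have "gaussE m \<sigma> (\<lambda>x. x 1 * f x + c * (x \<i> * f x)) = gaussE m \<sigma> (\<lambda>x. x 1 * f x) + c * gaussE m \<sigma> (\<lambda>x. x \<i> * f x)"
    using B by (simp add: gaussE_add[OF assms(1)] poly_fun_cmult gaussE_cmult)
  then show ?thesis
    unfolding gaussE_stein[OF assms B(1)] gaussE_stein[OF assms B(2)] by (simp add: algebra_simps)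
qed

text \<open>Stein's identity in a complex direction: \<open>partial 1\<close> plus \<i> times
  \<open>partial \<i>\<close> annihilates \<open>zvar\<close> and sends \<open>zcvar\<close> to 2,
  so only the exponent of the conjugate drops, with factor 2 \<sigma>^2. Once no \<open>zvar\<close>
  is left, the conjugate direction annihilates \<open>zcvar\<close> and yields plain powers of the
  mean.\<close>

lemma gaussM_rec:
  assumes "0 < \<sigma>"
  shows "gaussM m \<sigma> (Suc a) b = m * gaussM m \<sigma> a b + of_real (2 * \<sigma>\<^sup>2) * of_nat b * gaussM m \<sigma> a (b - 1)"
    and "gaussM m \<sigma> 0 (Suc b) = cnj m * gaussM m \<sigma> 0 b"
proof -
  have m: "of_real (m \<bullet> 1) + \<i> * of_real (m \<bullet> \<i>) = m" "of_real (m \<bullet> 1) + (- \<i>) * of_real (m \<bullet> \<i>) = cnj m"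
    by (simp_all add: complex_eq_iff)
  have "gaussM m \<sigma> (Suc a) b = gaussE m \<sigma> (\<lambda>x. (x 1 + \<i> * x \<i>) * (zvar x ^ a * zcvar x ^ b))"
    by (simp add: gaussM_def zvar_def mult.assoc)
  then show "gaussM m \<sigma> (Suc a) b = m * gaussM m \<sigma> a b + of_real (2 * \<sigma>\<^sup>2) * of_nat b * gaussM m \<sigma> a (b - 1)"
    unfolding gaussE_stein_complex[OF assms poly_fun_zvar_pow] m gaussE_partial_zvar_pow[OF assms] gaussM_def[symmetric]
    by (simp add: algebra_simps)
  have "gaussM m \<sigma> 0 (Suc b) = gaussE m \<sigma> (\<lambda>x. (x 1 + (- \<i>) * x \<i>) * (zvar x ^ 0 * zcvar x ^ b))"
    by (simp add: gaussM_def zcvar_def mult.assoc)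
  then show "gaussM m \<sigma> 0 (Suc b) = cnj m * gaussM m \<sigma> 0 b"
    unfolding gaussE_stein_complex[OF assms poly_fun_zvar_pow] m gaussE_partial_zvar_pow[OF assms] gaussM_def[symmetric]
    by (simp add: algebra_simps)
qed

lemma gaussM_0: "0 < \<sigma> \<Longrightarrow> gaussM m \<sigma> 0 0 = 1"
  using gauss_pmonom(2)[of \<sigma> m 1 "\<lambda>_. 0"]
  by (simp add: gaussM_def pmonom_def normal_moment_def integral_normal_density)

text \<open>The recursion of \<open>gaussM_rec\<close> with 2 \<sigma>^2 replaced by an
  indeterminate \<tau>. The result is exp (\<tau> d/dx d/dy) applied to x^a y^b, a complex Hermite
  polynomial up to signs and scaling.\<close>

fun heat_bimonom :: "nat \<Rightarrow> nat \<Rightarrow> complex \<Rightarrow> complex \<Rightarrow> complex poly" where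
  "heat_bimonom 0 b x y = [:y ^ b:]"
| "heat_bimonom (Suc a) b x y = Polynomial.smult x (heat_bimonom a b x y) + Polynomial.smult (of_nat b) (pCons 0 (heat_bimonom a (b - 1) x y))"

lemma gaussM_heat_bimonom:
  assumes "0 < \<sigma>"
  shows "gaussM m \<sigma> a b = poly (heat_bimonom a b m (cnj m)) (of_real (2 * \<sigma>\<^sup>2))"
proof (induction a arbitrary: b)
  case 0
  show ?case by (induction b) (auto simp: gaussM_0 gaussM_rec(2) assms)
next
  case (Suc a)
  then show ?case by (simp add: gaussM_rec(1)[OF assms] algebra_simps)
qed

lemma poly_heat_bimonom_0: "poly (heat_bimonom a b x y) 0 = x ^ a * y ^ b"
  by (induction a arbitrary: b) auto

lemma degree_heat_bimonom: "degree (heat_bimonom a b x y) \<le> a"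
proof (induction a arbitrary: b)
  case (Suc a)
  show ?case
    unfolding heat_bimonom.simps
    by (intro degree_add_le order_trans[OF degree_smult_le] order_trans[OF degree_pCons_le])
      (use Suc[of b] Suc[of "b - 1"] in auto)
qed simp

lemma pderiv_heat_bimonom:
  "pderiv (heat_bimonom a b x y) = Polynomial.smult (of_nat a * of_nat b) (heat_bimonom (a - 1) (b - 1) x y)"
proof (induction a arbitrary: b)
  case (Suc a)
  have "pderiv (heat_bimonom (Suc a) b x y) = Polynomial.smult (x * (of_nat a * of_nat b)) (heat_bimonom (a - 1) (b - 1) x y) +
    Polynomial.smult (of_nat b) (heat_bimonom a (b - 1) x y + pCons 0 (Polynomial.smult (of_nat a * of_nat (b - 1)) (heat_bimonom (a - 1) (b - 1 - 1) x y)))"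
    by (simp add: Suc pderiv_add pderiv_smult pderiv_pCons smult_add_right)
  also have "\<dots> = Polynomial.smult (of_nat (Suc a) * of_nat b) (heat_bimonom a (b - 1) x y)"
  proof (cases a)
    case (Suc n)
    have "Polynomial.smult (of_nat a * of_nat b) (heat_bimonom a (b - 1) x y) =
      Polynomial.smult (x * (of_nat a * of_nat b)) (heat_bimonom (a - 1) (b - 1) x y) +
      Polynomial.smult (of_nat b) (pCons 0 (Polynomial.smult (of_nat a * of_nat (b - 1)) (heat_bimonom (a - 1) (b - 1 - 1) x y)))"
      by (simp add: Suc smult_add_right mult_ac)
    then show ?thesis by (simp add: smult_add_right smult_add_left algebra_simps)
  qed simp
  finally show ?case by simp
qed (simp add: pderiv_pCons)

lemma borel_measurable_cnj [measurable]: "cnj \<in> borel_measurable borel"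
  by (intro borel_measurable_continuous_onI continuous_intros)

text \<open>Completing the square in each real coordinate: \<theta> a^2 + (a - u)^2 = (a - \<tau>
  u)^2 / \<tau> + \<theta> \<tau> u^2. The variance of the entry shrinks from 1 to \<tau> and its
  mean from \<mu> to \<tau> \<mu>; the prefactor \<tau> is the ratio of the normalising
  constants.\<close>

lemma tilted_cn_density:
  fixes \<theta> :: real and \<mu> z :: complex
  assumes "0 \<le> \<theta>" and \<tau>: "\<tau> = 1 / (1 + \<theta>)"
  shows "exp (- \<theta> * (cmod z)\<^sup>2) * cn_density \<mu> z =
    \<tau> * exp (- \<theta> * \<tau> * (cmod \<mu>)\<^sup>2) *
      (normal_density (\<tau> * Re \<mu>) (sqrt (\<tau> / 2)) (Re z) * normal_density (\<tau> * Im \<mu>) (sqrt (\<tau> / 2)) (Im z))"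
proof -
  have \<tau>0: "\<tau> > 0" using assms by simp
  have *: "- \<theta> * a\<^sup>2 - (a - u)\<^sup>2 = - \<theta> * \<tau> * u\<^sup>2 - (a - \<tau> * u)\<^sup>2 / \<tau>" for a u
  proof -
    have "1 + \<theta> \<noteq> 0" using assms by simp
    then show ?thesis unfolding \<tau> by (simp add: divide_simps) (simp add: power2_eq_square algebra_simps)
  qed
  have "exp (- \<theta> * (cmod z)\<^sup>2) * cn_density \<mu> z =
    exp ((- \<theta> * (Re z)\<^sup>2 - (Re z - Re \<mu>)\<^sup>2) + (- \<theta> * (Im z)\<^sup>2 - (Im z - Im \<mu>)\<^sup>2)) / pi"
    unfolding cn_density_def times_divide_eq_right exp_add[symmetric]
    by (simp add: cmod_power2 algebra_simps)
  also have "\<dots> = exp (- \<theta> * \<tau> * (cmod \<mu>)\<^sup>2) * exp (- (Re z - \<tau> * Re \<mu>)\<^sup>2 / \<tau>) * exp (- (Im z - \<tau> * Im \<mu>)\<^sup>2 / \<tau>) / pi"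
    unfolding * exp_add[symmetric] by (simp add: cmod_power2 algebra_simps)
  also have "\<dots> = \<tau> * exp (- \<theta> * \<tau> * (cmod \<mu>)\<^sup>2) *
      (normal_density (\<tau> * Re \<mu>) (sqrt (\<tau> / 2)) (Re z) * normal_density (\<tau> * Im \<mu>) (sqrt (\<tau> / 2)) (Im z))"
    unfolding normal_density_def using \<tau>0 by (simp add: field_simps)
  finally show ?thesis .
qed

lemma cn_tilted_moment:
  fixes \<theta> :: real and \<mu> :: complex
  assumes "0 \<le> \<theta>" and \<tau>: "\<tau> = 1 / (1 + \<theta>)"
  shows "integrable lborel (\<lambda>z. of_real (exp (- \<theta> * (cmod z)\<^sup>2) * cn_density \<mu> z) * (z ^ a * cnj z ^ b))"
    and "(\<integral>z. of_real (exp (- \<theta> * (cmod z)\<^sup>2) * cn_density \<mu> z) * (z ^ a * cnj z ^ b) \<partial>lborel) =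
      of_real (\<tau> * exp (- \<theta> * \<tau> * (cmod \<mu>)\<^sup>2)) * poly (heat_bimonom a b (\<tau> * \<mu>) (\<tau> * cnj \<mu>)) (of_real \<tau>)"
proof -
  define C where "C = \<tau> * exp (- \<theta> * \<tau> * (cmod \<mu>)\<^sup>2)"
  \<comment> \<open>Each real coordinate carries half of the complex variance \<tau>, so the heat
    time 2 \<sigma>^2 is \<tau>.\<close>
  define \<sigma> where "\<sigma> = sqrt (\<tau> / 2)"
  have \<tau>0: "\<tau> > 0" using assms by simp
  then have \<sigma>: "0 < \<sigma>" "2 * \<sigma>\<^sup>2 = \<tau>" by (auto simp: \<sigma>_def)
  let ?F = "\<lambda>z. of_real (exp (- \<theta> * (cmod z)\<^sup>2) * cn_density \<mu> z) * (z ^ a * cnj z ^ b)"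
  let ?T = "\<lambda>f :: complex \<Rightarrow> real. \<Sum>b\<in>Basis. f b *\<^sub>R b"
  let ?P = "\<Pi>\<^sub>M b\<in>(Basis :: complex set). (lborel :: real measure)"
  have T: "?T f = Complex (f 1) (f \<i>)" for f
    by (simp add: Basis_complex_def complex_eq_iff)
  have [measurable]: "?T \<in> measurable ?P borel" by measurable
  have [measurable]: "?F \<in> borel_measurable borel"
    unfolding cn_density_def by measurable
  have e: "?F (?T \<omega>) = of_real C * ((zvar (\<lambda>b. of_real (\<omega> b)) ^ a * zcvar (\<lambda>b. of_real (\<omega> b)) ^ b) *
     of_real (\<Prod>b\<in>Basis. normal_density ((\<tau> * \<mu>) \<bullet> b) \<sigma> (\<omega> b)))" for \<omega>
  proof -
    have "zvar (\<lambda>b. of_real (\<omega> b)) = ?T \<omega>" "zcvar (\<lambda>b. of_real (\<omega> b)) = cnj (?T \<omega>)"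
      unfolding T by (auto simp: zvar_def zcvar_def complex_eq_iff)
    moreover have "(\<Prod>b\<in>Basis. normal_density ((\<tau> * \<mu>) \<bullet> b) \<sigma> (\<omega> b)) =
      normal_density (\<tau> * Re \<mu>) \<sigma> (Re (?T \<omega>)) * normal_density (\<tau> * Im \<mu>) \<sigma> (Im (?T \<omega>))"
      unfolding T by (simp add: Basis_complex_def)
    ultimately show ?thesis
      unfolding tilted_cn_density[OF assms] C_def \<sigma>_def by (simp only: of_real_mult mult_ac)
  qed
  have "integrable ?P (\<lambda>\<omega>. ?F (?T \<omega>))"
    unfolding e using gauss_integrable_poly_fun[OF \<sigma>(1) poly_fun_zvar_pow, of "\<tau> * \<mu>" a b]
    unfolding gauss_integrable_def by (rule integrable_mult_right)
  then have "integrable (distr ?P borel ?T) ?F"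
    by (rule iffD2[OF integrable_distr_eq, rotated 2]) measurable
  then show "integrable lborel ?F" by (subst lborel_eq)
  have "(\<integral>z. ?F z \<partial>lborel) = (\<integral>\<omega>. ?F (?T \<omega>) \<partial>?P)"
    by (subst lborel_eq) (rule integral_distr; measurable)
  also have "\<dots> = of_real C * gaussM (\<tau> * \<mu>) \<sigma> a b"
    unfolding e gaussM_def gaussE_def by (rule integral_mult_right_zero)
  also have "gaussM (\<tau> * \<mu>) \<sigma> a b = poly (heat_bimonom a b (\<tau> * \<mu>) (\<tau> * cnj \<mu>)) (of_real \<tau>)"
    unfolding gaussM_heat_bimonom[OF \<sigma>(1)] \<sigma>(2) by simp
  finally show "(\<integral>z. ?F z \<partial>lborel) = of_real (\<tau> * exp (- \<theta> * \<tau> * (cmod \<mu>)\<^sup>2)) * poly (heat_bimonom a b (\<tau> * \<mu>) (\<tau> * cnj \<mu>)) (of_real \<tau>)"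
    unfolding C_def .
qed

section \<open>Gaussian expectation of polynomials in all matrix entries as a heat flow\<close>

lemma pmonom_gvars:
  "pmonom (gvars s t) n x = (\<Prod>v\<in>{..<s} \<times> {..<t}. x (Inl v) ^ n (Inl v) * x (Inr v) ^ n (Inr v))"
  unfolding pmonom_def gvars_def by (simp add: prod.Plus prod.distrib)

text \<open>The Laplacian is a sum over the entries, and each summand lowers both exponents of its
  own entry. Monomials therefore evolve entrywise, and the exponents of the \<open>Inl\<close>
  coordinates alone bound the degree in time.\<close>

lemma heat_exp_heatX_pmonom:
  assumes "(\<Sum>v\<in>{..<s} \<times> {..<t}. n (Inl v)) \<le> N"
  shows "heat_exp (heatX s t) N \<tau> (pmonom (gvars s t) n) x =
    (\<Prod>v\<in>{..<s} \<times> {..<t}. poly (heat_bimonom (n (Inl v)) (n (Inr v)) (x (Inl v)) (x (Inr v))) \<tau>)"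
proof -
  interpret heat_op "gvars s t" "heatX s t" by (rule heat_op_X)
  let ?I = "{..<s} \<times> {..<t}"
  have fin: "finite ?I" by simp
  define G where "G n = (\<Prod>v\<in>?I. heat_bimonom (n (Inl v)) (n (Inr v)) (x (Inl v)) (x (Inr v)))" for n
  let ?c = "\<lambda>v (n :: nat \<times> nat + nat \<times> nat \<Rightarrow> nat). of_nat (n (Inl v)) * (of_nat (n (Inr v)) :: complex)"
  let ?r = "\<lambda>v (n :: nat \<times> nat + nat \<times> nat \<Rightarrow> nat). n(Inl v := n (Inl v) - 1, Inr v := n (Inr v) - 1)"
  have poly_fun_pm: "poly_fun (gvars s t) (pmonom (gvars s t) n)" for n
    using poly_fun_pmonom[of "gvars s t" 1 n] by simp
  have "heat_exp (heatX s t) N \<tau> (pmonom (gvars s t) n) x = poly (G n) \<tau>"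
  proof (rule heat_exp_basis[where b = "pmonom (gvars s t)" and G = G and K = ?I and c = ?c and r = ?r])
    show "poly_fun (gvars s t) (pmonom (gvars s t) n)" for n by (rule poly_fun_pm)
    show "heatX s t (pmonom (gvars s t) n) = (\<lambda>x. \<Sum>v\<in>?I. ?c v n * pmonom (gvars s t) (?r v n) x)" for n
      unfolding heatX_def
    proof (intro ext sum.cong refl)
      fix x v assume v: "v \<in> ?I"
      then have m: "Inl v \<in> gvars s t" "Inr v \<in> gvars s t" by (auto simp: gvars_def)
      have "partial (Inr v) (pmonom (gvars s t) n) = (\<lambda>x. of_nat (n (Inr v)) * pmonom (gvars s t) (n(Inr v := n (Inr v) - 1)) x)"
        using m by (auto simp: partial_pmonom)
      then show "partial (Inl v) (partial (Inr v) (pmonom (gvars s t) n)) x = ?c v n * pmonom (gvars s t) (?r v n) x"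
        using m by (simp add: partial_cmult[OF finite_gvars[of s t]] poly_fun_pm partial_pmonom fun_upd_twist)
    qed
    show "pderiv (G n) = (\<Sum>v\<in>?I. Polynomial.smult (?c v n) (G (?r v n)))" for n
      unfolding G_def pderiv_prod
    proof (intro sum.cong refl)
      fix v assume v: "v \<in> ?I"
      have "(\<Prod>u\<in>?I - {v}. heat_bimonom ((?r v n) (Inl u)) ((?r v n) (Inr u)) (x (Inl u)) (x (Inr u))) =
        (\<Prod>u\<in>?I - {v}. heat_bimonom (n (Inl u)) (n (Inr u)) (x (Inl u)) (x (Inr u)))"
        by (rule prod.cong) auto
      then have "(\<Prod>u\<in>?I. heat_bimonom ((?r v n) (Inl u)) ((?r v n) (Inr u)) (x (Inl u)) (x (Inr u))) =
        heat_bimonom (n (Inl v) - 1) (n (Inr v) - 1) (x (Inl v)) (x (Inr v)) *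
        (\<Prod>u\<in>?I - {v}. heat_bimonom (n (Inl u)) (n (Inr u)) (x (Inl u)) (x (Inr u)))"
        using prod.remove[OF fin v, of "\<lambda>u. heat_bimonom ((?r v n) (Inl u)) ((?r v n) (Inr u)) (x (Inl u)) (x (Inr u))"]
        by simp
      then show "(\<Prod>u\<in>?I - {v}. heat_bimonom (n (Inl u)) (n (Inr u)) (x (Inl u)) (x (Inr u))) *
          pderiv (heat_bimonom (n (Inl v)) (n (Inr v)) (x (Inl v)) (x (Inr v))) =
        Polynomial.smult (?c v n) (\<Prod>u\<in>?I. heat_bimonom ((?r v n) (Inl u)) ((?r v n) (Inr u)) (x (Inl u)) (x (Inr u)))"
        by (simp only: pderiv_heat_bimonom mult_smult_right mult.commute)
    qed
    show "poly (G n) 0 = pmonom (gvars s t) n x" for n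
      unfolding G_def poly_prod poly_heat_bimonom_0 pmonom_gvars ..
    have "degree (G n) \<le> (\<Sum>v\<in>?I. degree (heat_bimonom (n (Inl v)) (n (Inr v)) (x (Inl v)) (x (Inr v))))"
      unfolding G_def by (rule degree_prod_sum_le[unfolded comp_def]) simp
    also have "\<dots> \<le> (\<Sum>v\<in>?I. n (Inl v))" by (intro sum_mono degree_heat_bimonom)
    finally show "degree (G n) \<le> N" using assms by linarith
  qed
  then show ?thesis by (simp add: G_def poly_prod)
qed

definition rvar :: "('i \<Rightarrow> complex) \<Rightarrow> 'i + 'i \<Rightarrow> complex" where
  "rvar X = case_sum X (\<lambda>v. cnj (X v))"

text \<open>Independence factorises a tilted monomial into moments of single entries, each a heat
  evolution for time \<tau> from \<tau> \<mu>; sums follow by linearity. The threshold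
  \<open>N0\<close> depends on \<open>f\<close> and stays existential, so that for a sum the larger
  of two thresholds serves.\<close>

lemma (in prob_space) expectation_tilted_poly_fun:
  fixes X :: "nat \<times> nat \<Rightarrow> 'a \<Rightarrow> complex" and \<mu> :: "nat \<times> nat \<Rightarrow> complex" and \<theta> :: real
  defines "I s t \<equiv> {..<s} \<times> {..<t}"
  assumes ind: "indep_vars (\<lambda>_. borel) X (I s t)"
    and dis: "\<And>v. v \<in> I s t \<Longrightarrow> distributed M lborel (X v) (\<lambda>z. ennreal (cn_density (\<mu> v) z))"
    and \<theta>: "0 \<le> \<theta>" and \<tau>: "\<tau> = 1 / (1 + \<theta>)"
    and f: "poly_fun (gvars s t) f"
  defines "W \<equiv> \<lambda>\<omega>. of_real (exp (- \<theta> * (\<Sum>v\<in>I s t. (cmod (X v \<omega>))\<^sup>2))) * f (rvar (\<lambda>v. X v \<omega>))"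
  shows "integrable M W"
    and "\<exists>N0. \<forall>N\<ge>N0. expectation W =
      of_real (\<Prod>v\<in>I s t. \<tau> * exp (- \<theta> * \<tau> * (cmod (\<mu> v))\<^sup>2)) *
      heat_exp (heatX s t) N (of_real \<tau>) f (rvar (\<lambda>v. \<tau> * \<mu> v))"
proof -
  interpret X: heat_op "gvars s t" "heatX s t" by (rule heat_op_X)
  define C where "C = (of_real (\<Prod>v\<in>I s t. \<tau> * exp (- \<theta> * \<tau> * (cmod (\<mu> v))\<^sup>2)) :: complex)"
  have fin: "finite (I s t)" by (simp add: I_def)
  have rvX: "X v \<in> borel_measurable M" if "v \<in> I s t" for v
    using ind that by (auto simp: indep_vars_def)
  define Y where "Y n v z = of_real (exp (- \<theta> * (cmod z)\<^sup>2)) * (z ^ n (Inl v) * cnj z ^ n (Inr v))"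
    for n :: "nat \<times> nat + nat \<times> nat \<Rightarrow> nat" and v and z :: complex
  have Ymeas [measurable]: "Y n v \<in> borel_measurable borel" for n v
    unfolding Y_def by measurable
  have Y: "integrable M (\<lambda>\<omega>. Y n v (X v \<omega>))"
    "expectation (\<lambda>\<omega>. Y n v (X v \<omega>)) = of_real (\<tau> * exp (- \<theta> * \<tau> * (cmod (\<mu> v))\<^sup>2)) *
      poly (heat_bimonom (n (Inl v)) (n (Inr v)) (\<tau> * \<mu> v) (\<tau> * cnj (\<mu> v))) (of_real \<tau>)"
    if v: "v \<in> I s t" for n v
  proof -
    have d: "distr M lborel (X v) = density lborel (\<lambda>z. ennreal (cn_density (\<mu> v) z))"
      using dis[OF v] by (simp add: distributed_def)
    have [measurable]: "X v \<in> borel_measurable M" by (rule rvX[OF v])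
    have [measurable]: "(\<lambda>z. cn_density (\<mu> v) z) \<in> borel_measurable borel"
      unfolding cn_density_def by measurable
    have nn: "0 \<le> cn_density (\<mu> v) z" for z by (simp add: cn_density_def)
    have e: "cn_density (\<mu> v) z *\<^sub>R Y n v z =
      of_real (exp (- \<theta> * (cmod z)\<^sup>2) * cn_density (\<mu> v) z) * (z ^ n (Inl v) * cnj z ^ n (Inr v))" for z
      by (simp add: Y_def scaleR_conv_of_real)
    have "integrable (distr M lborel (X v)) (Y n v)"
      unfolding d by (subst integrable_density) (auto simp: nn e cn_tilted_moment(1)[OF \<theta> \<tau>, simplified])
    then show "integrable M (\<lambda>\<omega>. Y n v (X v \<omega>))"
      by (subst (asm) integrable_distr_eq) auto
    have "expectation (\<lambda>\<omega>. Y n v (X v \<omega>)) = (\<integral>z. Y n v z \<partial>distr M lborel (X v))"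
      by (subst integral_distr) auto
    also have "\<dots> = (\<integral>z. cn_density (\<mu> v) z *\<^sub>R Y n v z \<partial>lborel)"
      unfolding d by (subst integral_density) (auto simp: nn)
    finally show "expectation (\<lambda>\<omega>. Y n v (X v \<omega>)) = of_real (\<tau> * exp (- \<theta> * \<tau> * (cmod (\<mu> v))\<^sup>2)) *
      poly (heat_bimonom (n (Inl v)) (n (Inr v)) (\<tau> * \<mu> v) (\<tau> * cnj (\<mu> v))) (of_real \<tau>)"
      unfolding e cn_tilted_moment(2)[OF \<theta> \<tau>] .
  qed
  define T where "T f \<omega> = of_real (exp (- \<theta> * (\<Sum>v\<in>I s t. (cmod (X v \<omega>))\<^sup>2))) * f (rvar (\<lambda>v. X v \<omega>))"
    for f :: "(nat \<times> nat + nat \<times> nat \<Rightarrow> complex) \<Rightarrow> complex" and \<omega>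
  have mono: "integrable M (T (pmonom (gvars s t) n))"
    "\<exists>N0. \<forall>N\<ge>N0. expectation (T (pmonom (gvars s t) n)) =
      C * heat_exp (heatX s t) N (of_real \<tau>) (pmonom (gvars s t) n) (rvar (\<lambda>v. \<tau> * \<mu> v))" for n
  proof -
    have e: "T (pmonom (gvars s t) n) \<omega> = (\<Prod>v\<in>I s t. Y n v (X v \<omega>))" for \<omega>
    proof -
      have "exp (- \<theta> * (\<Sum>v\<in>I s t. (cmod (X v \<omega>))\<^sup>2)) = (\<Prod>v\<in>I s t. exp (- \<theta> * (cmod (X v \<omega>))\<^sup>2))"
        unfolding sum_distrib_left by (rule exp_sum[OF fin])
      then show ?thesis
        unfolding T_def pmonom_gvars Y_def prod.distrib I_def[symmetric]
        by (simp add: rvar_def prod.distrib)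
    qed
    have ind': "indep_vars (\<lambda>_. borel) (\<lambda>v \<omega>. Y n v (X v \<omega>)) (I s t)"
      by (rule indep_vars_compose2[OF ind]) simp
    show "integrable M (T (pmonom (gvars s t) n))"
      unfolding e by (rule indep_vars_integrable[OF fin ind']) (rule Y(1))
    have "expectation (T (pmonom (gvars s t) n)) = (\<Prod>v\<in>I s t. expectation (\<lambda>\<omega>. Y n v (X v \<omega>)))"
      unfolding e by (rule indep_vars_lebesgue_integral[OF fin ind']) (rule Y(1))
    also have "\<dots> = (\<Prod>v\<in>I s t. of_real (\<tau> * exp (- \<theta> * \<tau> * (cmod (\<mu> v))\<^sup>2)) *
      poly (heat_bimonom (n (Inl v)) (n (Inr v)) (\<tau> * \<mu> v) (\<tau> * cnj (\<mu> v))) (of_real \<tau>))"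
      by (intro prod.cong refl Y(2))
    also have "\<dots> = C * (\<Prod>v\<in>I s t. poly (heat_bimonom (n (Inl v)) (n (Inr v)) (\<tau> * \<mu> v) (\<tau> * cnj (\<mu> v))) (of_real \<tau>))"
      unfolding prod.distrib C_def by simp
    finally have "expectation (T (pmonom (gvars s t) n)) = \<dots>" .
    then show "\<exists>N0. \<forall>N\<ge>N0. expectation (T (pmonom (gvars s t) n)) =
      C * heat_exp (heatX s t) N (of_real \<tau>) (pmonom (gvars s t) n) (rvar (\<lambda>v. \<tau> * \<mu> v))"
      by (intro exI[of _ "\<Sum>v\<in>{..<s} \<times> {..<t}. n (Inl v)"] allI impI)
        (simp add: heat_exp_heatX_pmonom rvar_def I_def)
  qed
  have "integrable M (T f) \<and> (\<exists>N0. \<forall>N\<ge>N0. expectation (T f) =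
    C * heat_exp (heatX s t) N (of_real \<tau>) f (rvar (\<lambda>v. \<tau> * \<mu> v)))"
    using f
  proof induction
    case (poly_fun_pmonom c n)
    have pm: "poly_fun (gvars s t) (pmonom (gvars s t) n)"
      using poly_fun.poly_fun_pmonom[of "gvars s t" 1 n] by simp
    have e: "T (\<lambda>x. c * pmonom (gvars s t) n x) = (\<lambda>\<omega>. c * T (pmonom (gvars s t) n) \<omega>)"
      by (auto simp: T_def)
    show ?case
      unfolding e using mono[of n] by (auto simp: X.heat_exp_cmult[OF pm])
  next
    case (poly_fun_add f g)
    have e: "T (\<lambda>x. f x + g x) = (\<lambda>\<omega>. T f \<omega> + T g \<omega>)"
      by (auto simp: T_def algebra_simps)
    from poly_fun_add.IH obtain N1 N2 where
      N: "\<And>N. N \<ge> N1 \<Longrightarrow> expectation (T f) = C * heat_exp (heatX s t) N (of_real \<tau>) f (rvar (\<lambda>v. \<tau> * \<mu> v))"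
       "\<And>N. N \<ge> N2 \<Longrightarrow> expectation (T g) = C * heat_exp (heatX s t) N (of_real \<tau>) g (rvar (\<lambda>v. \<tau> * \<mu> v))"
      by blast
    have "expectation (\<lambda>\<omega>. T f \<omega> + T g \<omega>) =
      C * heat_exp (heatX s t) N (of_real \<tau>) (\<lambda>x. f x + g x) (rvar (\<lambda>v. \<tau> * \<mu> v))" if "N \<ge> max N1 N2" for N
    proof -
      have "expectation (\<lambda>\<omega>. T f \<omega> + T g \<omega>) = expectation (T f) + expectation (T g)"
        using poly_fun_add.IH by (intro Bochner_Integration.integral_add) auto
      then show ?thesis
        using N(1)[of N] N(2)[of N] that by (simp add: X.heat_exp_add[OF poly_fun_add.hyps] distrib_left)
    qed
    moreover have "integrable M (\<lambda>\<omega>. T f \<omega> + T g \<omega>)"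
      using poly_fun_add.IH by (intro Bochner_Integration.integrable_add) auto
    ultimately show ?case unfolding e by blast
  qed
  then show "integrable M W" "\<exists>N0. \<forall>N\<ge>N0. expectation W =
      of_real (\<Prod>v\<in>I s t. \<tau> * exp (- \<theta> * \<tau> * (cmod (\<mu> v))\<^sup>2)) *
      heat_exp (heatX s t) N (of_real \<tau>) f (rvar (\<lambda>v. \<tau> * \<mu> v))"
    unfolding W_def T_def C_def by blast+
qed

section \<open>The noncentral chi-square kernel\<close>

definition wint :: "nat \<Rightarrow> (real \<Rightarrow> real) \<Rightarrow> real" where
  "wint k h = (\<integral>w. indicator {0..} w * (w ^ k * exp (- w) * h w) \<partial>lborel)"

text \<open>For z > 0 this is z^(- q / 2) times the modified Bessel function of order q at 2 sqrt z.
  Splitting off the fractional power keeps it analytic at 0, where the confluent columns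
  arise.\<close>

definition nu0 :: "nat \<Rightarrow> real \<Rightarrow> real" where
  "nu0 q z = (\<Sum>k. z ^ k / (fact k * fact (k + q)))"

text \<open>For k = n + q this equals exp l times the mean of w^n h(w), where w is the squared
  length of a complex Gaussian vector of dimension q + 1 with unit variances and squared mean length
  l.\<close>

definition kint :: "nat \<Rightarrow> real \<Rightarrow> nat \<Rightarrow> (real \<Rightarrow> real) \<Rightarrow> real" where
  "kint q l k h = wint k (\<lambda>w. nu0 q (l * w) * h w)"

lemma power_exp_integral:
  fixes c :: real
  assumes "0 < c"
  shows "has_bochner_integral lborel (\<lambda>w. indicator {0..} w * (w ^ k * exp (- c * w))) (fact k / c ^ Suc k)"
proof -
  have "(\<integral>\<^sup>+ x. ennreal (erlang_density k c x) \<partial>lborel) = ennreal 1"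
    using nn_integral_erlang_ith_moment[OF assms, of k 0] by simp
  then have "has_bochner_integral lborel (erlang_density k c) 1"
    using assms by (intro has_bochner_integral_nn_integral) auto
  then have "has_bochner_integral lborel (\<lambda>w. (fact k / c ^ Suc k) * erlang_density k c w) ((fact k / c ^ Suc k) * 1)"
    by (rule has_bochner_integral_mult_right)
  moreover have "(fact k / c ^ Suc k) * erlang_density k c w = indicator {0..} w * (w ^ k * exp (- c * w))" for w
    using assms by (auto simp: erlang_density_def indicator_def)
  ultimately show ?thesis by simp
qed

lemma wint_power_exp:
  fixes \<theta> :: real
  assumes "0 \<le> \<theta>"
  shows "wint k (\<lambda>w. w ^ m * exp (- \<theta> * w)) = fact (k + m) / (1 + \<theta>) ^ Suc (k + m)"
proof -
  have e: "indicator {0..} w * (w ^ k * exp (- w) * (w ^ m * exp (- \<theta> * w))) =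
    indicator {0..} w * (w ^ (k + m) * exp (- (1 + \<theta>) * w))" for w :: real
    by (simp add: power_add algebra_simps flip: exp_add)
  have "0 < 1 + \<theta>" using assms by simp
  from has_bochner_integral_integral_eq[OF power_exp_integral[OF this, of "k + m"]]
  show ?thesis unfolding wint_def e .
qed

lemma wint_integrable:
  fixes h :: "real \<Rightarrow> real"
  assumes "h \<in> borel_measurable borel" "\<And>w. 0 \<le> w \<Longrightarrow> \<bar>h w\<bar> \<le> B"
  shows "integrable lborel (\<lambda>w. indicator {0..} w * (w ^ k * exp (- w) * h w))"
proof (rule Bochner_Integration.integrable_bound)
  show "integrable lborel (\<lambda>w :: real. B * (indicator {0..} w * (w ^ k * exp (- 1 * w))))"
    using power_exp_integral[of 1 k] by (intro integrable_mult_right) (auto simp: has_bochner_integral_iff)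
  have "B \<ge> 0" using assms(2)[of 0] by auto
  then show "AE w in lborel. norm (indicator {0..} w * (w ^ k * exp (- w) * h w)) \<le>
      norm (B * (indicator {0..} w * (w ^ k * exp (- 1 * w))))"
    using assms(2) by (auto simp: abs_mult indicator_def mult_ac intro!: mult_mono)
qed (use assms(1) in measurable)

lemma wint_bound:
  fixes h :: "real \<Rightarrow> real"
  assumes "h \<in> borel_measurable borel" "\<And>w. 0 \<le> w \<Longrightarrow> \<bar>h w\<bar> \<le> B"
  shows "(\<integral>w. \<bar>indicator {0..} w * (w ^ k * exp (- w) * h w)\<bar> \<partial>lborel) \<le> B * fact k"
proof -
  have i: "integrable lborel (\<lambda>w :: real. B * (indicator {0..} w * (w ^ k * exp (- 1 * w))))"
    using power_exp_integral[of 1 k] by (intro integrable_mult_right) (auto simp: has_bochner_integral_iff)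
  have "(\<integral>w. \<bar>indicator {0..} w * (w ^ k * exp (- w) * h w)\<bar> \<partial>lborel) \<le>
    (\<integral>w. B * (indicator {0..} w * (w ^ k * exp (- 1 * w))) \<partial>lborel)"
  proof (rule integral_mono[OF integrable_abs[OF wint_integrable[OF assms]] i])
    fix w :: real
    show "\<bar>indicator {0..} w * (w ^ k * exp (- w) * h w)\<bar> \<le> B * (indicator {0..} w * (w ^ k * exp (- 1 * w)))"
      using assms(2)[of w] by (auto simp: abs_mult indicator_def mult_ac intro!: mult_mono)
  qed
  also have "\<dots> = B * fact k"
    using power_exp_integral[of 1 k] by (simp add: has_bochner_integral_iff)
  finally show ?thesis .
qed

text \<open>Kummer's transformation: the confluent hypergeometric series is exp z times a polynomial
  of Laguerre type. Vandermonde's convolution expands (n + q + k)! / (k + q)! in the binomials C(k,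
  m), and the series with terms C(k, m) z^k / k! sums to exp z z^m / m!.\<close>

lemma kummer_sums:
  fixes z :: "'a :: {real_normed_field, banach}"
  shows "(\<lambda>k. z ^ k * fact (n + q + k) / (fact k * fact (k + q))) sums
    (exp z * (\<Sum>j\<le>n. fact n * of_nat ((q + n) choose j) / fact (n - j) * z ^ (n - j)))"
proof -
  have 1: "(\<lambda>k. of_nat (k choose m) * z ^ k / fact k) sums (exp z * (z ^ m / fact m))" for m
  proof -
    have "(\<lambda>k. (z ^ k /\<^sub>R fact k) * (z ^ m / fact m)) sums (exp z * (z ^ m / fact m))"
      by (intro sums_mult2 exp_converges)
    moreover have "(z ^ k /\<^sub>R fact k) * (z ^ m / fact m) = of_nat ((k + m) choose m) * z ^ (k + m) / fact (k + m)" for k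
    proof -
      have "(of_nat ((k + m) choose m) :: 'a) = fact (k + m) / (fact m * fact k)"
        using binomial_fact[of m "k + m", where ?'a = 'a] by simp
      then show ?thesis by (simp add: scaleR_conv_of_real field_simps power_add)
    qed
    ultimately have "(\<lambda>k. of_nat ((k + m) choose m) * z ^ (k + m) / fact (k + m)) sums (exp z * (z ^ m / fact m))"
      by simp
    then show ?thesis
      by (subst (asm) sums_iff_shift[where f = "\<lambda>k. of_nat (k choose m) * z ^ k / fact k"])
        (simp add: binomial_eq_0)
  qed
  have 2: "z ^ k * fact (n + q + k) / (fact k * fact (k + q)) =
    (\<Sum>j\<le>n. fact n * of_nat ((q + n) choose j) * (of_nat (k choose (n - j)) * z ^ k / fact k))" for k
  proof -
    have "(fact (n + q + k) :: 'a) / fact (k + q) = fact n * of_nat ((q + n + k) choose n)"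
      using binomial_fact[of n "q + n + k", where ?'a = 'a] by (simp add: field_simps add_ac)
    also have "(q + n + k) choose n = (\<Sum>j\<le>n. ((q + n) choose j) * (k choose (n - j)))"
      by (rule vandermonde[symmetric])
    finally show ?thesis
      by (simp add: sum_distrib_left sum_distrib_right field_simps)
  qed
  have "(\<lambda>k. \<Sum>j\<le>n. fact n * of_nat ((q + n) choose j) * (of_nat (k choose (n - j)) * z ^ k / fact k)) sums
    (\<Sum>j\<le>n. fact n * of_nat ((q + n) choose j) * (exp z * (z ^ (n - j) / fact (n - j))))"
    by (intro sums_sum sums_mult 1)
  also have "(\<Sum>j\<le>n. fact n * of_nat ((q + n) choose j) * (exp z * (z ^ (n - j) / fact (n - j)))) =
    exp z * (\<Sum>j\<le>n. fact n * of_nat ((q + n) choose j) / fact (n - j) * z ^ (n - j))"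
    by (simp add: sum_distrib_left mult_ac)
  finally show ?thesis unfolding 2 .
qed

lemma nu0_summable: "summable (\<lambda>k. z ^ k / (fact k * fact (k + q) :: real))"
proof (rule summable_comparison_test')
  show "summable (\<lambda>k. \<bar>z\<bar> ^ k * fact (0 + q + k) / (fact k * fact (k + q)))"
    using kummer_sums[of "\<bar>z\<bar>" 0 q] by (rule sums_summable)
  fix k :: nat assume "0 \<le> k"
  have "\<bar>z\<bar> ^ k / (fact k * fact (k + q)) * 1 \<le> \<bar>z\<bar> ^ k / (fact k * fact (k + q)) * fact (0 + q + k)"
    by (intro mult_left_mono) auto
  then show "norm (z ^ k / (fact k * fact (k + q))) \<le> \<bar>z\<bar> ^ k * fact (0 + q + k) / (fact k * fact (k + q))"
    by (simp add: power_abs abs_mult)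
qed

lemma nu0_sums: "(\<lambda>k. z ^ k / (fact k * fact (k + q))) sums nu0 q z"
  unfolding nu0_def by (rule summable_sums[OF nu0_summable])

lemma nu0_measurable [measurable]: "nu0 q \<in> borel_measurable borel"
  unfolding nu0_def[abs_def] by (rule borel_measurable_suminf) measurable

text \<open>Expansion of the kernel in powers of \<open>l\<close> under the integral; the Kummer
  series provides the majorant for the exchange. The coefficients are what confluent columns will
  consist of.\<close>

lemma kint_sums_aux:
  assumes h: "h \<in> borel_measurable borel" "\<And>w. 0 \<le> w \<Longrightarrow> \<bar>h w\<bar> \<le> B" and l: "0 \<le> l"
  shows "(\<lambda>k. l ^ k * (wint (n + q + k) h / (fact k * fact (k + q)))) sums kint q l (n + q) h"
    and "integrable lborel (\<lambda>w. indicator {0..} w * (w ^ (n + q) * exp (- w) * (nu0 q (l * w) * h w)))"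
proof -
  let ?c = "\<lambda>k. l ^ k / (fact k * fact (k + q))"
  let ?f = "\<lambda>k w. ?c k * (indicator {0..} w * (w ^ (n + q + k) * exp (- w) * h w))"
  have i: "integrable lborel (?f k)" for k
    by (intro integrable_mult_right wint_integrable[OF h])
  have c: "0 \<le> ?c k" for k using l by simp
  have s: "summable (\<lambda>k. \<integral>w. norm (?f k w) \<partial>lborel)"
  proof (rule summable_comparison_test')
    show "summable (\<lambda>k. B * (l ^ k * fact (n + q + k) / (fact k * fact (k + q))))"
      using kummer_sums[of l n q] by (intro summable_mult sums_summable)
    fix k :: nat assume "0 \<le> k"
    have "(\<integral>w. norm (?f k w) \<partial>lborel) = ?c k * (\<integral>w. \<bar>indicator {0..} w * (w ^ (n + q + k) * exp (- w) * h w)\<bar> \<partial>lborel)"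
      unfolding real_norm_def abs_mult[of "?c k"] abs_of_nonneg[OF c] by (rule integral_mult_right_zero)
    also have "\<dots> \<le> ?c k * (B * fact (n + q + k))"
      by (intro mult_left_mono wint_bound[OF h] c)
    finally show "norm (\<integral>w. norm (?f k w) \<partial>lborel) \<le> B * (l ^ k * fact (n + q + k) / (fact k * fact (k + q)))"
      by (simp add: mult_ac)
  qed
  have sw: "(\<lambda>k. ?f k w) sums (indicator {0..} w * (w ^ (n + q) * exp (- w) * (nu0 q (l * w) * h w)))" for w
  proof -
    have "(\<lambda>k. (indicator {0..} w * (w ^ (n + q) * exp (- w) * h w)) * ((l * w) ^ k / (fact k * fact (k + q))))
      sums ((indicator {0..} w * (w ^ (n + q) * exp (- w) * h w)) * nu0 q (l * w))"
      by (intro sums_mult nu0_sums)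
    then show ?thesis by (simp add: power_mult_distrib power_add mult_ac)
  qed
  have sa: "AE w in lborel. summable (\<lambda>k. norm (?f k w))"
  proof (rule AE_I2)
    fix w :: real
    have "(\<lambda>k. (indicator {0..} w * (w ^ (n + q) * exp (- w) * \<bar>h w\<bar>)) * ((l * w) ^ k / (fact k * fact (k + q))))
      sums ((indicator {0..} w * (w ^ (n + q) * exp (- w) * \<bar>h w\<bar>)) * nu0 q (l * w))"
      by (intro sums_mult nu0_sums)
    moreover have "(indicator {0..} w * (w ^ (n + q) * exp (- w) * \<bar>h w\<bar>)) * ((l * w) ^ k / (fact k * fact (k + q))) =
      norm (?f k w)" for k
      using l by (auto simp: indicator_def abs_mult power_mult_distrib power_add power_abs mult_ac)
    ultimately show "summable (\<lambda>k. norm (?f k w))" by (simp add: sums_iff)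
  qed
  have e: "(\<Sum>k. ?f k w) = indicator {0..} w * (w ^ (n + q) * exp (- w) * (nu0 q (l * w) * h w))" for w
    using sw by (simp add: sums_iff)
  show "integrable lborel (\<lambda>w. indicator {0..} w * (w ^ (n + q) * exp (- w) * (nu0 q (l * w) * h w)))"
    using integrable_suminf[OF i sa s] unfolding e .
  show "(\<lambda>k. l ^ k * (wint (n + q + k) h / (fact k * fact (k + q)))) sums kint q l (n + q) h"
    using sums_integral[OF i sa s] unfolding e kint_def wint_def by simp
qed

lemmas kint_sums = kint_sums_aux(1)

lemma exp_poly_bounded:
  fixes p :: "real poly"
  assumes "0 < \<theta>"
  shows "\<exists>B. \<forall>w\<ge>0. \<bar>poly p w * exp (- \<theta> * w)\<bar> \<le> B"
proof -
  have m: "w ^ m * exp (- \<theta> * w) \<le> fact m / \<theta> ^ m" if "0 \<le> w" for w m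
  proof -
    have "(\<theta> * w) ^ m /\<^sub>R fact m \<le> exp (\<theta> * w)"
      unfolding exp_def
      by (rule order_trans[OF _ sum_le_suminf[OF summable_exp_generic, of "{m}"]])
        (use assms that in auto)
    then show ?thesis using assms
      by (simp add: exp_minus power_mult_distrib divide_simps mult_ac)
  qed
  show ?thesis
  proof (intro exI allI impI)
    fix w :: real assume w: "0 \<le> w"
    have "\<bar>poly p w * exp (- \<theta> * w)\<bar> \<le> (\<Sum>i\<le>degree p. \<bar>coeff p i\<bar> * (w ^ i * exp (- \<theta> * w)))"
      unfolding poly_altdef sum_distrib_right
      by (rule order_trans[OF sum_abs]) (use w in \<open>simp add: abs_mult mult.assoc\<close>)
    also have "\<dots> \<le> (\<Sum>i\<le>degree p. \<bar>coeff p i\<bar> * (fact i / \<theta> ^ i))"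
      by (intro sum_mono mult_left_mono m w) auto
    finally show "\<bar>poly p w * exp (- \<theta> * w)\<bar> \<le> (\<Sum>i\<le>degree p. \<bar>coeff p i\<bar> * (fact i / \<theta> ^ i))" .
  qed
qed

lemma wint_sum:
  assumes "\<And>i. i \<in> I \<Longrightarrow> integrable lborel (\<lambda>w. indicator {0..} w * (w ^ k * exp (- w) * h i w))"
  shows "wint k (\<lambda>w. \<Sum>i\<in>I. c i * h i w) = (\<Sum>i\<in>I. c i * wint k (h i))"
proof -
  have "wint k (\<lambda>w. \<Sum>i\<in>I. c i * h i w) =
    (\<integral>w. (\<Sum>i\<in>I. c i * (indicator {0..} w * (w ^ k * exp (- w) * h i w))) \<partial>lborel)"
    unfolding wint_def by (simp add: sum_distrib_left mult_ac)
  also have "\<dots> = (\<Sum>i\<in>I. c i * wint k (h i))"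
    using assms unfolding wint_def by (subst Bochner_Integration.integral_sum) auto
  finally show ?thesis .
qed

text \<open>The one-variable link between kernel and heat flow: integrating w^n p(w) against the
  tilted kernel is, up to a factor, the heat evolution of w^n p for time \<tau> from \<tau>^2 l.
  Both sides are computed on monomials, the left one by Kummer's transformation; the weighted
  homogeneity of \<open>heat_monom\<close> accounts for the powers of \<tau>.\<close>

lemma kint_heat_poly:
  fixes p :: "real poly"
  assumes \<theta>: "0 < \<theta>" and \<tau>: "\<tau> = 1 / (1 + \<theta>)" and l: "0 \<le> l"
  shows "of_real (kint q l (n + q) (\<lambda>w. poly p w * exp (- \<theta> * w))) =
    of_real (exp (l * \<tau>) * \<tau> ^ Suc q) *
      poly (heat_poly q (monom 1 n * map_poly of_real p) (of_real (\<tau>\<^sup>2 * l))) (of_real \<tau>)"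
proof -
  have \<tau>0: "\<tau> > 0" using assms by simp
  define h where "h w = poly p w * exp (- \<theta> * w)" for w
  obtain B where B: "\<And>w. w \<ge> 0 \<Longrightarrow> \<bar>h w\<bar> \<le> B" using exp_poly_bounded[OF \<theta>, of p] unfolding h_def by blast
  have hm: "h \<in> borel_measurable borel" unfolding h_def[abs_def] poly_altdef by measurable
  have mono_int: "integrable lborel (\<lambda>w. indicator {0..} w * (w ^ k * exp (- w) * (w ^ m * exp (- \<theta> * w))))" for k m
  proof -
    have "poly (monom 1 m) = (\<lambda>w :: real. w ^ m)" by (auto simp: poly_monom)
    with exp_poly_bounded[OF \<theta>, of "monom 1 m"] obtain B where "\<And>w. w \<ge> 0 \<Longrightarrow> \<bar>w ^ m * exp (- \<theta> * w)\<bar> \<le> B"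
      by auto
    then show ?thesis by (intro wint_integrable) auto
  qed
  have wh: "wint k h = (\<Sum>m\<le>degree p. coeff p m * (fact (k + m) * \<tau> ^ Suc (k + m)))" for k
  proof -
    have "h = (\<lambda>w. \<Sum>m\<le>degree p. coeff p m * (w ^ m * exp (- \<theta> * w)))"
      by (auto simp: h_def poly_altdef sum_distrib_right mult.assoc)
    then have "wint k h = (\<Sum>m\<le>degree p. coeff p m * wint k (\<lambda>w. w ^ m * exp (- \<theta> * w)))"
      by (simp only: wint_sum[OF mono_int])
    then show ?thesis using \<theta> by (simp only: wint_power_exp \<tau> power_one_over divide_inverse less_imp_le) (simp add: power_inverse)
  qed
  define F where "F N = exp (l * \<tau>) * (\<Sum>j\<le>N. fact N * of_nat ((q + N) choose j) / fact (N - j) * (l * \<tau>) ^ (N - j))" for N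
  have "(\<lambda>k. \<Sum>m\<le>degree p. coeff p m * \<tau> ^ Suc (n + m + q) * ((l * \<tau>) ^ k * fact (n + m + q + k) / (fact k * fact (k + q)))) sums
    (\<Sum>m\<le>degree p. coeff p m * \<tau> ^ Suc (n + m + q) * F (n + m))"
    unfolding F_def by (intro sums_sum sums_mult kummer_sums)
  moreover have "(\<Sum>m\<le>degree p. coeff p m * \<tau> ^ Suc (n + m + q) * ((l * \<tau>) ^ k * fact (n + m + q + k) / (fact k * fact (k + q)))) =
    l ^ k * (wint (n + q + k) h / (fact k * fact (k + q)))" for k
    unfolding wh by (simp add: sum_distrib_left sum_divide_distrib power_mult_distrib power_add mult_ac add_ac)
  ultimately have 1: "kint q l (n + q) h = (\<Sum>m\<le>degree p. coeff p m * \<tau> ^ Suc (n + m + q) * F (n + m))"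
    using kint_sums[OF hm B l, of n q] by (simp add: sums_unique2)
  have heat_monom: "poly (heat_monom q N (of_real (\<tau>\<^sup>2 * l))) (of_real \<tau>) = of_real (\<tau> ^ N * F N / exp (l * \<tau>))" for N
  proof -
    have "poly (heat_monom q N (of_real (\<tau>\<^sup>2 * l))) (of_real \<tau>) = (of_real (\<Sum>j\<le>N. fact N * of_nat ((q + N) choose j) / fact (N - j) *
       (\<tau>\<^sup>2 * l) ^ (N - j) * \<tau> ^ j) :: complex)"
      by (simp add: heat_monom_def poly_sum poly_monom)
    also have "(\<Sum>j\<le>N. fact N * of_nat ((q + N) choose j) / fact (N - j) * (\<tau>\<^sup>2 * l) ^ (N - j) * \<tau> ^ j) =
      (\<Sum>j\<le>N. \<tau> ^ N * (fact N * of_nat ((q + N) choose j) / fact (N - j) * (l * \<tau>) ^ (N - j)))"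
    proof (intro sum.cong refl)
      fix j assume "j \<in> {..N}"
      then have "\<tau> ^ N = \<tau> ^ (N - j) * \<tau> ^ j" by (simp flip: power_add)
      then show "fact N * of_nat ((q + N) choose j) / fact (N - j) * (\<tau>\<^sup>2 * l) ^ (N - j) * \<tau> ^ j =
        \<tau> ^ N * (fact N * of_nat ((q + N) choose j) / fact (N - j) * (l * \<tau>) ^ (N - j))"
        by (simp add: power_mult_distrib power2_eq_square)
    qed
    also have "\<dots> = \<tau> ^ N * F N / exp (l * \<tau>)"
      by (simp only: F_def sum_distrib_left[symmetric]) simp
    finally show ?thesis .
  qed
  define P where "P = (map_poly of_real p :: complex poly)"
  have dP: "degree (monom 1 n * P) \<le> n + degree p"
    by (rule order_trans[OF degree_mult_le]) (simp add: degree_monom_eq P_def degree_map_poly)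
  have "heat_poly q (monom 1 n * P) \<zeta> = (\<Sum>m\<le>degree p. Polynomial.smult (of_real (coeff p m)) (heat_monom q (n + m) \<zeta>))" for \<zeta>
  proof -
    have "heat_poly q (monom 1 n * P) \<zeta> = (\<Sum>m\<le>n + degree p. Polynomial.smult (if n \<le> m then of_real (coeff p (m - n)) else 0) (heat_monom q m \<zeta>))"
      unfolding heat_poly_eq[OF dP] by (intro sum.cong refl) (simp add: coeff_monom_mult P_def coeff_map_poly)
    also have "\<dots> = (\<Sum>m\<in>{n..n + degree p}. Polynomial.smult (of_real (coeff p (m - n))) (heat_monom q m \<zeta>))"
      by (rule sum.mono_neutral_cong_right) auto
    also have "\<dots> = (\<Sum>m\<le>degree p. Polynomial.smult (of_real (coeff p m)) (heat_monom q (n + m) \<zeta>))"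
      by (rule sum.reindex_bij_witness[of _ "\<lambda>m. n + m" "\<lambda>m. m - n"]) auto
    finally show ?thesis .
  qed
  then have "of_real (exp (l * \<tau>) * \<tau> ^ Suc q) * poly (heat_poly q (monom 1 n * P) (of_real (\<tau>\<^sup>2 * l))) (of_real \<tau>) =
    of_real (exp (l * \<tau>) * \<tau> ^ Suc q * (\<Sum>m\<le>degree p. coeff p m * (\<tau> ^ (n + m) * F (n + m) / exp (l * \<tau>))))"
    by (simp only: poly_sum poly_smult heat_monom) simp
  also have "exp (l * \<tau>) * \<tau> ^ Suc q * (\<Sum>m\<le>degree p. coeff p m * (\<tau> ^ (n + m) * F (n + m) / exp (l * \<tau>))) =
    (\<Sum>m\<le>degree p. coeff p m * \<tau> ^ Suc (n + m + q) * F (n + m))"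
    by (simp add: sum_distrib_left power_add mult_ac)
  finally show ?thesis unfolding h_def[symmetric] P_def 1 by simp
qed

section \<open>Coinciding eigenvalues\<close>

lemma vdm_Suc_last: "vdm (Suc c) x = vdm c x * (\<Prod>i<c. x i - x c)"
proof -
  have e: "{(i, j). i < j \<and> j < Suc c} = {(i, j). i < j \<and> j < c} \<union> (\<lambda>i. (i, c)) ` {..<c}"
    by (auto simp: less_Suc_eq)
  have "vdm (Suc c) x = vdm c x * (\<Prod>(i, j)\<in>(\<lambda>i. (i, c)) ` {..<c}. x i - x j)"
    unfolding vdm_def e by (rule prod.union_disjoint) (auto simp: finite_pairs)
  also have "(\<Prod>(i, j)\<in>(\<lambda>i. (i, c)) ` {..<c}. x i - x j) = (\<Prod>i<c. x i - x c)"
    by (subst prod.reindex) (auto simp: inj_on_def)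
  finally show ?thesis .
qed

lemma vdm_cong: "(\<And>i. i < s \<Longrightarrow> x i = y i) \<Longrightarrow> vdm s x = vdm s y"
  unfolding vdm_def by (rule prod.cong) auto

lemma powser_limit_0:
  fixes a :: "nat \<Rightarrow> complex" and f :: "real \<Rightarrow> complex"
  assumes f: "\<And>e. 0 \<le> e \<Longrightarrow> (\<lambda>k. of_real e ^ k * a k) sums f e"
    and lim: "(f \<longlongrightarrow> c) (at_right 0)"
  shows "a 0 = c"
proof -
  have s: "summable (\<lambda>k. a k * 1 ^ k)"
    using sums_summable[OF f[of 1]] by (simp add: mult.commute)
  have "isCont (\<lambda>x. \<Sum>k. a k * x ^ k) (0 :: complex)"
    by (rule isCont_powser[OF s]) simp
  then have "((\<lambda>x. \<Sum>k. a k * x ^ k) \<longlongrightarrow> (\<Sum>k. a k * 0 ^ k)) (at (0 :: complex))"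
    by (simp add: isCont_def)
  moreover have "filterlim (\<lambda>e :: real. of_real e :: complex) (at 0) (at_right 0)"
    unfolding filterlim_at by (auto intro!: tendsto_eq_intros simp: eventually_at_filter)
  ultimately have "((\<lambda>e. \<Sum>k. a k * of_real e ^ k) \<longlongrightarrow> (\<Sum>k. a k * 0 ^ k)) (at_right (0 :: real))"
    by (rule filterlim_compose)
  moreover have "eventually (\<lambda>e. (\<Sum>k. a k * of_real e ^ k) = f e) (at_right (0 :: real))"
    by (rule eventually_at_rightI[of 0 1]) (use f in \<open>auto simp: sums_iff mult.commute\<close>)
  ultimately have "(f \<longlongrightarrow> (\<Sum>k. a k * 0 ^ k)) (at_right 0)"
    by (rule Lim_transform_eventually)
  then have "c = (\<Sum>k. a k * 0 ^ k)"
    by (rule tendsto_unique[OF trivial_limit_at_right_real lim])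
  then show ?thesis by simp
qed

text \<open>Only one-sided information is available: for e > 0 the sum is e^m K e, with K
  convergent. This forces the coefficients below m to vanish and identifies the m-th with the limit;
  each induction step removes one factor e.\<close>

lemma powser_coeff_limit:
  fixes a :: "nat \<Rightarrow> complex" and f :: "real \<Rightarrow> complex"
  assumes f: "\<And>e. 0 \<le> e \<Longrightarrow> (\<lambda>k. of_real e ^ k * a k) sums f e"
    and K: "\<And>e. 0 < e \<Longrightarrow> f e = of_real e ^ m * K e"
    and lim: "(K \<longlongrightarrow> c) (at_right 0)"
  shows "a m = c"
  using f K
proof (induction m arbitrary: a f)
  case (0 a f)
  have "(f \<longlongrightarrow> c) (at_right 0)"
    by (rule Lim_transform_eventually[OF lim], rule eventually_at_rightI[of 0 1]) (simp_all add: 0(2))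
  with 0(1) show ?case by (rule powser_limit_0)
next
  case (Suc m a f)
  have "((\<lambda>e. of_real e ^ Suc m * K e) \<longlongrightarrow> of_real 0 ^ Suc m * c) (at_right (0 :: real))"
    by (intro tendsto_intros lim)
  then have lim0: "(f \<longlongrightarrow> of_real 0 ^ Suc m * c) (at_right 0)"
    by (rule Lim_transform_eventually, intro eventually_at_rightI[of 0 1]) (simp_all add: Suc.prems(2))
  have a0: "a 0 = 0" using powser_limit_0[OF Suc.prems(1) lim0] by simp
  define g where "g e = (\<Sum>k. of_real e ^ k * a (Suc k))" for e
  show ?case
  proof (rule Suc.IH[of "\<lambda>k. a (Suc k)" g])
    fix e :: real assume e: "0 \<le> e"
    show s: "(\<lambda>k. of_real e ^ k * a (Suc k)) sums g e"
    proof (cases "e = 0")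
      case True
      have "(\<lambda>k. of_real e ^ k * a (Suc k)) sums a (Suc 0)"
        using powser_sums_zero[of "\<lambda>k. a (Suc k)"] by (simp add: True mult.commute)
      then show ?thesis by (simp add: g_def sums_iff)
    next
      case False
      have "summable (\<lambda>k. of_real e ^ Suc k * a (Suc k))"
        using Suc.prems(1)[OF e] by (subst summable_Suc_iff) (rule sums_summable)
      then have "summable (\<lambda>k. (1 / of_real e) * (of_real e ^ Suc k * a (Suc k)))"
        by (rule summable_mult)
      then show ?thesis unfolding g_def using False by (intro summable_sums) simp
    qed
  next
    fix e :: real assume e: "0 < e"
    have s: "(\<lambda>k. of_real e ^ Suc k * a (Suc k)) sums f e"
      using Suc.prems(1)[of e] e a0 by (subst sums_Suc_iff) simp
    have "g e = (1 / of_real e) * f e"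
      using sums_mult[OF s, of "1 / of_real e"] e by (simp add: g_def sums_iff)
    then show "g e = of_real e ^ m * K e" using Suc.prems(2)[OF e] e by simp
  qed
qed

text \<open>The cofactors of column \<open>c\<close> do not involve that column, so coefficients in
  a parameter of the column can be read off under the sum.\<close>

lemma det_column_expansion:
  fixes B :: "nat \<Rightarrow> nat \<Rightarrow> 'a :: comm_ring_1"
  assumes "c < s"
  shows "\<exists>C. \<forall>v. det (mat s s (\<lambda>(i, j). if j = c then v i else B i j)) = (\<Sum>i<s. v i * C i)"
proof -
  define A where "A v = mat s s (\<lambda>(i, j). if j = c then v i else B i j)" for v
  have "mat_delete (A v) i c = mat_delete (A (\<lambda>_. 0)) i c" for v i
    unfolding mat_delete_def A_def by (rule eq_matI) auto
  then have cof: "cofactor (A v) i c = cofactor (A (\<lambda>_. 0)) i c" for v i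
    unfolding cofactor_def by (rule arg_cong)
  have "det (A v) = (\<Sum>i<s. A v $$ (i, c) * cofactor (A v) i c)" for v
    by (rule laplace_expansion_column[OF _ assms]) (simp add: A_def)
  moreover have "A v $$ (i, c) = v i" if "i < s" for v i using that assms by (simp add: A_def)
  ultimately have "det (A v) = (\<Sum>i<s. v i * cofactor (A (\<lambda>_. 0)) i c)" for v
    by (simp add: cof[of v])
  then show ?thesis unfolding A_def by (intro exI allI)
qed

text \<open>Letting the coordinates with index \<open>\<ge> L\<close> tend to \<open>0\<close> one after the other replaces
  columns by Taylor coefficients.\<close>

lemma confluent_det:
  fixes G :: "nat \<Rightarrow> real \<Rightarrow> complex" and A :: "nat \<Rightarrow> nat \<Rightarrow> complex"
    and R :: "(nat \<Rightarrow> real) \<Rightarrow> complex"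
  assumes G: "\<And>i e. 0 \<le> e \<Longrightarrow> (\<lambda>k. of_real e ^ k * A i k) sums G i e"
    and R: "\<And>\<xi> c. continuous_on UNIV (\<lambda>e. R (\<xi>(c := e)))"
    and id: "\<And>\<xi>. (\<And>j. 0 \<le> \<xi> j) \<Longrightarrow> of_real (vdm s \<xi>) * R \<xi> = det (mat s s (\<lambda>(i, j). G i (\<xi> j)))"
    and L: "L \<le> s" and nn: "\<And>j. 0 \<le> \<xi> j" and z: "\<And>j. L \<le> j \<Longrightarrow> \<xi> j = 0"
  shows "of_real (vdm L \<xi> * (\<Prod>j<L. \<xi> j ^ (s - L))) * R \<xi> =
    det (mat s s (\<lambda>(i, j). if j < L then G i (\<xi> j) else A i (s - 1 - j)))"
  using L nn z
proof (induction "s - L" arbitrary: L \<xi>)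
  case 0
  then have "L = s" by simp
  moreover have "mat s s (\<lambda>(i, j). if j < s then G i (\<xi> j) else A i (s - 1 - j)) = mat s s (\<lambda>(i, j). G i (\<xi> j))"
    by (rule eq_matI) auto
  ultimately show ?case using id[of \<xi>] 0(3) by simp
next
  case (Suc m L \<xi>)
  then have Ls: "L < s" by simp
  have m: "m = s - Suc L" using Suc(2) by simp
  define B where "B i j = (if j < L then G i (\<xi> j) else A i (s - 1 - j))" for i j
  from det_column_expansion[OF Ls, of B] obtain C where
    "\<forall>v. det (mat s s (\<lambda>(i, j). if j = L then v i else B i j)) = (\<Sum>i<s. v i * C i)" ..
  note C = spec[OF this]
  \<comment> \<open>The left-hand side for L + 1, taken at the point with L-th coordinate e, with
    e^m split off. That power is the factor j = L of the product with exponent s - (L + 1), so m = s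
    - 1 - L, and this selects the Taylor coefficient that replaces column L.\<close>
  define K where "K e = of_real (vdm L \<xi> * (\<Prod>i<L. \<xi> i - e) * (\<Prod>j<L. \<xi> j ^ m)) * R (\<xi>(L := e))" for e
  have eq: "(\<Sum>i<s. G i e * C i) = of_real e ^ m * K e" if e: "0 < e" for e
  proof -
    let ?\<xi> = "\<xi>(L := e)"
    have "of_real (vdm (Suc L) ?\<xi> * (\<Prod>j<Suc L. ?\<xi> j ^ (s - Suc L))) * R ?\<xi> =
      det (mat s s (\<lambda>(i, j). if j < Suc L then G i (?\<xi> j) else A i (s - 1 - j)))"
      using Suc.prems Ls e by (intro Suc.hyps(1)[OF m]) auto
    also have "mat s s (\<lambda>(i, j). if j < Suc L then G i (?\<xi> j) else A i (s - 1 - j)) =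
      mat s s (\<lambda>(i, j). if j = L then G i e else B i j)"
      by (rule eq_matI) (auto simp: B_def)
    also have "det \<dots> = (\<Sum>i<s. G i e * C i)" by (rule C[of "\<lambda>i. G i e"])
    also have "vdm (Suc L) ?\<xi> = vdm L \<xi> * (\<Prod>i<L. \<xi> i - e)"
      unfolding vdm_Suc_last by (intro arg_cong2[where f = "(*)"] vdm_cong prod.cong) auto
    also have "(\<Prod>j<Suc L. ?\<xi> j ^ (s - Suc L)) = (\<Prod>j<L. \<xi> j ^ m) * e ^ m"
      by (simp add: m)
    finally have "(\<Sum>i<s. G i e * C i) =
      of_real ((vdm L \<xi> * (\<Prod>i<L. \<xi> i - e)) * ((\<Prod>j<L. \<xi> j ^ m) * e ^ m)) * R ?\<xi>" ..
    then show ?thesis by (simp only: K_def of_real_mult of_real_power mult_ac)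
  qed
  have lim: "(K \<longlongrightarrow> K 0) (at_right 0)"
  proof -
    have "continuous_on UNIV K"
      unfolding K_def by (intro continuous_intros R)
    then have "isCont K 0" by (simp add: continuous_on_eq_continuous_at)
    then show ?thesis unfolding isCont_def by (rule tendsto_mono[OF at_le, rotated]) simp
  qed
  have s: "(\<lambda>k. of_real e ^ k * (\<Sum>i<s. A i k * C i)) sums (\<Sum>i<s. G i e * C i)" if "0 \<le> e" for e
  proof -
    have "(\<lambda>k. \<Sum>i<s. (of_real e ^ k * A i k) * C i) sums (\<Sum>i<s. G i e * C i)"
      by (intro sums_sum sums_mult2 G that)
    then show ?thesis by (simp add: sum_distrib_left mult.assoc)
  qed
  have "(\<Sum>i<s. A i m * C i) = K 0"
    by (rule powser_coeff_limit[where a = "\<lambda>k. \<Sum>i<s. A i k * C i", OF s eq lim])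
  then have "K 0 = det (mat s s (\<lambda>(i, j). if j = L then A i m else B i j))"
    using C[of "\<lambda>i. A i m"] by (rule trans[OF sym sym])
  also have "mat s s (\<lambda>(i, j). if j = L then A i m else B i j) =
    mat s s (\<lambda>(i, j). if j < L then G i (\<xi> j) else A i (s - 1 - j))"
    by (rule eq_matI) (auto simp: B_def m)
  also have "K 0 = of_real (vdm L \<xi> * (\<Prod>j<L. \<xi> j ^ (s - L))) * R \<xi>"
  proof -
    have "\<xi>(L := 0) = \<xi>" using Suc.prems(3)[of L] by auto
    \<comment> \<open>At e = 0 the new Vandermonde factors \<open>\<xi> i - e\<close> become
      \<open>\<xi> i\<close> and raise the exponent from m to s - L.\<close>
    moreover have "(\<Prod>j<L. \<xi> j) * (\<Prod>j<L. \<xi> j ^ m) = (\<Prod>j<L. \<xi> j ^ (s - L))"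
      unfolding prod.distrib[symmetric] power_Suc[symmetric] Suc(2) ..
    ultimately show ?thesis by (simp only: K_def diff_zero mult.assoc)
  qed
  finally show ?case .
qed

lemma continuous_fun_upd: "continuous_on UNIV (\<lambda>e :: real. (\<xi>(c := e)) j)"
  by (cases "j = c") auto

lemma continuous_heat_exp_words:
  fixes \<tau> :: real
  shows "continuous_on UNIV (\<lambda>e. heat_exp_words q N (of_real \<tau>) cs (\<lambda>n. powsum s n (\<lambda>j. of_real (\<tau>\<^sup>2 * (\<xi>(c := e)) j))))"
proof -
  have 1: "continuous_on UNIV (\<lambda>e. powsum s n (\<lambda>j. of_real (\<tau>\<^sup>2 * (\<xi>(c := e)) j)))" for n
    unfolding powsum_def by (intro continuous_intros continuous_fun_upd)
  have 2: "continuous_on UNIV (\<lambda>e. (\<Prod>n\<leftarrow>w. p e n))" if "\<And>n. continuous_on UNIV (\<lambda>e :: real. p e n :: complex)" for w p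
    by (induction w) (auto intro!: continuous_intros that)
  have 3: "continuous_on UNIV (\<lambda>e. eval_words (p e) cs)" if "\<And>n. continuous_on UNIV (\<lambda>e :: real. p e n)" for p cs
    by (induction cs) (auto intro!: continuous_intros 2 that)
  show ?thesis unfolding heat_exp_words_def by (intro continuous_intros 3 1)
qed

text \<open>The target matrix before column scaling. A column j \<ge> L is the Taylor coefficient of
  order s - 1 - j at 0 of the generic column, as read off from \<open>kint_sums\<close>.\<close>

definition psi_mat :: "nat \<Rightarrow> nat \<Rightarrow> nat \<Rightarrow> (nat \<Rightarrow> real) \<Rightarrow> (real \<Rightarrow> real) \<Rightarrow> real mat" where
  "psi_mat q s L \<xi> h = mat s s (\<lambda>(i, j). if j < L then kint q (\<xi> j) (s - 1 - i + q) h
     else wint (s - 1 - i + q + (s - 1 - j)) h / (fact (s - 1 - j) * fact (s - 1 - j + q)))"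

lemma det_of_real: "det (map_mat of_real A) = (of_real (det A) :: complex)"
  by (simp add: of_real_hom.hom_det)

text \<open>Turns the determinant of heat evolutions into kernel integrals, with s - L eigenvalues
  equal to zero. The powers of \<tau> and the exponential are the factors that
  \<open>kint_heat_poly\<close> attaches to the columns, together with the rescaling of the
  Vandermonde product.\<close>

lemma heat_exp_words_confluent:
  fixes p :: "real poly" and \<theta> \<tau> :: real
  assumes cs: "\<And>x. eval_words (\<lambda>n. powsum s n x) cs = (\<Prod>j<s. poly (map_poly of_real p) (x j))"
    and N: "s * (s + degree p) \<le> N"
    and \<theta>: "0 < \<theta>" and \<tau>: "\<tau> = 1 / (1 + \<theta>)"
    and L: "L \<le> s" and nn: "\<And>j. 0 \<le> \<xi> j" and z: "\<And>j. L \<le> j \<Longrightarrow> \<xi> j = 0"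
  shows "of_real (vdm L \<xi> * (\<Prod>j<L. \<xi> j ^ (s - L)) * (\<tau> ^ (s * (s + q)) * exp (\<tau> * (\<Sum>j<s. \<xi> j)))) *
      heat_exp_words q N (of_real \<tau>) cs (\<lambda>n. powsum s n (\<lambda>j. of_real (\<tau>\<^sup>2 * \<xi> j))) =
    of_real (det (psi_mat q s L \<xi> (\<lambda>w. poly p w * exp (- \<theta> * w))))"
proof -
  define h where "h w = poly p w * exp (- \<theta> * w)" for w
  obtain B where B: "\<And>w. w \<ge> 0 \<Longrightarrow> \<bar>h w\<bar> \<le> B" using exp_poly_bounded[OF \<theta>, of p] unfolding h_def by blast
  have hm: "h \<in> borel_measurable borel" unfolding h_def[abs_def] poly_altdef by measurable
  have \<tau>0: "\<tau> > 0" using \<theta> \<tau> by simp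
  define U where "U \<xi> = heat_exp_words q N (of_real \<tau>) cs (\<lambda>n. powsum s n (\<lambda>j. of_real (\<tau>\<^sup>2 * \<xi> j)))" for \<xi>
  define R where "R \<xi> = of_real (\<tau> ^ (s * (s + q)) * exp (\<tau> * (\<Sum>j<s. \<xi> j))) * U \<xi>" for \<xi>
  define A where "A i k = (of_real (wint (s - 1 - i + q + k) h / (fact k * fact (k + q))) :: complex)" for i k
  define G where "G i e = (of_real (kint q e (s - 1 - i + q) h) :: complex)" for i e
  have "of_real (vdm L \<xi> * (\<Prod>j<L. \<xi> j ^ (s - L))) * R \<xi> =
    det (mat s s (\<lambda>(i, j). if j < L then G i (\<xi> j) else A i (s - 1 - j)))"
  proof (rule confluent_det[OF _ _ _ L nn z])
    fix i and e :: real assume e: "0 \<le> e"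
    have "(\<lambda>k. of_real (e ^ k * (wint (s - 1 - i + q + k) h / (fact k * fact (k + q))))) sums G i e"
      unfolding G_def by (intro sums_of_real kint_sums[OF hm B e])
    then show "(\<lambda>k. of_real e ^ k * A i k) sums G i e" by (simp add: A_def)
  next
    fix \<xi> c
    show "continuous_on UNIV (\<lambda>e. R (\<xi>(c := e)))"
      unfolding R_def U_def
      by (intro continuous_intros continuous_heat_exp_words continuous_fun_upd)
  next
    fix \<xi> :: "nat \<Rightarrow> real" assume nn: "\<And>j. 0 \<le> \<xi> j"
    let ?H = "\<lambda>i j. poly (heat_poly q (monom 1 (s - 1 - i) * map_poly of_real p) (of_real (\<tau>\<^sup>2 * \<xi> j))) (of_real \<tau>)"
    let ?c = "\<lambda>j. of_real (exp (\<xi> j * \<tau>) * \<tau> ^ Suc q) :: complex"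
    have d: "degree (map_poly of_real p :: complex poly) = degree p"
      by (simp add: degree_map_poly)
    \<comment> \<open>Each of the s (s - 1) / 2 differences contributes a factor \<tau>^2.\<close>
    have V: "vdm s (\<lambda>j. of_real (\<tau>\<^sup>2 * \<xi> j)) = (of_real (\<tau> ^ (s * (s - 1)) * vdm s \<xi>) :: complex)"
    proof -
      have "vdm s (\<lambda>j. c * x j) = c ^ (s * (s - 1) div 2) * vdm s x" for c :: complex and x
      proof (induction s arbitrary: x)
        case (Suc s)
        have "(\<Prod>j<s. c * x 0 - c * x (Suc j)) = c ^ s * (\<Prod>j<s. x 0 - x (Suc j))"
          by (simp add: prod.distrib flip: right_diff_distrib)
        moreover have "Suc s * s div 2 = s + s * (s - 1) div 2"
          by (cases s) (auto simp: algebra_simps)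
        ultimately show ?case by (simp add: vdm_Suc Suc power_add)
      qed (simp add: vdm_def)
      from this[of "of_real (\<tau>\<^sup>2)" "\<lambda>j. of_real (\<xi> j)"]
      have "vdm s (\<lambda>j. of_real (\<tau>\<^sup>2 * \<xi> j)) = (of_real (\<tau>\<^sup>2) ^ (s * (s - 1) div 2) * vdm s (\<lambda>j. of_real (\<xi> j)) :: complex)"
        by simp
      also have "of_real (\<tau>\<^sup>2) ^ (s * (s - 1) div 2) = (of_real (\<tau> ^ (s * (s - 1))) :: complex)"
      proof -
        have "2 * (s * (s - 1) div 2) = s * (s - 1)"
          by (rule dvd_mult_div_cancel) auto
        then show ?thesis by (simp only: of_real_power power_mult[symmetric])
      qed
      also have "vdm s (\<lambda>j. of_real (\<xi> j)) = (of_real (vdm s \<xi>) :: complex)"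
        by (simp add: vdm_def case_prod_unfold)
      finally show ?thesis by simp
    qed
    have "G i (\<xi> j) = ?c j * ?H i j" for i j
      unfolding G_def h_def by (rule kint_heat_poly[OF \<theta> \<tau> nn])
    then have "det (mat s s (\<lambda>(i, j). G i (\<xi> j))) = det (mat s s (\<lambda>(i, j). ?c j * ?H i j))" by simp
    also have "\<dots> = (\<Prod>j<s. ?c j) * det (mat s s (\<lambda>(i, j). ?H i j))"
      by (subst (1 2) det_col[of _ s])
        (auto simp: permutes_in_image prod.distrib sum_distrib_left mult_ac simp del: of_real_mult of_real_power
          intro!: sum.cong prod.cong arg_cong2[where f = "(*)"])
    also have "det (mat s s (\<lambda>(i, j). ?H i j)) = of_real (\<tau> ^ (s * (s - 1)) * vdm s \<xi>) * U \<xi>"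
      using heat_exp_words_det[OF cs, of N "\<lambda>j. of_real (\<tau>\<^sup>2 * \<xi> j)" q "of_real \<tau>"] N d
      unfolding V U_def by simp
    also have "(\<Prod>j<s. ?c j) = of_real (exp (\<tau> * (\<Sum>j<s. \<xi> j)) * \<tau> ^ (s * Suc q))"
    proof -
      have "(\<Prod>j<s. exp (\<xi> j * \<tau>) * \<tau> ^ Suc q) = exp (\<Sum>j<s. \<xi> j * \<tau>) * (\<tau> ^ Suc q) ^ s"
        by (simp only: prod.distrib prod_constant card_lessThan exp_sum[OF finite_lessThan])
      also have "\<dots> = exp (\<tau> * (\<Sum>j<s. \<xi> j)) * \<tau> ^ (s * Suc q)"
        by (simp only: sum_distrib_left power_mult[symmetric] mult.commute)
      finally show ?thesis by (simp only: of_real_prod[symmetric])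
    qed
    finally have "det (mat s s (\<lambda>(i, j). G i (\<xi> j))) = of_real (vdm s \<xi>) *
      (of_real (\<tau> ^ (s * Suc q) * \<tau> ^ (s * (s - 1)) * exp (\<tau> * (\<Sum>j<s. \<xi> j))) * U \<xi>)"
      by (simp add: mult_ac)
    \<comment> \<open>Column factors and Vandermonde scaling add up to the exponent s (s + q), the
      number of matrix entries. The same power comes out of the tilted densities, one \<tau> per
      entry.\<close>
    also have "\<tau> ^ (s * Suc q) * \<tau> ^ (s * (s - 1)) = \<tau> ^ (s * (s + q))"
    proof -
      have "s * Suc q + s * (s - 1) = s * (s + q)" by (cases s) (auto simp: algebra_simps)
      then show ?thesis by (simp only: power_add[symmetric])
    qed
    finally show "of_real (vdm s \<xi>) * R \<xi> = det (mat s s (\<lambda>(i, j). G i (\<xi> j)))"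
      by (simp only: R_def)
  qed
  also have "mat s s (\<lambda>(i, j). if j < L then G i (\<xi> j) else A i (s - 1 - j)) = map_mat of_real (psi_mat q s L \<xi> h)"
    by (rule eq_matI) (auto simp: psi_mat_def G_def A_def)
  finally show ?thesis
    unfolding det_of_real h_def[symmetric] R_def U_def by (simp only: of_real_mult mult.assoc)
qed

section \<open>The spectrum of a Gram matrix\<close>

lemma mat_mult_index:
  assumes "A \<in> carrier_mat n m" "B \<in> carrier_mat m l" "i < n" "k < l"
  shows "(A * B) $$ (i, k) = (\<Sum>j<m. A $$ (i, j) * B $$ (j, k))"
  using assms by (auto simp: scalar_prod_def atLeast0LessThan)

lemma mat_vec_index:
  assumes "A \<in> carrier_mat n m" "v \<in> carrier_vec m" "i < n"
  shows "(A *\<^sub>v v) $ i = (\<Sum>k<m. A $$ (i, k) * v $ k)"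
  using assms by (auto simp: scalar_prod_def atLeast0LessThan)

lemma mat_diag_sum_comm:
  fixes P B :: "'a :: comm_semiring_0 mat"
  assumes "P \<in> carrier_mat n n" "B \<in> carrier_mat n n"
  shows "(\<Sum>i<n. (P * B) $$ (i, i)) = (\<Sum>i<n. (B * P) $$ (i, i))"
proof -
  have "(\<Sum>i<n. (P * B) $$ (i, i)) = (\<Sum>i<n. \<Sum>k<n. P $$ (i, k) * B $$ (k, i))"
    using assms by (intro sum.cong refl) (auto simp: scalar_prod_def atLeast0LessThan)
  also have "\<dots> = (\<Sum>k<n. \<Sum>i<n. B $$ (k, i) * P $$ (i, k))"
    by (subst sum.swap) (simp add: mult.commute)
  also have "\<dots> = (\<Sum>i<n. (B * P) $$ (i, i))"
    using assms by (intro sum.cong refl) (auto simp: scalar_prod_def atLeast0LessThan)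
  finally show ?thesis .
qed

lemma upper_triangular_pow:
  fixes B :: "'a :: comm_semiring_1 mat"
  assumes B: "B \<in> carrier_mat n n" and u: "upper_triangular B"
  shows "upper_triangular (B ^\<^sub>m k) \<and> (\<forall>i<n. (B ^\<^sub>m k) $$ (i, i) = (B $$ (i, i)) ^ k)"
proof (induction k)
  case 0
  then show ?case using B by (auto simp: upper_triangular_def)
next
  case (Suc k)
  have C: "B ^\<^sub>m k \<in> carrier_mat n n" using B by simp
  have e: "(B ^\<^sub>m Suc k) $$ (i, j) = (\<Sum>l<n. (B ^\<^sub>m k) $$ (i, l) * B $$ (l, j))" if "i < n" "j < n" for i j
    using that B C by (auto simp: scalar_prod_def atLeast0LessThan)
  have z: "(B ^\<^sub>m k) $$ (i, l) * B $$ (l, j) = 0" if "i < n" "l < n" "j < n" "l < i \<or> j < l" for i j l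
    using that Suc u B C by (auto simp: upper_triangular_def)
  have "(B ^\<^sub>m Suc k) $$ (i, j) = 0" if "j < i" "i < n" for i j
    using that by (subst e) (auto intro!: sum.neutral z)
  moreover have "(B ^\<^sub>m Suc k) $$ (i, i) = (B $$ (i, i)) ^ Suc k" if "i < n" for i
  proof -
    have "(B ^\<^sub>m Suc k) $$ (i, i) = (\<Sum>l<n. if l = i then (B ^\<^sub>m k) $$ (i, i) * B $$ (i, i) else 0)"
      unfolding e[OF that that] using that by (intro sum.cong refl) (auto intro!: z)
    then show ?thesis using that Suc by (simp add: mult.commute)
  qed
  ultimately show ?case using B by (auto simp: upper_triangular_def simp del: pow_mat.simps)
qed

text \<open>A Schur decomposition puts \<open>es\<close> on the diagonal of a triangular matrix,
  whose powers have the powers of \<open>es\<close> there; traces are invariant under similarity.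
  Multiplicities are respected without diagonalising.\<close>

lemma diag_sum_pow_char_poly:
  fixes A :: "complex mat"
  assumes A: "A \<in> carrier_mat n n" and c: "char_poly A = (\<Prod>a\<leftarrow>es. [:- a, 1:])"
  shows "length es = n" and "(\<Sum>i<n. (A ^\<^sub>m k) $$ (i, i)) = (\<Sum>j<n. (es ! j) ^ k)"
proof -
  obtain B P Q where BPQ: "schur_decomposition A es = (B, P, Q)"
    by (cases "schur_decomposition A es") auto
  from schur_decomposition[OF A c this] have sim: "similar_mat_wit A B P Q"
    and u: "upper_triangular B" and d: "diag_mat B = es" by auto
  note D = similar_mat_witD2[OF A sim]
  have "dim_row B = n" using D(5) by simp
  then show len: "length es = n" unfolding d[symmetric] by (simp add: diag_mat_def)
  have es: "es ! j = B $$ (j, j)" if "j < n" for j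
    unfolding d[symmetric] using that D(5) by (simp add: diag_mat_def)
  have Bk: "B ^\<^sub>m k \<in> carrier_mat n n" using D(5) by simp
  have "(\<Sum>i<n. (A ^\<^sub>m k) $$ (i, i)) = (\<Sum>i<n. (P * (B ^\<^sub>m k) * Q) $$ (i, i))"
    by (simp only: similar_mat_wit_pow_id[OF sim])
  also have "\<dots> = (\<Sum>i<n. (Q * (P * B ^\<^sub>m k)) $$ (i, i))"
    using D(6,7) Bk by (intro mat_diag_sum_comm) auto
  also have "Q * (P * B ^\<^sub>m k) = (Q * P) * B ^\<^sub>m k"
    using D(6,7) Bk by (intro assoc_mult_mat[symmetric]) auto
  also have "\<dots> = B ^\<^sub>m k" unfolding D(2) by (rule left_mult_one_mat[OF Bk])
  also have "(\<Sum>i<n. (B ^\<^sub>m k) $$ (i, i)) = (\<Sum>j<n. (es ! j) ^ k)"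
    using upper_triangular_pow[OF D(5) u, of k] by (intro sum.cong refl) (auto simp: es)
  finally show "(\<Sum>i<n. (A ^\<^sub>m k) $$ (i, i)) = (\<Sum>j<n. (es ! j) ^ k)" .
qed

lemma mat_adjoint_index:
  fixes A :: "complex mat"
  assumes "A \<in> carrier_mat s t" "i < t" "j < s"
  shows "mat_adjoint A $$ (i, j) = cnj (A $$ (j, i))"
  using assms by (simp add: mat_adjoint_def mat_of_rows_def)

lemma mat_adjoint_carrier:
  "A \<in> carrier_mat s t \<Longrightarrow> mat_adjoint A \<in> carrier_mat t s"
  by (auto simp: mat_adjoint_def)

lemma gram_index:
  fixes A :: "complex mat"
  assumes "A \<in> carrier_mat s t" "i < s" "k < s"
  shows "(A * mat_adjoint A) $$ (i, k) = (\<Sum>j<t. A $$ (i, j) * cnj (A $$ (k, j)))"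
  using assms mat_adjoint_carrier[OF assms(1)]
  by (auto simp: scalar_prod_def atLeast0LessThan mat_adjoint_index[OF assms(1)] intro!: sum.cong)

lemma gramTr_eq_diag_sum:
  fixes A :: "complex mat"
  assumes A: "A \<in> carrier_mat s t"
  shows "gramTr s t n (rvar (\<lambda>v. A $$ v)) = (\<Sum>i<s. ((A * mat_adjoint A) ^\<^sub>m n) $$ (i, i))"
proof -
  have S: "A * mat_adjoint A \<in> carrier_mat s s"
    using A mat_adjoint_carrier[OF A] by auto
  have g: "gramS t (rvar (\<lambda>v. A $$ v)) i k = (A * mat_adjoint A) $$ (i, k)" if "i < s" "k < s" for i k
    using that by (simp add: gramS_def rvar_def gram_index[OF A])
  have "gramP s t n (rvar (\<lambda>v. A $$ v)) i k = ((A * mat_adjoint A) ^\<^sub>m n) $$ (i, k)" if "i < s" "k < s" for i k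
    using that(2)
  proof (induction n arbitrary: k)
    case 0
    then show ?case using A that(1) by auto
  next
    case (Suc n)
    have "((A * mat_adjoint A) ^\<^sub>m Suc n) $$ (i, k) =
      (\<Sum>l<s. ((A * mat_adjoint A) ^\<^sub>m n) $$ (i, l) * (A * mat_adjoint A) $$ (l, k))"
      unfolding pow_mat.simps by (rule mat_mult_index[OF pow_carrier_mat[OF S] S that(1) Suc.prems])
    then show ?case using Suc that(1) by (simp add: g)
  qed
  then show ?thesis by (simp add: gramTr_def)
qed

text \<open>For an eigenvector v, z times the squared length of v is the squared length of the
  adjoint of A applied to v.\<close>

lemma gram_eigenvalue_nonneg:
  fixes A :: "complex mat"
  assumes A: "A \<in> carrier_mat s t" and z: "eigenvalue (A * mat_adjoint A) z"
  shows "\<exists>r\<ge>0. z = of_real r"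
proof -
  let ?S = "A * mat_adjoint A"
  have S: "?S \<in> carrier_mat s s"
    using A mat_adjoint_carrier[OF A] by auto
  obtain v where v: "v \<in> carrier_vec s" "v \<noteq> 0\<^sub>v s" "?S *\<^sub>v v = z \<cdot>\<^sub>v v"
    using z A unfolding eigenvalue_def eigenvector_def by auto
  define n where "n = (\<Sum>i<s. (cmod (v $ i))\<^sup>2)"
  define y where "y j = (\<Sum>k<s. cnj (A $$ (k, j)) * v $ k)" for j
  have Sv: "(\<Sum>k<s. ?S $$ (i, k) * v $ k) = z * v $ i" if "i < s" for i
  proof -
    have "(?S *\<^sub>v v) $ i = (\<Sum>k<s. ?S $$ (i, k) * v $ k)"
      by (rule mat_vec_index[OF S v(1) that])
    then show ?thesis using v that by simp
  qed
  have n0: "n > 0"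
  proof -
    have "\<exists>i<s. v $ i \<noteq> 0" using v(1,2) by auto
    then obtain i where "i < s" "v $ i \<noteq> 0" by blast
    then show ?thesis unfolding n_def by (intro sum_pos2[of _ i]) auto
  qed
  have "z * of_real n = (\<Sum>i<s. cnj (v $ i) * (z * v $ i))"
    unfolding n_def of_real_sum sum_distrib_left complex_norm_square
    by (intro sum.cong refl) (simp add: mult_ac)
  also have "\<dots> = (\<Sum>i<s. cnj (v $ i) * (\<Sum>k<s. ?S $$ (i, k) * v $ k))"
    by (intro sum.cong refl) (simp add: Sv)
  also have "\<dots> = (\<Sum>i<s. \<Sum>k<s. \<Sum>j<t. cnj (v $ i) * A $$ (i, j) * (cnj (A $$ (k, j)) * v $ k))"
    by (intro sum.cong refl) (simp add: gram_index[OF A] sum_distrib_left sum_distrib_right mult_ac)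
  also have "\<dots> = (\<Sum>i<s. \<Sum>j<t. \<Sum>k<s. cnj (v $ i) * A $$ (i, j) * (cnj (A $$ (k, j)) * v $ k))"
    by (intro sum.cong refl sum.swap)
  also have "\<dots> = (\<Sum>i<s. \<Sum>j<t. cnj (v $ i) * A $$ (i, j) * y j)"
    by (simp add: y_def sum_distrib_left)
  also have "\<dots> = (\<Sum>j<t. (\<Sum>i<s. cnj (v $ i) * A $$ (i, j)) * y j)"
    by (subst sum.swap) (simp add: sum_distrib_right)
  also have "\<dots> = (\<Sum>j<t. of_real ((cmod (y j))\<^sup>2))"
  proof (intro sum.cong refl)
    fix j
    have "(\<Sum>i<s. cnj (v $ i) * A $$ (i, j)) = cnj (y j)"
      by (simp add: y_def mult.commute)
    then show "(\<Sum>i<s. cnj (v $ i) * A $$ (i, j)) * y j = of_real ((cmod (y j))\<^sup>2)"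
      by (simp only: complex_norm_square mult.commute)
  qed
  finally have "z * of_real n = of_real (\<Sum>j<t. (cmod (y j))\<^sup>2)" by simp
  then have "z = of_real ((\<Sum>j<t. (cmod (y j))\<^sup>2) / n)"
    using n0 by (simp add: field_simps)
  moreover have "(\<Sum>j<t. (cmod (y j))\<^sup>2) / n \<ge> 0"
    using n0 by (intro divide_nonneg_pos sum_nonneg) auto
  ultimately show ?thesis by blast
qed

text \<open>The witness lists the eigenvalues with multiplicity. It is used only through power sums
  and the minimum, so any order will do.\<close>

lemma gram_spectrum:
  fixes A :: "complex mat"
  assumes A: "A \<in> carrier_mat s t" and s: "1 \<le> s"
  shows "\<exists>w. (\<forall>j. 0 \<le> w j) \<and> (\<forall>n. gramTr s t n (rvar (\<lambda>v. A $$ v)) = powsum s n (\<lambda>j. of_real (w j))) \<and>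
    (\<forall>x. x < smallest_eigenvalue (A * mat_adjoint A) \<longleftrightarrow> (\<forall>j<s. x < w j))"
proof -
  let ?S = "A * mat_adjoint A"
  have S: "?S \<in> carrier_mat s s"
    using A mat_adjoint_carrier[OF A] by auto
  obtain es where c: "char_poly ?S = (\<Prod>a\<leftarrow>es. [:- a, 1:])"
    using char_poly_factorized[OF S] by blast
  note len = diag_sum_pow_char_poly(1)[OF S c]
  have ev: "eigenvalue ?S z \<longleftrightarrow> z \<in> set es" for z
    unfolding eigenvalue_root_char_poly[OF S] c poly_prod_list
    by (auto simp: prod_list_zero_iff image_iff)
  \<comment> \<open>The value 0 beyond \<open>s\<close> makes nonnegativity hold for every
    index.\<close>
  define w where "w j = (if j < s then Re (es ! j) else 0)" for j
  have nn: "0 \<le> w j \<and> (j < s \<longrightarrow> es ! j = of_real (w j))" for j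
  proof (cases "j < s")
    case True
    then have "es ! j \<in> set es" using len by simp
    then obtain r where "r \<ge> 0" "es ! j = of_real r"
      using gram_eigenvalue_nonneg[OF A] ev by blast
    then show ?thesis using True by (simp add: w_def)
  qed (simp add: w_def)
  have 1: "gramTr s t n (rvar (\<lambda>v. A $$ v)) = powsum s n (\<lambda>j. of_real (w j))" for n
    unfolding gramTr_eq_diag_sum[OF A] diag_sum_pow_char_poly(2)[OF S c] powsum_def
    using nn by (intro sum.cong refl) simp
  have e: "{Re z | z. eigenvalue ?S z} = w ` {..<s}"
  proof -
    have "{Re z | z. eigenvalue ?S z} = Re ` set es" by (auto simp: ev)
    also have "set es = (!) es ` {..<s}" using len by (auto simp: set_conv_nth)
    finally show ?thesis by (auto simp: image_image w_def)
  qed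
  have 2: "x < smallest_eigenvalue ?S \<longleftrightarrow> (\<forall>j<s. x < w j)" for x
    unfolding smallest_eigenvalue_def e using s by (subst Min_gr_iff) (auto simp: lessThan_empty_iff)
  show ?thesis using nn 1 2 by blast
qed

section \<open>From polynomials to indicators\<close>

lemma gramTr_cong:
  assumes "\<And>i j. i < s \<Longrightarrow> j < t \<Longrightarrow> x (Inl (i, j)) = y (Inl (i, j)) \<and> x (Inr (i, j)) = y (Inr (i, j))"
  shows "gramTr s t n x = gramTr s t n y"
proof -
  have S: "gramS t x i k = gramS t y i k" if "i < s" "k < s" for i k
    unfolding gramS_def using assms that by (intro sum.cong) auto
  have "gramP s t n x i k = gramP s t n y i k" if "i < s" "k < s" for i k
    using that(2) by (induction n arbitrary: k) (auto simp: S intro!: sum.cong)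
  then show ?thesis unfolding gramTr_def by (intro sum.cong) auto
qed

lemma gramTr_scale:
  "gramTr s t n (rvar (\<lambda>v. of_real c * \<mu> v)) = of_real (c\<^sup>2) ^ n * gramTr s t n (rvar \<mu>)"
proof -
  have S: "gramS t (rvar (\<lambda>v. of_real c * \<mu> v)) i k = of_real (c\<^sup>2) * gramS t (rvar \<mu>) i k" for i k
    by (simp add: gramS_def rvar_def sum_distrib_left power2_eq_square mult_ac)
  have "gramP s t n (rvar (\<lambda>v. of_real c * \<mu> v)) i k = of_real (c\<^sup>2) ^ n * gramP s t n (rvar \<mu>) i k" for i k
    by (induction n arbitrary: k) (simp_all add: S sum_distrib_left mult_ac)
  then show ?thesis by (simp add: gramTr_def sum_distrib_left)
qed

lemma gramTr_1: "gramTr s t 1 (rvar \<mu>) = of_real (\<Sum>v\<in>{..<s} \<times> {..<t}. (cmod (\<mu> v))\<^sup>2)"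
proof -
  have "gramP s t 1 (rvar \<mu>) i i = (\<Sum>j<t. of_real ((cmod (\<mu> (i, j)))\<^sup>2))" if "i < s" for i
  proof -
    have "gramP s t 1 (rvar \<mu>) i i = (\<Sum>l<s. if l = i then gramS t (rvar \<mu>) i i else 0)"
      unfolding One_nat_def gramP.simps by (intro sum.cong refl) auto
    also have "\<dots> = gramS t (rvar \<mu>) i i" using that by simp
    finally show ?thesis unfolding gramS_def rvar_def complex_norm_square by simp
  qed
  then have "gramTr s t 1 (rvar \<mu>) = (\<Sum>i<s. \<Sum>j<t. of_real ((cmod (\<mu> (i, j)))\<^sup>2))"
    unfolding gramTr_def by (intro sum.cong) auto
  then show ?thesis by (simp add: sum.cartesian_product case_prod_unfold)
qed

lemma tendsto_det:
  fixes A :: "nat \<Rightarrow> nat \<Rightarrow> nat \<Rightarrow> real"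
  assumes "\<And>i j. i < s \<Longrightarrow> j < s \<Longrightarrow> (\<lambda>n. A n i j) \<longlonglongrightarrow> B i j"
  shows "(\<lambda>n. det (mat s s (\<lambda>(i, j). A n i j))) \<longlonglongrightarrow> det (mat s s (\<lambda>(i, j). B i j))"
proof -
  have e: "det (mat s s (\<lambda>(i, j). C i j)) = (\<Sum>p | p permutes {0..<s}. signof p * (\<Prod>j<s. C (p j) j))" for C :: "nat \<Rightarrow> nat \<Rightarrow> real"
    by (subst det_col[of _ s])
      (auto simp: permutes_in_image intro!: sum.cong prod.cong arg_cong2[where f = "(*)"])
  show ?thesis unfolding e
    by (intro tendsto_sum tendsto_mult tendsto_const tendsto_prod assms) (auto simp: permutes_in_image)
qed

lemma wint_limit:
  fixes h :: "nat \<Rightarrow> real \<Rightarrow> real"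
  assumes m: "\<And>n. h n \<in> borel_measurable borel"
    and b: "\<And>n w. 0 \<le> w \<Longrightarrow> \<bar>h n w\<bar> \<le> B"
    and l: "\<And>w. 0 \<le> w \<Longrightarrow> (\<lambda>n. h n w) \<longlonglongrightarrow> h' w"
    and h': "h' \<in> borel_measurable borel"
  shows "(\<lambda>n. wint k (h n)) \<longlonglongrightarrow> wint k h'"
    and "0 \<le> e \<Longrightarrow> (\<lambda>n. kint q e (k + q) (h n)) \<longlonglongrightarrow> kint q e (k + q) h'"
proof -
  have B: "0 \<le> B" using b[of 0 0] by linarith
  show "(\<lambda>n. wint k (h n)) \<longlonglongrightarrow> wint k h'"
    unfolding wint_def
  proof (rule integral_dominated_convergence[where w = "\<lambda>w. indicator {0..} w * (w ^ k * exp (- w) * B)"])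
    show "integrable lborel (\<lambda>w. indicator {0..} w * (w ^ k * exp (- w) * B))"
      using B by (intro wint_integrable) auto
    show "AE w in lborel. (\<lambda>n. indicator {0..} w * (w ^ k * exp (- w) * h n w)) \<longlonglongrightarrow> indicator {0..} w * (w ^ k * exp (- w) * h' w)"
      using l by (intro AE_I2) (auto simp: indicator_def intro!: tendsto_intros)
    show "AE w in lborel. norm (indicator {0..} w * (w ^ k * exp (- w) * h n w)) \<le> indicator {0..} w * (w ^ k * exp (- w) * B)" for n
      using b by (intro AE_I2) (auto simp: indicator_def abs_mult intro!: mult_left_mono)
  qed (use m h' in measurable)
  assume e: "0 \<le> e"
  have nu: "0 \<le> nu0 q (e * w)" if "0 \<le> w" for w
    unfolding nu0_def using that e by (intro suminf_nonneg nu0_summable) auto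
  show "(\<lambda>n. kint q e (k + q) (h n)) \<longlonglongrightarrow> kint q e (k + q) h'"
    unfolding kint_def wint_def
  proof (rule integral_dominated_convergence[where w = "\<lambda>w. indicator {0..} w * (w ^ (k + q) * exp (- w) * (nu0 q (e * w) * B))"])
    show "integrable lborel (\<lambda>w. indicator {0..} w * (w ^ (k + q) * exp (- w) * (nu0 q (e * w) * B)))"
      using B e by (intro kint_sums_aux(2)[where B = B]) auto
    show "AE w in lborel. (\<lambda>n. indicator {0..} w * (w ^ (k + q) * exp (- w) * (nu0 q (e * w) * h n w))) \<longlonglongrightarrow>
        indicator {0..} w * (w ^ (k + q) * exp (- w) * (nu0 q (e * w) * h' w))"
      using l by (intro AE_I2) (auto simp: indicator_def intro!: tendsto_intros)
    show "AE w in lborel. norm (indicator {0..} w * (w ^ (k + q) * exp (- w) * (nu0 q (e * w) * h n w))) \<le>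
        indicator {0..} w * (w ^ (k + q) * exp (- w) * (nu0 q (e * w) * B))" for n
      using b nu by (intro AE_I2) (auto simp: indicator_def abs_mult mult.assoc intro!: mult_left_mono mult_nonneg_nonneg)
  qed (use m h' in measurable)
qed

text \<open>The matrix of means enters through the power sums of its Gram eigenvalues
  \<open>\<xi>\<close>, counted from 0 and padded with zeros from \<open>L\<close> on. The column
  count is written \<open>q + s\<close>, so \<open>q\<close> is the order of the Bessel
  kernel.\<close>

locale noncentral_wishart = prob_space M for M :: "'w measure" +
  fixes s q L :: nat and X :: "nat \<times> nat \<Rightarrow> 'w \<Rightarrow> complex" and \<mu> :: "nat \<times> nat \<Rightarrow> complex"
    and \<xi> :: "nat \<Rightarrow> real"
  assumes s: "1 \<le> s"
    and ind: "indep_vars (\<lambda>_. borel) X ({..<s} \<times> {..<q + s})"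
    and dis: "\<And>v. v \<in> {..<s} \<times> {..<q + s} \<Longrightarrow> distributed M lborel (X v) (\<lambda>z. ennreal (cn_density (\<mu> v) z))"
    and L: "L \<le> s" and \<xi>_nonneg: "\<And>j. 0 \<le> \<xi> j" and \<xi>_0: "\<And>j. L \<le> j \<Longrightarrow> \<xi> j = 0"
    and tr: "\<And>n. gramTr s (q + s) n (rvar \<mu>) = powsum s n (\<lambda>j. of_real (\<xi> j))"
begin

definition Xmat where "Xmat \<omega> = mat s (q + s) (\<lambda>v. X v \<omega>)"

text \<open>A pointwise choice, with no claim that it is measurable in \<omega>. Measurability is
  proved only for the symmetric products in \<open>good\<close>, where it descends from the matrix
  entries.\<close>

definition spec :: "'w \<Rightarrow> nat \<Rightarrow> real" where
  "spec \<omega> = (SOME w. (\<forall>j. 0 \<le> w j) \<and>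
    (\<forall>n. gramTr s (q + s) n (rvar (\<lambda>v. Xmat \<omega> $$ v)) = powsum s n (\<lambda>j. of_real (w j))) \<and>
    (\<forall>x. x < smallest_eigenvalue (Xmat \<omega> * mat_adjoint (Xmat \<omega>)) \<longleftrightarrow> (\<forall>j<s. x < w j)))"

lemma spec:
  "0 \<le> spec \<omega> j"
  "gramTr s (q + s) n (rvar (\<lambda>v. X v \<omega>)) = powsum s n (\<lambda>j. of_real (spec \<omega> j))"
  "x < smallest_eigenvalue (Xmat \<omega> * mat_adjoint (Xmat \<omega>)) \<longleftrightarrow> (\<forall>j<s. x < spec \<omega> j)"
proof -
  have "Xmat \<omega> \<in> carrier_mat s (q + s)" by (simp add: Xmat_def)
  from someI_ex[OF gram_spectrum[OF this s], folded spec_def]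
  have *: "\<forall>j. 0 \<le> spec \<omega> j"
    "\<forall>n. gramTr s (q + s) n (rvar (\<lambda>v. Xmat \<omega> $$ v)) = powsum s n (\<lambda>j. of_real (spec \<omega> j))"
    "\<forall>x. x < smallest_eigenvalue (Xmat \<omega> * mat_adjoint (Xmat \<omega>)) \<longleftrightarrow> (\<forall>j<s. x < spec \<omega> j)"
    by blast+
  show "0 \<le> spec \<omega> j"
    "x < smallest_eigenvalue (Xmat \<omega> * mat_adjoint (Xmat \<omega>)) \<longleftrightarrow> (\<forall>j<s. x < spec \<omega> j)"
    using *(1,3) by blast+
  have "gramTr s (q + s) n (rvar (\<lambda>v. Xmat \<omega> $$ v)) = gramTr s (q + s) n (rvar (\<lambda>v. X v \<omega>))"
    by (rule gramTr_cong) (simp add: rvar_def Xmat_def)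
  then show "gramTr s (q + s) n (rvar (\<lambda>v. X v \<omega>)) = powsum s n (\<lambda>j. of_real (spec \<omega> j))"
    using *(2) by simp
qed

text \<open>The Vandermonde product and the powers of \<xi> come from the confluent limit; the
  exponential compensates for the factors exp (- \<xi> j) that the kernel columns leave out.\<close>

definition nconst :: real where
  "nconst = vdm L \<xi> * (\<Prod>j<L. \<xi> j ^ (s - L)) * exp (\<Sum>j<s. \<xi> j)"

text \<open>Both sides are multilinear, not linear, in \<open>h\<close>, so \<open>good\<close> is extended by limits only.\<close>

definition good :: "(real \<Rightarrow> real) \<Rightarrow> bool" where
  "good h \<longleftrightarrow> (\<lambda>\<omega>. \<Prod>j<s. h (spec \<omega> j)) \<in> borel_measurable M \<and>
    nconst * expectation (\<lambda>\<omega>. \<Prod>j<s. h (spec \<omega> j)) = det (psi_mat q s L \<xi> h)"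

text \<open>The two halves meet here: the product of the \<open>p\<close> values is a combination of
  words in traces, its tilted expectation is the heat flow of these words on matrices, and
  \<open>heat_exp_words\<close> is the same expression on eigenvalues.\<close>

lemma good_poly_exp:
  assumes \<theta>: "0 < \<theta>"
  shows "good (\<lambda>w. poly p w * exp (- \<theta> * w))"
proof -
  define h where "h w = poly p w * exp (- \<theta> * w)" for w
  define \<tau> where "\<tau> = 1 / (1 + \<theta>)"
  have \<tau>: "0 < \<tau>" "\<theta> * \<tau> = 1 - \<tau>" using \<theta> by (auto simp: \<tau>_def field_simps)
  let ?I = "{..<s} \<times> {..<q + s}"
  let ?P = "map_poly of_real p :: complex poly"
  obtain cs where cs: "\<And>x. eval_words (\<lambda>n. powsum s n x) cs = (\<Prod>j<s. poly ?P (x j))"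
    using psum_expr_prod[of s ?P] unfolding psum_expr_def by blast
  define f where "f x = eval_words (\<lambda>n. gramTr s (q + s) n x) cs" for x
  interpret PX: power_sum_heat "gvars s (q + s)" "heatX s (q + s)" "\<lambda>x. 1" "gammaX s (q + s)" "gramTr s (q + s)" q
    by (rule power_sum_heat_X)
  have poly_fun_f: "poly_fun (gvars s (q + s)) f"
    unfolding f_def[abs_def] by (intro poly_fun_eval_words poly_fun_gramTr)
  define W where "W \<omega> = of_real (exp (- \<theta> * (\<Sum>v\<in>?I. (cmod (X v \<omega>))\<^sup>2))) * f (rvar (\<lambda>v. X v \<omega>))" for \<omega>
  have W: "W \<omega> = of_real (\<Prod>j<s. h (spec \<omega> j))" for \<omega>
  proof -
    have "of_real (\<Sum>v\<in>?I. (cmod (X v \<omega>))\<^sup>2) = (of_real (\<Sum>j<s. spec \<omega> j) :: complex)"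
      using spec(2)[of 1 \<omega>] unfolding gramTr_1 by (simp add: powsum_def)
    then have "(\<Sum>v\<in>?I. (cmod (X v \<omega>))\<^sup>2) = (\<Sum>j<s. spec \<omega> j)"
      by (rule of_real_eq_iff[THEN iffD1])
    then have "exp (- \<theta> * (\<Sum>v\<in>?I. (cmod (X v \<omega>))\<^sup>2)) = (\<Prod>j<s. exp (- \<theta> * spec \<omega> j))"
      by (simp only: sum_distrib_left exp_sum[OF finite_lessThan])
    moreover have "f (rvar (\<lambda>v. X v \<omega>)) = of_real (\<Prod>j<s. poly p (spec \<omega> j))"
      unfolding f_def spec(2) cs by (simp add: of_real_hom.poly_map_poly)
    ultimately show ?thesis
      unfolding W_def h_def prod.distrib by (simp only: of_real_mult mult.commute)
  qed
  note E = expectation_tilted_poly_fun[OF ind dis less_imp_le[OF \<theta>] \<tau>_def poly_fun_f, folded W_def]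
  obtain N0 where N0: "\<And>N. N \<ge> N0 \<Longrightarrow> expectation W =
      of_real (\<Prod>v\<in>?I. \<tau> * exp (- \<theta> * \<tau> * (cmod (\<mu> v))\<^sup>2)) *
      heat_exp (heatX s (q + s)) N (of_real \<tau>) f (rvar (\<lambda>v. \<tau> * \<mu> v))"
    using E(2) by blast
  \<comment> \<open>One cut-off that is large enough for the matrix expectation and for the
    eigenvalue determinant.\<close>
  define N where "N = max N0 (s * (s + degree p))"
  let ?U = "heat_exp_words q N (of_real \<tau>) cs (\<lambda>n. powsum s n (\<lambda>j. of_real (\<tau>\<^sup>2 * \<xi> j)))"
  have U: "heat_exp (heatX s (q + s)) N (of_real \<tau>) f (rvar (\<lambda>v. \<tau> * \<mu> v)) = ?U"
  proof -
    have "gramTr s (q + s) n (rvar (\<lambda>v. \<tau> * \<mu> v)) = powsum s n (\<lambda>j. of_real (\<tau>\<^sup>2 * \<xi> j))" for n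
      unfolding gramTr_scale tr by (simp add: powsum_def sum_distrib_left power_mult_distrib)
    then show ?thesis
      using PX.heat_exp_eval_words[of N "of_real \<tau>" cs "rvar (\<lambda>v. \<tau> * \<mu> v)"] by (simp add: f_def[abs_def])
  qed
  have c: "(\<Prod>v\<in>?I. \<tau> * exp (- \<theta> * \<tau> * (cmod (\<mu> v))\<^sup>2)) = \<tau> ^ (s * (s + q)) * exp (- (1 - \<tau>) * (\<Sum>j<s. \<xi> j))"
  proof -
    have "of_real (\<Sum>v\<in>?I. (cmod (\<mu> v))\<^sup>2) = (of_real (\<Sum>j<s. \<xi> j) :: complex)"
      using tr[of 1] unfolding gramTr_1 by (simp add: powsum_def)
    then have "(\<Sum>v\<in>?I. (cmod (\<mu> v))\<^sup>2) = (\<Sum>j<s. \<xi> j)"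
      by (rule of_real_eq_iff[THEN iffD1])
    moreover have "(\<Prod>v\<in>?I. \<tau> * exp (- \<theta> * \<tau> * (cmod (\<mu> v))\<^sup>2)) =
        \<tau> ^ card ?I * exp (- (\<theta> * \<tau>) * (\<Sum>v\<in>?I. (cmod (\<mu> v))\<^sup>2))"
      unfolding sum_distrib_left by (subst exp_sum) (simp_all add: prod.distrib)
    ultimately show ?thesis by (simp add: \<tau>(2) add.commute)
  qed
  have "of_real (expectation (\<lambda>\<omega>. \<Prod>j<s. h (spec \<omega> j))) = expectation W"
    unfolding W by (simp only: integral_complex_of_real)
  also have "\<dots> = of_real (\<tau> ^ (s * (s + q)) * exp (- (1 - \<tau>) * (\<Sum>j<s. \<xi> j))) * ?U"
    using N0[of N] unfolding U c by (simp add: N_def)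
  finally have "of_real (nconst * expectation (\<lambda>\<omega>. \<Prod>j<s. h (spec \<omega> j))) =
    of_real (vdm L \<xi> * (\<Prod>j<L. \<xi> j ^ (s - L)) * (\<tau> ^ (s * (s + q)) *
      (exp (\<Sum>j<s. \<xi> j) * exp (- (1 - \<tau>) * (\<Sum>j<s. \<xi> j))))) * ?U"
    by (simp only: nconst_def of_real_mult mult_ac)
  \<comment> \<open>The exponential in \<open>nconst\<close> and the one left by the tilted
    densities combine to the factor required by \<open>heat_exp_words_confluent\<close>.\<close>
  also have "exp (\<Sum>j<s. \<xi> j) * exp (- (1 - \<tau>) * (\<Sum>j<s. \<xi> j)) = exp (\<tau> * (\<Sum>j<s. \<xi> j))"
    by (simp add: algebra_simps flip: exp_add)
  also have "of_real (vdm L \<xi> * (\<Prod>j<L. \<xi> j ^ (s - L)) * (\<tau> ^ (s * (s + q)) * exp (\<tau> * (\<Sum>j<s. \<xi> j)))) * ?U =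
    of_real (det (psi_mat q s L \<xi> h))"
    unfolding h_def by (rule heat_exp_words_confluent[OF cs _ \<theta> \<tau>_def L \<xi>_nonneg \<xi>_0]) (simp add: N_def)
  finally have "nconst * expectation (\<lambda>\<omega>. \<Prod>j<s. h (spec \<omega> j)) = det (psi_mat q s L \<xi> h)"
    by (rule of_real_eq_iff[THEN iffD1])
  moreover have "(\<lambda>\<omega>. \<Prod>j<s. h (spec \<omega> j)) \<in> borel_measurable M"
  proof -
    have "(\<lambda>\<omega>. Re (W \<omega>)) \<in> borel_measurable M"
      using E(1) by measurable
    then show ?thesis by (simp only: W Re_complex_of_real)
  qed
  ultimately show ?thesis unfolding good_def h_def by blast
qed

text \<open>Dominated convergence on both sides, with B^s for the expectation and inside every entry
  for the determinant, which is continuous in its entries. Measurability passes to the pointwise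
  limit.\<close>

lemma good_limit:
  fixes h :: "nat \<Rightarrow> real \<Rightarrow> real"
  assumes g: "\<And>n. good (h n)" and m: "\<And>n. h n \<in> borel_measurable borel"
    and b: "\<And>n w. 0 \<le> w \<Longrightarrow> \<bar>h n w\<bar> \<le> B"
    and l: "\<And>w. 0 \<le> w \<Longrightarrow> (\<lambda>n. h n w) \<longlonglongrightarrow> h' w"
    and h': "h' \<in> borel_measurable borel"
  shows "good h'"
proof -
  have mg: "(\<lambda>\<omega>. \<Prod>j<s. h n (spec \<omega> j)) \<in> borel_measurable M" for n
    using g[of n] by (simp add: good_def)
  have lw: "(\<lambda>n. \<Prod>j<s. h n (spec \<omega> j)) \<longlonglongrightarrow> (\<Prod>j<s. h' (spec \<omega> j))" for \<omega>
    by (intro tendsto_prod l spec(1))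
  have mh': "(\<lambda>\<omega>. \<Prod>j<s. h' (spec \<omega> j)) \<in> borel_measurable M"
    by (rule borel_measurable_LIMSEQ_metric[OF mg lw])
  have "(\<lambda>n. expectation (\<lambda>\<omega>. \<Prod>j<s. h n (spec \<omega> j))) \<longlonglongrightarrow> expectation (\<lambda>\<omega>. \<Prod>j<s. h' (spec \<omega> j))"
  proof (rule integral_dominated_convergence[OF mh' mg, where w = "\<lambda>_. B ^ s"])
    show "AE \<omega> in M. norm (\<Prod>j<s. h n (spec \<omega> j)) \<le> B ^ s" for n
    proof (rule AE_I2)
      fix \<omega>
      have "(\<Prod>j<s. \<bar>h n (spec \<omega> j)\<bar>) \<le> (\<Prod>j<s. B)"
        by (intro prod_mono conjI abs_ge_zero b spec(1))
      then show "norm (\<Prod>j<s. h n (spec \<omega> j)) \<le> B ^ s" by (simp add: abs_prod)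
    qed
  qed (use lw in auto)
  then have "(\<lambda>n. nconst * expectation (\<lambda>\<omega>. \<Prod>j<s. h n (spec \<omega> j))) \<longlonglongrightarrow>
      nconst * expectation (\<lambda>\<omega>. \<Prod>j<s. h' (spec \<omega> j))"
    by (intro tendsto_intros)
  then have 1: "(\<lambda>n. det (psi_mat q s L \<xi> (h n))) \<longlonglongrightarrow> nconst * expectation (\<lambda>\<omega>. \<Prod>j<s. h' (spec \<omega> j))"
    using g by (simp add: good_def)
  have "(\<lambda>n. det (psi_mat q s L \<xi> (h n))) \<longlonglongrightarrow> det (psi_mat q s L \<xi> h')"
    unfolding psi_mat_def
  proof (rule tendsto_det)
    fix i j
    show "(\<lambda>n. if j < L then kint q (\<xi> j) (s - 1 - i + q) (h n)
        else wint (s - 1 - i + q + (s - 1 - j)) (h n) / (fact (s - 1 - j) * fact (s - 1 - j + q))) \<longlonglongrightarrow>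
      (if j < L then kint q (\<xi> j) (s - 1 - i + q) h'
        else wint (s - 1 - i + q + (s - 1 - j)) h' / (fact (s - 1 - j) * fact (s - 1 - j + q)))"
    proof (cases "j < L")
      case True
      then show ?thesis using wint_limit(2)[OF m b l h' \<xi>_nonneg] by simp
    next
      case False
      then show ?thesis using tendsto_divide[OF wint_limit(1)[OF m b l h'] tendsto_const] by simp
    qed
  qed
  from LIMSEQ_unique[OF 1 this] show ?thesis
    using mh' by (simp add: good_def)
qed

text \<open>All powers exp (- k w) are put over one tilt, exp (- (n + 1) w) times exp ((n + 1 - k)
  w), and the second factor is expanded in its Taylor series. The common tilt keeps each approximant
  of the form covered by \<open>good_poly_exp\<close>, sums not being available. For w \<ge> 0 the
  partial sums stay below the full exponential, which gives the uniform bound.\<close>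

lemma good_poly_of_exp: "good (\<lambda>w. poly P (exp (- w)))"
proof -
  define n where "n = degree P"
  \<comment> \<open>With n + 1 in place of n the tilt stays positive even for a constant
    polynomial.\<close>
  define a where "a k = real (Suc n - k)" for k
  define p where "p N = (\<Sum>k\<le>n. \<Sum>m\<le>N. monom (coeff P k * (a k ^ m / fact m)) m)" for N
  define h where "h N w = poly (p N) w * exp (- real (Suc n) * w)" for N w
  have h: "h N w = (\<Sum>k\<le>n. coeff P k * ((\<Sum>m\<le>N. (a k * w) ^ m / fact m) * exp (- real (Suc n) * w)))" for N w
    by (simp add: h_def p_def poly_sum poly_monom sum_distrib_left sum_distrib_right power_mult_distrib mult_ac)
  have lim: "(\<lambda>N. \<Sum>m\<le>N. (a k * w) ^ m / fact m) \<longlonglongrightarrow> exp (a k * w)" for k w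
  proof -
    have "(\<lambda>m. (a k * w) ^ m / fact m) sums exp (a k * w)"
      using exp_converges[of "a k * w"] by (simp add: field_simps)
    then show ?thesis by (simp add: sums_def_le)
  qed
  have e: "exp (a k * w) * exp (- real (Suc n) * w) = exp (- w) ^ k" if "k \<le> n" for k w
    using that by (simp add: a_def of_nat_diff algebra_simps flip: exp_add exp_of_nat_mult)
  show ?thesis
  proof (rule good_limit[of h])
    show "good (h N)" for N
      unfolding h_def by (rule good_poly_exp) simp
    show "h N \<in> borel_measurable borel" for N
      unfolding h_def poly_altdef by measurable
    show "(\<lambda>w. poly P (exp (- w))) \<in> borel_measurable borel"
      unfolding poly_altdef by measurable
    fix w :: real assume w: "0 \<le> w"
    show "\<bar>h N w\<bar> \<le> (\<Sum>k\<le>n. \<bar>coeff P k\<bar>)" for N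
    proof -
      have "\<bar>coeff P k * ((\<Sum>m\<le>N. (a k * w) ^ m / fact m) * exp (- real (Suc n) * w))\<bar> \<le> \<bar>coeff P k\<bar>" if k: "k \<le> n" for k
      proof -
        have nn: "0 \<le> (a k * w) ^ m / fact m" for m using w by (simp add: a_def)
        have "(\<Sum>m\<le>N. (a k * w) ^ m / fact m) \<le> exp (a k * w)"
          by (rule incseq_le[OF incseq_SucI lim]) (simp only: sum.atMost_Suc le_add_same_cancel1 nn)
        then have "(\<Sum>m\<le>N. (a k * w) ^ m / fact m) * exp (- real (Suc n) * w) \<le> exp (- w) ^ k"
          unfolding e[OF k, symmetric] by (rule mult_right_mono) simp
        also have "\<dots> \<le> 1" using w by (intro power_le_one) auto
        finally have "(\<Sum>m\<le>N. (a k * w) ^ m / fact m) * exp (- real (Suc n) * w) \<le> 1" .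
        moreover have "0 \<le> (\<Sum>m\<le>N. (a k * w) ^ m / fact m) * exp (- real (Suc n) * w)"
          by (intro mult_nonneg_nonneg sum_nonneg nn) auto
        ultimately show ?thesis by (simp add: abs_mult mult_left_le)
      qed
      then show ?thesis unfolding h by (intro order_trans[OF sum_abs] sum_mono) auto
    qed
    have "(\<lambda>N. h N w) \<longlonglongrightarrow> (\<Sum>k\<le>n. coeff P k * (exp (a k * w) * exp (- real (Suc n) * w)))"
      unfolding h by (intro tendsto_intros lim)
    also have "(\<Sum>k\<le>n. coeff P k * (exp (a k * w) * exp (- real (Suc n) * w))) = poly P (exp (- w))"
      unfolding poly_altdef n_def[symmetric] by (intro sum.cong refl) (simp only: e atMost_iff)
    finally show "(\<lambda>N. h N w) \<longlonglongrightarrow> poly P (exp (- w))" .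
  qed
qed

text \<open>The substitution y = exp (- w) maps the half-line into the unit interval, where
  Bernstein polynomials converge uniformly and hence boundedly. Setting the function to 0 for w < 0
  keeps it Borel, although \<open>H\<close> is controlled only on \<open>{0..1}\<close>.\<close>

lemma good_continuous:
  assumes H: "continuous_on {0..1} H"
  shows "good (\<lambda>w. if 0 \<le> w then H (exp (- w)) else 0)"
proof -
  define P where "P n = (\<Sum>k\<le>n. Polynomial.smult (H (k / n) * real (n choose k)) ([:0, 1:] ^ k * [:1, -1:] ^ (n - k)))" for n :: nat
  have P: "poly (P n) y = (\<Sum>k\<le>n. H (k / n) * Bernstein n k y)" for n y
    by (simp add: P_def poly_sum Bernstein_def mult_ac)
  have "\<exists>n. \<forall>y\<in>{0..1}. \<bar>H y - poly (P n) y\<bar> < inverse (real (Suc i))" for i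
  proof -
    obtain N where "\<forall>n y. N \<le> n \<and> y \<in> {0..1} \<longrightarrow> \<bar>H y - poly (P n) y\<bar> < inverse (real (Suc i))"
      using Bernstein_Weierstrass[OF H, of "inverse (real (Suc i))"] unfolding P by auto
    then show ?thesis by (intro exI[of _ N]) blast
  qed
  then obtain n where n: "\<And>i y. y \<in> {0..1} \<Longrightarrow> \<bar>H y - poly (P (n i)) y\<bar> < inverse (real (Suc i))"
    by metis
  obtain B where "\<forall>z\<in>H ` {0..1}. norm z \<le> B"
    using compact_imp_bounded[OF compact_continuous_image[OF H compact_Icc]]
    unfolding bounded_iff by blast
  then have B: "\<bar>H y\<bar> \<le> B" if "y \<in> {0..1}" for y
    using that by auto
  show ?thesis
  proof (rule good_limit[of "\<lambda>i w. poly (P (n i)) (exp (- w))"])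
    show "good (\<lambda>w. poly (P (n i)) (exp (- w)))" for i by (rule good_poly_of_exp)
    show "(\<lambda>w. poly (P (n i)) (exp (- w))) \<in> borel_measurable borel" for i
      unfolding poly_altdef by measurable
    have "continuous_on {0..} (\<lambda>w. H (exp (- w)))"
      by (rule continuous_on_compose2[OF H]) (auto intro!: continuous_intros)
    then have "(\<lambda>w. if w \<in> {0..} then H (exp (- w)) else 0) \<in> borel_measurable borel"
      by (intro borel_measurable_continuous_on_if) auto
    then show "(\<lambda>w. if 0 \<le> w then H (exp (- w)) else 0) \<in> borel_measurable borel" by simp
    fix w :: real assume w: "0 \<le> w"
    then have y: "exp (- w) \<in> {0..1}" by auto
    show "\<bar>poly (P (n i)) (exp (- w))\<bar> \<le> B + 1" for i
    proof -
      have "inverse (real (Suc i)) \<le> 1" by (simp add: inverse_le_1_iff)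
      then show ?thesis using n[OF y, of i] B[OF y] by linarith
    qed
    have "(\<lambda>i. H (exp (- w)) - poly (P (n i)) (exp (- w))) \<longlonglongrightarrow> 0"
      by (rule tendsto_rabs_zero_cancel, rule tendsto_sandwich[OF _ _ tendsto_const LIMSEQ_inverse_real_of_nat])
        (use n[OF y] in \<open>auto intro!: eventuallyI less_imp_le\<close>)
    from tendsto_diff[OF tendsto_const[of "H (exp (- w))"] this]
    show "(\<lambda>i. poly (P (n i)) (exp (- w))) \<longlonglongrightarrow> (if 0 \<le> w then H (exp (- w)) else 0)" using w by simp
  qed
qed

text \<open>The ramps are continuous in y = exp (- w), vanish for 0 \<le> w \<le> x, and equal 1 at
  any given w > x once i is large. Vanishing at w = x itself selects the open half-line, hence a
  strict inequality for the smallest eigenvalue.\<close>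

lemma good_indicator:
  assumes x: "0 \<le> x"
  shows "good (indicator {x<..})"
proof (rule good_limit[of "\<lambda>i w. if 0 \<le> w then min 1 (real i * max 0 (exp (- x) - exp (- w))) else 0"])
  show "good (\<lambda>w. if 0 \<le> w then min 1 (real i * max 0 (exp (- x) - exp (- w))) else 0)" for i
    by (rule good_continuous[of "\<lambda>y. min 1 (real i * max 0 (exp (- x) - y))"]) (auto intro!: continuous_intros)
  show "(\<lambda>w. if 0 \<le> w then min 1 (real i * max 0 (exp (- x) - exp (- w))) else 0) \<in> borel_measurable borel" for i
    by measurable
  fix w :: real assume w: "0 \<le> w"
  then show "\<bar>if 0 \<le> w then min 1 (real i * max 0 (exp (- x) - exp (- w))) else 0\<bar> \<le> 1" for i
    by auto
  show "(\<lambda>i. if 0 \<le> w then min 1 (real i * max 0 (exp (- x) - exp (- w))) else 0) \<longlonglongrightarrow> indicator {x<..} w"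
  proof (cases "x < w")
    case True
    then have d: "exp (- x) - exp (- w) > 0" by simp
    then obtain n where "1 \<le> real n * (exp (- x) - exp (- w))"
      using reals_Archimedean3[OF d] by (metis less_imp_le)
    then have "\<forall>\<^sub>F i in sequentially. (if 0 \<le> w then min 1 (real i * max 0 (exp (- x) - exp (- w))) else 0) = 1"
      using d w by (intro eventually_sequentiallyI[of n])
        (auto simp: min_def max_def intro: order_trans[OF _ mult_right_mono])
    then show ?thesis using True by (simp add: tendsto_eventually)
  next
    case False
    then have "max 0 (exp (- x) - exp (- w)) = 0" by simp
    then show ?thesis using False w by simp
  qed
qed (auto intro!: borel_measurable_indicator)

lemma det_psi_indicator:
  assumes "0 \<le> x"
  shows "nconst * prob {\<omega> \<in> space M. x < smallest_eigenvalue (Xmat \<omega> * mat_adjoint (Xmat \<omega>))} =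
      det (psi_mat q s L \<xi> (indicator {x<..}))"
    and "{\<omega> \<in> space M. x < smallest_eigenvalue (Xmat \<omega> * mat_adjoint (Xmat \<omega>))} \<in> events"
proof -
  let ?E = "{\<omega> \<in> space M. x < smallest_eigenvalue (Xmat \<omega> * mat_adjoint (Xmat \<omega>))}"
  have i: "(\<Prod>j<s. indicator {x<..} (spec \<omega> j)) = (indicator ?E \<omega> :: real)" if "\<omega> \<in> space M" for \<omega>
    using that by (auto simp: spec(3) indicator_def prod_zero_iff)
  have g: "(\<lambda>\<omega>. \<Prod>j<s. indicator {x<..} (spec \<omega> j) :: real) \<in> borel_measurable M"
    "nconst * expectation (\<lambda>\<omega>. \<Prod>j<s. indicator {x<..} (spec \<omega> j)) = det (psi_mat q s L \<xi> (indicator {x<..}))"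
    using good_indicator[OF assms] by (auto simp: good_def)
  \<comment> \<open>The event is measurable because its indicator is a limit of symmetric products;
    measurability of the eigenvalues is not invoked.\<close>
  from g(1) have "(indicator ?E :: _ \<Rightarrow> real) \<in> borel_measurable M"
    by (subst (asm) measurable_cong[OF i]) auto
  then show E: "?E \<in> events"
    by (subst (asm) borel_measurable_indicator_iff) (auto simp: Int_absorb2)
  have "expectation (\<lambda>\<omega>. \<Prod>j<s. indicator {x<..} (spec \<omega> j)) = (expectation (indicator ?E) :: real)"
    by (rule Bochner_Integration.integral_cong[OF refl i])
  also have "\<dots> = prob ?E" using E by simp
  finally show "nconst * prob ?E = det (psi_mat q s L \<xi> (indicator {x<..}))" using g(2) by simp
qed

lemma det_psi_1: "nconst = det (psi_mat q s L \<xi> (\<lambda>_. 1))"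
  using good_poly_of_exp[of 1] by (simp add: good_def prob_space)

end

section \<open>The Nuttall function and the main theorem\<close>

lemma besselI_eq: "besselI q z = (z / 2) ^ q * nu0 q (z\<^sup>2 / 4)"
proof -
  have "(z / 2)\<^sup>2 = z\<^sup>2 / 4" by (simp add: power_divide)
  then have "(z / 2) ^ (2 * k + q) / (fact k * fact (k + q)) = (z / 2) ^ q * ((z\<^sup>2 / 4) ^ k / (fact k * fact (k + q)))" for k
    by (simp only: power_add power_mult) simp
  then show ?thesis
    unfolding besselI_def nu0_def by (simp only: suminf_mult[OF nu0_summable])
qed

lemma isCont_nu0: "isCont (nu0 q) z"
proof -
  have "summable (\<lambda>k. inverse (fact k * fact (k + q)) * (\<bar>z\<bar> + 1) ^ k)"
    using nu0_summable[of "\<bar>z\<bar> + 1" q] by (simp add: field_simps)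
  then have "isCont (\<lambda>z. \<Sum>k. inverse (fact k * fact (k + q)) * z ^ k) z"
    by (rule isCont_powser) simp
  then show ?thesis unfolding nu0_def[abs_def] by (simp add: field_simps)
qed

lemma nu0_nonneg: "0 \<le> z \<Longrightarrow> 0 \<le> nu0 q z"
  unfolding nu0_def by (intro suminf_nonneg nu0_summable) auto

lemma set_lebesgue_integral_Ici_Ioi:
  fixes f :: "real \<Rightarrow> real"
  shows "(LINT u:{x..}|lborel. f u) = (LINT u:{x<..}|lborel. f u)"
  unfolding set_lebesgue_integral_def
proof (rule integral_discrete_difference[where X = "{x}"])
  show "indicat_real {x..} u *\<^sub>R f u = indicat_real {x<..} u *\<^sub>R f u" if "u \<notin> {x}" for u
    using that by (auto simp: indicator_def)
qed auto

lemma wint_indicator: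
  assumes "0 \<le> x"
  shows "wint k (\<lambda>w. g w * indicator {x<..} w) = (LINT u:{x..}|lborel. u ^ k * exp (- u) * g u)"
  unfolding set_lebesgue_integral_Ici_Ioi unfolding wint_def set_lebesgue_integral_def
  using assms by (intro Bochner_Integration.integral_cong refl) (auto simp: indicator_def)

lemma wint_1: "wint k g = (LINT u:{0..}|lborel. u ^ k * exp (- u) * g u)"
  unfolding wint_def set_lebesgue_integral_def by (simp add: mult_ac)

text \<open>The substitution y = sqrt (2 u) turns the product of the two arguments, squared and
  divided by 4, into l u, so the Bessel function becomes \<open>nu0 q (l * u)\<close> times powers
  of l and u.\<close>

lemma nuttallQ_eq:
  assumes l: "0 < l" and x: "0 \<le> x"
  shows "nuttallQ (2 * n + q + 1) q (sqrt (2 * l)) (sqrt (2 * x)) =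
    2 ^ (n + q) * exp (- l) * sqrt (l / 2) ^ q * (LINT u:{x..}|lborel. u ^ (n + q) * exp (- u) * nu0 q (l * u))"
proof -
  define C where "C = 2 ^ (n + q) * exp (- l) * sqrt (l / 2) ^ q"
  define p where "p = 2 * n + q + 1"
  define F where "F y = y ^ p * exp (- (y\<^sup>2 + (sqrt (2 * l))\<^sup>2) / 2) * besselI q (sqrt (2 * l) * y)" for y
  define f where "f u = u ^ (n + q) * exp (- u) * nu0 q (l * u)" for u
  have s2: "sqrt (2 * l) = 2 * sqrt (l / 2)"
    using real_sqrt_mult[of 4 "l / 2"] by simp
  have Ff: "F (sqrt (2 * u)) * (1 / sqrt (2 * u)) = C * f u" if u: "0 < u" for u
  proof -
    have 1: "sqrt (2 * l) * sqrt (2 * u) / 2 = sqrt (l / 2) * sqrt (2 * u)"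
      by (simp only: s2)
    have 2: "(sqrt (2 * l) * sqrt (2 * u))\<^sup>2 / 4 = l * u"
      using l u by (simp add: power_mult_distrib)
    \<comment> \<open>The total exponent p + q is odd; the square root left over cancels the
      Jacobian 1 / sqrt (2 u).\<close>
    have "sqrt (2 * u) ^ p * sqrt (2 * u) ^ q = sqrt (2 * u) ^ (2 * (n + q) + 1)"
      unfolding p_def power_add[symmetric] by (rule arg_cong2[where f = "(^)"]) auto
    also have "\<dots> = (2 * u) ^ (n + q) * sqrt (2 * u)"
      using u by (simp only: power_add power_mult power_one_right real_sqrt_pow2)
    finally have 3: "sqrt (2 * u) ^ p * sqrt (2 * u) ^ q = (2 * u) ^ (n + q) * sqrt (2 * u)" .
    have 4: "exp (- ((sqrt (2 * u))\<^sup>2 + (sqrt (2 * l))\<^sup>2) / 2) = exp (- u) * exp (- l)"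
      using l u by (simp add: field_simps flip: exp_add)
    have "F (sqrt (2 * u)) = (sqrt (2 * u) ^ p * sqrt (2 * u) ^ q) * (exp (- u) * exp (- l)) * (sqrt (l / 2) ^ q * nu0 q (l * u))"
      unfolding F_def besselI_eq 1 2 4 power_mult_distrib[of "sqrt (l / 2)"] by (simp only: mult_ac)
    then have "F (sqrt (2 * u)) * (1 / sqrt (2 * u)) =
      (2 * u) ^ (n + q) * (exp (- u) * exp (- l)) * (sqrt (l / 2) ^ q * nu0 q (l * u)) * (sqrt (2 * u) * (1 / sqrt (2 * u)))"
      unfolding 3 by (simp only: mult_ac)
    also have "sqrt (2 * u) * (1 / sqrt (2 * u)) = 1" using u by simp
    finally show ?thesis
      by (simp only: C_def f_def power_mult_distrib mult_ac mult_1_right)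
  qed
  have f_int: "integrable lborel (\<lambda>u. indicator {x<..} u *\<^sub>R f u)"
  proof -
    have "integrable lborel (\<lambda>w. indicator {0..} w * (w ^ (n + q) * exp (- w) * (nu0 q (l * w) * indicator {x<..} w)))"
      using l by (intro kint_sums_aux(2)[where B = 1]) (auto simp: indicator_def)
    also have "(\<lambda>w. indicator {0..} w * (w ^ (n + q) * exp (- w) * (nu0 q (l * w) * indicator {x<..} w))) =
      (\<lambda>u. indicator {x<..} u *\<^sub>R f u)"
      using x by (auto simp: indicator_def f_def)
    finally show ?thesis .
  qed
  have ind: "indicator {x<..} u *\<^sub>R (F (sqrt (2 * u)) * (1 / sqrt (2 * u))) = C * (indicator {x<..} u *\<^sub>R f u)" for u
    using Ff[of u] x by (auto simp: indicator_def)
  have ein: "einterval (ereal x) \<infinity> = {x<..}"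
    by (auto simp: einterval_def)
  have "(LBINT y=ereal (sqrt (2 * x))..\<infinity>. F y) = (LBINT u=ereal x..\<infinity>. F (sqrt (2 * u)) * (1 / sqrt (2 * u)))"
  proof (rule interval_integral_substitution_nonneg(2))
    show "ereal x < \<infinity>" by simp
    show "DERIV (\<lambda>u. sqrt (2 * u)) u :> 1 / sqrt (2 * u)" if "ereal x < ereal u" for u
      using that x by (auto intro!: derivative_eq_intros simp: field_simps)
    show "isCont F (sqrt (2 * u))" for u
    proof -
      have "isCont (\<lambda>y. (sqrt (2 * l) * y)\<^sup>2 / 4) (sqrt (2 * u))"
        by (intro continuous_intros) simp
      from isCont_o2[OF this isCont_nu0]
      show ?thesis unfolding F_def besselI_eq by (intro continuous_intros) simp_all
    qed
    show "isCont (\<lambda>u. 1 / sqrt (2 * u)) u" if "ereal x < ereal u" for u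
      using that x by (intro continuous_intros) auto
    show "0 \<le> F (sqrt (2 * u))" if "ereal x < ereal u" for u
      unfolding F_def besselI_eq using that x l
      by (intro mult_nonneg_nonneg nu0_nonneg) auto
    show "0 \<le> 1 / sqrt (2 * u)" if "ereal x \<le> ereal u" for u using that x by simp
    show "((ereal \<circ> (\<lambda>u. sqrt (2 * u)) \<circ> real_of_ereal) \<longlongrightarrow> ereal (sqrt (2 * x))) (at_right (ereal x))"
      unfolding ereal_tendsto_simps by (intro tendsto_intros)
    have "filterlim (\<lambda>u :: real. sqrt (2 * u)) at_top at_top"
      by (rule filterlim_compose[OF sqrt_at_top])
        (rule filterlim_tendsto_pos_mult_at_top[OF tendsto_const _ filterlim_ident], simp)
    then show "((ereal \<circ> (\<lambda>u. sqrt (2 * u)) \<circ> real_of_ereal) \<longlongrightarrow> \<infinity>) (at_left \<infinity>)"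
      unfolding ereal_tendsto_simps .
    show "set_integrable lborel (einterval (ereal x) \<infinity>) (\<lambda>u. F (sqrt (2 * u)) * (1 / sqrt (2 * u)))"
      unfolding set_integrable_def ein ind by (intro integrable_mult_right f_int)
  qed
  also have "\<dots> = C * (LINT u:{x<..}|lborel. f u)"
    unfolding interval_integral_to_infinity_eq set_lebesgue_integral_def ind
    by (rule integral_mult_right_zero)
  finally have "(LINT y:{sqrt (2 * x)..}|lborel. F y) = C * (LINT u:{x..}|lborel. f u)"
    unfolding set_lebesgue_integral_Ici_Ioi interval_integral_to_infinity_eq .
  then show ?thesis unfolding nuttallQ_def F_def f_def C_def p_def .
qed

text \<open>The matrices differ by nonzero column factors only: the row-dependent power of 2 in
  \<open>Psi\<close> cancels exactly the power 2^(n + q / 2), n = s - 1 - i, left over by the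
  Nuttall function.\<close>

lemma Psi_factorization:
  fixes lam :: "nat \<Rightarrow> real"
  assumes L: "L \<le> s" and pos: "\<And>j. 1 \<le> j \<Longrightarrow> j \<le> L \<Longrightarrow> lam j > 0"
  defines "\<xi> \<equiv> \<lambda>j. if j < L then lam (Suc j) else 0"
  shows "\<exists>D\<noteq>0. (\<forall>x\<ge>0. det (Psi s (q + s) L lam x) = D * det (psi_mat q s L \<xi> (indicator {x<..}))) \<and>
    det (Psi s (q + s) L lam 0) = D * det (psi_mat q s L \<xi> (\<lambda>_. 1))"
proof -
  \<comment> \<open>In a Nuttall column, the part of the prefactor that does not depend on the row;
    in a gamma column, the factorials by which \<open>psi_mat\<close> divides.\<close>
  define d where "d j = (if j < L then exp (- \<xi> j) * sqrt (\<xi> j) ^ q else fact (s - 1 - j) * fact (s - 1 - j + q))" for j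
  have \<xi>_pos: "0 < \<xi> j" if "j < L" for j using pos[of "Suc j"] that by (simp add: \<xi>_def)
  have d0: "d j \<noteq> 0" for j using \<xi>_pos[of j] by (auto simp: d_def)
  have N: "Psi s (q + s) L lam x $$ (i, j) =
      d j * (LINT u:{x..}|lborel. u ^ (s - 1 - i + q) * exp (- u) * nu0 q (\<xi> j * u))"
    if "i < s" "j < s" "j < L" "0 \<le> x" for i j x
  proof -
    define n where "n = s - 1 - i"
    define J where "J = (LINT u:{x..}|lborel. u ^ (n + q) * exp (- u) * nu0 q (\<xi> j * u))"
    have n: "s + (q + s) - 2 * (i + 1) + 1 = 2 * n + q + 1" "q + s - s = q"
      using that by (auto simp: n_def)
    have e: "(2 * real (i + 1) - real s - real (q + s)) / 2 = - (real n + real q / 2)"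
      using that by (simp add: n_def of_nat_diff field_simps)
    have "Psi s (q + s) L lam x $$ (i, j) = 2 powr ((2 * real (i + 1) - real s - real (q + s)) / 2) *
      nuttallQ (s + (q + s) - 2 * (i + 1) + 1) (q + s - s) (sqrt (2 * \<xi> j)) (sqrt (2 * x))"
      using that by (simp add: Psi_def \<xi>_def)
    then have "Psi s (q + s) L lam x $$ (i, j) =
      2 powr (- (real n + real q / 2)) * nuttallQ (2 * n + q + 1) q (sqrt (2 * \<xi> j)) (sqrt (2 * x))"
      by (simp only: n e)
    also have "\<dots> = 2 powr (- (real n + real q / 2)) * (2 ^ (n + q) * exp (- \<xi> j) * sqrt (\<xi> j / 2) ^ q) * J"
      unfolding nuttallQ_eq[OF \<xi>_pos[OF that(3)] that(4)] J_def by (simp only: mult.assoc)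
    also have "2 powr (- (real n + real q / 2)) * (2 ^ (n + q) * exp (- \<xi> j) * sqrt (\<xi> j / 2) ^ q) = d j"
    proof -
      have "(2 :: real) ^ (n + q) = 2 powr (real n + real q / 2) * 2 powr (real q / 2)"
        by (simp add: add.commute flip: powr_realpow powr_add)
      moreover have "sqrt (\<xi> j / 2) ^ q = sqrt (\<xi> j) ^ q / 2 powr (real q / 2)"
      proof -
        have "sqrt 2 ^ q = 2 powr (real q / 2)"
          by (simp add: powr_half_sqrt[symmetric] powr_powr flip: powr_realpow)
        then show ?thesis by (simp add: real_sqrt_divide power_divide)
      qed
      moreover have "2 powr (- a) * (2 powr a * 2 powr b * e * (r / 2 powr b)) = e * r" for a b e r :: real
        by (simp add: powr_minus)
      ultimately show ?thesis
        using that(3) by (simp only: d_def if_True)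
    qed
    finally show ?thesis by (simp only: J_def n_def)
  qed
  have G: "Psi s (q + s) L lam x $$ (i, j) =
      d j * ((LINT u:{x..}|lborel. u ^ (s - 1 - i + q + (s - 1 - j)) * exp (- u)) / (fact (s - 1 - j) * fact (s - 1 - j + q)))"
    if "i < s" "j < s" "\<not> j < L" for i j x
  proof -
    have "q + s + s - (i + 1) - (j + 1) + 1 - 1 = s - 1 - i + q + (s - 1 - j)"
      using that by simp
    moreover have "Psi s (q + s) L lam x $$ (i, j) = upper_inc_Gamma (q + s + s - (i + 1) - (j + 1) + 1) x"
      using that by (simp add: Psi_def)
    ultimately show ?thesis
      using that d0[of j] unfolding upper_inc_Gamma_def by (simp only: d_def if_False) simp
  qed
  \<comment> \<open>A general \<open>h\<close> covers both uses: the indicator of the open half-line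
    for x \<ge> 0, and the constant 1 at x = 0.\<close>
  have fac: "det (Psi s (q + s) L lam x) = (\<Prod>j<s. d j) * det (psi_mat q s L \<xi> h)"
    if x: "0 \<le> x" and h: "\<And>k g. wint k (\<lambda>w. g w * h w) = (LINT u:{x..}|lborel. u ^ k * exp (- u) * g u)" for x h
  proof -
    have w: "wint k h = (LINT u:{x..}|lborel. u ^ k * exp (- u))" for k
      using h[of k "\<lambda>_. 1"] by simp
    have P: "Psi s (q + s) L lam x $$ (i, j) = d j * psi_mat q s L \<xi> h $$ (i, j)" if "i < s" "j < s" for i j
      using that N[OF that _ x] G[OF that, of x] by (simp add: psi_mat_def kint_def h w)
    have "Psi s (q + s) L lam x \<in> carrier_mat s s" "psi_mat q s L \<xi> h \<in> carrier_mat s s"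
      by (simp_all add: Psi_def psi_mat_def)
    note D = this[THEN det_col]
    have "det (Psi s (q + s) L lam x) = (\<Sum>p | p permutes {0..<s}. signof p * (\<Prod>j<s. d j * psi_mat q s L \<xi> h $$ (p j, j)))"
      unfolding D(1)
    proof (intro sum.cong refl arg_cong2[where f = "(*)"] prod.cong)
      fix p j assume p: "p \<in> {p. p permutes {0..<s}}" and j: "j \<in> {..<s}"
      then have "p j < s" using permutes_in_image[of p "{0..<s}" j] by simp
      then show "Psi s (q + s) L lam x $$ (p j, j) = d j * psi_mat q s L \<xi> h $$ (p j, j)"
        using P j by simp
    qed
    also have "\<dots> = (\<Prod>j<s. d j) * det (psi_mat q s L \<xi> h)"
      unfolding D(2) prod.distrib sum_distrib_left by (simp only: mult_ac)
    finally show ?thesis .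
  qed
  show ?thesis
  proof (intro exI[of _ "\<Prod>j<s. d j"] conjI allI impI)
    show "(\<Prod>j<s. d j) \<noteq> 0" using d0 by simp
    show "det (Psi s (q + s) L lam x) = (\<Prod>j<s. d j) * det (psi_mat q s L \<xi> (indicator {x<..}))" if "0 \<le> x" for x
      by (rule fac[OF that wint_indicator[OF that]])
    show "det (Psi s (q + s) L lam 0) = (\<Prod>j<s. d j) * det (psi_mat q s L \<xi> (\<lambda>_. 1))"
      by (rule fac) (simp_all add: wint_1)
  qed
qed

text \<open>The factorised characteristic polynomial lists the values \<open>lam\<close> followed by
  s - L zeros; \<open>lam\<close> counts from 1 and the list from 0, hence the
  \<open>Suc\<close>.\<close>

lemma gramTr_mean:
  fixes A :: "complex mat" and lam :: "nat \<Rightarrow> real"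
  assumes A: "A \<in> carrier_mat s t" and L: "L \<le> s"
    and c: "char_poly (A * mat_adjoint A) =
      monom 1 (s - L) * (\<Prod>j\<in>{1..L}. [: - complex_of_real (lam j), 1 :])"
  shows "gramTr s t n (rvar (\<lambda>v. A $$ v)) =
    powsum s n (\<lambda>j. of_real (if j < L then lam (Suc j) else 0))"
proof -
  define es where "es = map (\<lambda>j. complex_of_real (lam (Suc j))) [0..<L] @ replicate (s - L) 0"
  have S: "A * mat_adjoint A \<in> carrier_mat s s"
    using A mat_adjoint_carrier[OF A] by auto
  have "(\<Prod>a\<leftarrow>es. [:- a, 1:]) = (\<Prod>j\<leftarrow>[0..<L]. [:- complex_of_real (lam (Suc j)), 1:]) * [:0, 1:] ^ (s - L)"
    by (simp add: es_def comp_def map_replicate_const)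
  also have "(\<Prod>j\<leftarrow>[0..<L]. [:- complex_of_real (lam (Suc j)), 1:]) = (\<Prod>j\<in>{1..L}. [: - complex_of_real (lam j), 1 :])"
    by (subst prod.distinct_set_conv_list[symmetric])
      (auto intro!: prod.reindex_bij_witness[of _ "\<lambda>j. j - 1" Suc])
  also have "[:0, 1:] ^ (s - L) = (monom 1 (s - L) :: complex poly)"
    by (simp add: monom_altdef)
  finally have "char_poly (A * mat_adjoint A) = (\<Prod>a\<leftarrow>es. [:- a, 1:])"
    by (simp only: c mult.commute)
  from diag_sum_pow_char_poly(2)[OF S this] show ?thesis
    unfolding gramTr_eq_diag_sum[OF A] powsum_def
    using L by (auto simp: es_def nth_append intro!: sum.cong)
qed

theorem theorem1:
  fixes M :: "'w measure"
    and s t L :: nat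
    and Mm :: "complex mat"
    and X :: "nat \<Rightarrow> nat \<Rightarrow> 'w \<Rightarrow> complex"
    and lam :: "nat \<Rightarrow> real"
  assumes "prob_space M"
    and "1 \<le> s" and "s \<le> t"
    and "Mm \<in> carrier_mat s t"
    and "prob_space.indep_vars M (\<lambda>_. borel) (\<lambda>(i, j). X i j) ({0..<s} \<times> {0..<t})"
    and "\<And>i j. i < s \<Longrightarrow> j < t \<Longrightarrow>
           distributed M lborel (X i j) (\<lambda>z. ennreal (cn_density (Mm $$ (i, j)) z))"
    and "L \<le> s"
    and "\<And>j. 1 \<le> j \<Longrightarrow> j < L \<Longrightarrow> lam j > lam (j + 1)"
    and "\<And>j. 1 \<le> j \<Longrightarrow> j \<le> L \<Longrightarrow> lam j > 0"
    and "char_poly (Mm * mat_adjoint Mm) =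
           monom 1 (s - L) * (\<Prod>j\<in>{1..L}. [: - complex_of_real (lam j), 1 :])"
  shows "\<And>x. x > 0 \<Longrightarrow>
      measure M {\<omega> \<in> space M.
         smallest_eigenvalue (mat s t (\<lambda>(i, j). X i j \<omega>) * mat_adjoint (mat s t (\<lambda>(i, j). X i j \<omega>))) \<le> x}
      = 1 - det (Psi s t L lam x) / det (Psi s t L lam 0)"
proof -
  fix x :: real assume x: "x > 0"
  define q where "q = t - s"
  have t: "t = q + s" using assms(3) by (simp add: q_def)
  define \<xi> where "\<xi> = (\<lambda>j. if j < L then lam (Suc j) else 0)"
  define Y where "Y = (\<lambda>(i, j). X i j)"
  have pos: "0 < \<xi> j" if "j < L" for j
    using assms(9)[of "Suc j"] that by (simp add: \<xi>_def)
  interpret noncentral_wishart M s q L Y "\<lambda>v. Mm $$ v" \<xi>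
  proof (intro noncentral_wishart.intro noncentral_wishart_axioms.intro assms(1,2,7))
    show "prob_space.indep_vars M (\<lambda>_. borel) Y ({..<s} \<times> {..<q + s})"
      using assms(5) by (simp add: Y_def t atLeast0LessThan)
    show "distributed M lborel (Y v) (\<lambda>z. ennreal (cn_density (Mm $$ v) z))" if "v \<in> {..<s} \<times> {..<q + s}" for v
      using that assms(6) by (auto simp: Y_def t)
    show "0 \<le> \<xi> j" for j using pos[of j] by (cases "j < L") (auto simp: \<xi>_def)
    show "L \<le> j \<Longrightarrow> \<xi> j = 0" for j by (simp add: \<xi>_def)
    show "gramTr s (q + s) n (rvar (\<lambda>v. Mm $$ v)) = powsum s n (\<lambda>j. of_real (\<xi> j))" for n
      using gramTr_mean[OF assms(4,7,10), of n] by (simp add: t \<xi>_def)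
  qed
  \<comment> \<open>Distinctness of the eigenvalues enters here: a coincidence would annihilate
    \<open>nconst\<close> and reduce the identity to 0 = 0.\<close>
  have "vdm L \<xi> \<noteq> 0"
  proof -
    have "\<xi> j < \<xi> i" if "i < j" "j < L" for i j
      using that
    proof (induction j)
      case (Suc j)
      have "\<xi> (Suc j) < \<xi> j" using assms(8)[of "Suc j"] Suc.prems by (simp add: \<xi>_def)
      then show ?case using Suc by (cases "i = j") auto
    qed simp
    then have "inj_on \<xi> {..<L}"
      by (intro linorder_inj_onI) (auto, metis less_irrefl)
    then show ?thesis by (simp add: vdm_eq_0)
  qed
  moreover have "\<xi> j \<noteq> 0" if "j < L" for j using pos[OF that] by simp
  ultimately have nc: "nconst \<noteq> 0"
    by (simp add: nconst_def)
  obtain D where D: "D \<noteq> 0" "\<And>x. 0 \<le> x \<Longrightarrow> det (Psi s t L lam x) = D * det (psi_mat q s L \<xi> (indicator {x<..}))"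
    "det (Psi s t L lam 0) = D * det (psi_mat q s L \<xi> (\<lambda>_. 1))"
    using Psi_factorization[of L s lam q] assms(7,9) unfolding t \<xi>_def by blast
  let ?E = "{\<omega> \<in> space M. x < smallest_eigenvalue (Xmat \<omega> * mat_adjoint (Xmat \<omega>))}"
  have E: "nconst * prob ?E = det (psi_mat q s L \<xi> (indicator {x<..}))" "?E \<in> events"
    using det_psi_indicator[of x] x by auto
  \<comment> \<open>Both determinants carry the factors \<open>D\<close> and \<open>nconst\<close>.
    These are nonzero, so the denominator is nonzero and they cancel.\<close>
  have "det (Psi s t L lam x) / det (Psi s t L lam 0) = prob ?E"
    using D(1) nc x by (simp add: D(2)[of x] D(3) E(1)[symmetric] det_psi_1[symmetric])
  moreover have "Xmat \<omega> = mat s t (\<lambda>(i, j). X i j \<omega>)" for \<omega>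
    by (subst Xmat_def) (simp add: Y_def t case_prod_unfold)
  moreover have "{\<omega> \<in> space M. smallest_eigenvalue (Xmat \<omega> * mat_adjoint (Xmat \<omega>)) \<le> x} = space M - ?E"
    by auto
  ultimately show "measure M {\<omega> \<in> space M.
         smallest_eigenvalue (mat s t (\<lambda>(i, j). X i j \<omega>) * mat_adjoint (mat s t (\<lambda>(i, j). X i j \<omega>))) \<le> x}
      = 1 - det (Psi s t L lam x) / det (Psi s t L lam 0)"
    using prob_compl[OF E(2)] by simp
qed

end
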